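(* Let $n\geq 2$ and $1<p<n$. Let $\Omega\subset\mathbb S^n$ be an open set such that $N\in\Omega$ and $|\Omega|<|\mathbb S^n|$, and let $a^\star\in(0,\pi)$ be such that $|\Omega|=|\mathcal B(a^\star)|$. Then for every $u\in W^{1,p}_0(\Omega)$, \[ \int_\Omega |\nabla u|^p\,dV \;\geq\; \left(\frac{n-p}{p}\right)^p\int_\Omega |u|^p\rho_{a^\star}^p\,dV . \] Moreover the constant $\left(\frac{n-p}{p}\right)^p$ is sharp (it cannot be replaced by a larger constant).
   Context: $\mathbb S^n=\{x\in\mathbb R^{n+1}: |x|=1\}$ is the unit $n$-sphere with its standard metric $g$, gradient $\nabla$, volume element $dV$, and $|E|$ denotes the Riemannian volume of $E\subset\mathbb S^n$. $N=(0,\dots,0,1)$ is the north pole; for $x\in\mathbb S^n$, $\theta\in[0,\pi]$ denotes the angle with $x_{n+1}=\cos\theta$ (so $\theta=d_g(x,N)$). For $\alpha\in(0,\pi]$, $\mathcal B(\alpha)=\{x\in\mathbb S^n: 0\le\theta<\alpha\}$. For $a\in(0,\pi)$ define $\widetilde\eta_a:(0,a)\to\mathbb R$ by \[ \widetilde\eta_a(t)=\frac{(\sin t)^{-\frac{n-1}{p-1}}}{\int_t^a(\sin s)^{-\frac{n-1}{p-1}}\,ds}. \] There is a unique $\widetilde T\in(0,a)$ such that $\widetilde\eta_a$ is strictly decreasing on $(0,\widetilde T)$ and strictly increasing on $(\widetilde T,a)$. Define the truncation $\widetilde\eta_{aT}(t)=\widetilde\eta_a(t)$ for $t\in(0,\widetilde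 T)$ and $\widetilde\eta_{aT}(t)=\widetilde\eta_a(\widetilde T)$ for $t\in[\widetilde T,a)$. With $a=a^\star$ and the corresponding $\widetilde T$, define $\rho_{a^\star}:\mathbb S^n\setminus\{N\}\to\mathbb R$ by $\rho_{a^\star}(x)=\frac{p-1}{n-p}\widetilde\eta_{a^\star T}(\theta)$ if $x\in\mathcal B(a^\star)\setminus\{N\}$ and $\rho_{a^\star}(x)=\frac{p-1}{n-p}\widetilde\eta_{a^\star T}(\widetilde T)$ if $x\in\mathbb S^n\setminus\mathcal B(a^\star)$. *)

theory Defs
  imports "HOL-Analysis.Analysis"
begin

text \<open>Points of R^(n+1) are represented as pairs (y, t) :: (real^'n) \<times> real, so that
  n = CARD('n), the last coordinate x_(n+1) is snd x, and the north pole is N = (0,1).\<close>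

definition north_pole :: "(real^'n) \<times> real" where
  "north_pole = (0, 1)"

text \<open>Riemannian volume measure on the unit sphere S^n in R^(n+1) (as a measure on the
  ambient space, concentrated on the sphere), via the cone construction:
  |E| = (n+1) * Lebesgue measure of {t x : x in E, 0 < t <= 1}, i.e. the push-forward of
  Lebesgue measure on the punctured unit ball under radial projection, scaled by n+1.\<close>

definition sphere_measure :: "('a::euclidean_space) measure" where
  "sphere_measure = scale_measure (of_nat DIM('a))
      (distr (restrict_space lborel (ball 0 1 - {0})) borel (\<lambda>y. y /\<^sub>R norm y))"

definition theta :: "(real^'n) \<times> real \<Rightarrow> real" where
  "theta x = arccos (snd x)"

definition geo_ball :: "real \<Rightarrow> ((real^'n) \<times> real) set" where
  "geo_ball \<alpha> = {x \<in> sphere 0 1. 0 \<le> theta x \<and> theta x < \<alpha>}"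

definition eta :: "real \<Rightarrow> real \<Rightarrow> real \<Rightarrow> real \<Rightarrow> real" where
  "eta n p a t = (sin t) powr (- (n - 1) / (p - 1)) /
      integral {t..a} (\<lambda>s. (sin s) powr (- (n - 1) / (p - 1)))"

definition eta_T :: "real \<Rightarrow> real \<Rightarrow> real \<Rightarrow> real" where
  "eta_T n p a = (THE T. 0 < T \<and> T < a \<and>
      strict_antimono_on {0<..<T} (eta n p a) \<and> strict_mono_on {T<..<a} (eta n p a))"

definition eta_trunc :: "real \<Rightarrow> real \<Rightarrow> real \<Rightarrow> real \<Rightarrow> real" where
  "eta_trunc n p a t = (if t < eta_T n p a then eta n p a t else eta n p a (eta_T n p a))"

text \<open>The weight rho_a (only meaningful on S^n minus N).\<close>

definition rho :: "real \<Rightarrow> real \<Rightarrow> real \<Rightarrow> (real^'n) \<times> real \<Rightarrow> real" where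
  "rho n p a x = (if x \<in> geo_ball a - {north_pole}
      then (p - 1) / (n - p) * eta_trunc n p a (theta x)
      else (p - 1) / (n - p) * eta_trunc n p a (eta_T n p a))"

text \<open>Tangential (spherical) gradient of a C^1 function on R^(n+1) with Euclidean gradient G.\<close>

definition tgrad :: "('a::real_inner \<Rightarrow> 'a) \<Rightarrow> 'a \<Rightarrow> 'a" where
  "tgrad G x = G x - (G x \<bullet> x) *\<^sub>R x"

definition C1c_on_sphere :: "('a::euclidean_space) set \<Rightarrow> ('a \<Rightarrow> real) \<Rightarrow> ('a \<Rightarrow> 'a) \<Rightarrow> bool" where
  "C1c_on_sphere \<Omega> U G \<longleftrightarrow>
     (\<forall>x. (U has_derivative (\<lambda>h. G x \<bullet> h)) (at x)) \<and> continuous_on UNIV G \<and>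
     compact (closure {x \<in> sphere 0 1. U x \<noteq> 0}) \<and>
     closure {x \<in> sphere 0 1. U x \<noteq> 0} \<subseteq> \<Omega>"

text \<open>W^{1,p}_0(\<Omega>): u (with weak spherical gradient g) is the W^{1,p}(S^n)-limit of
  C^1 functions compactly supported in \<Omega> (completion of C_c^1(\<Omega>) = C_c^\<infinity>-closure).\<close>

definition W1p0 :: "real \<Rightarrow> ('a::euclidean_space) set \<Rightarrow> ('a \<Rightarrow> real) \<Rightarrow> ('a \<Rightarrow> 'a) \<Rightarrow> bool" where
  "W1p0 p \<Omega> u g \<longleftrightarrow>
     u \<in> borel_measurable borel \<and> g \<in> borel_measurable borel \<and>
     (\<integral>\<^sup>+ x. ennreal (\<bar>u x\<bar> powr p) \<partial>sphere_measure) < \<infinity> \<and>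
     (\<integral>\<^sup>+ x. ennreal (norm (g x) powr p) \<partial>sphere_measure) < \<infinity> \<and>
     (\<exists>U G. (\<forall>k. C1c_on_sphere \<Omega> (U k) (G k)) \<and>
        (\<lambda>k. \<integral>\<^sup>+ x. ennreal (\<bar>U k x - u x\<bar> powr p) \<partial>sphere_measure) \<longlonglongrightarrow> 0 \<and>
        (\<lambda>k. \<integral>\<^sup>+ x. ennreal (norm (tgrad (G k) x - g x) powr p) \<partial>sphere_measure) \<longlonglongrightarrow> 0)"

end

theory Submission
  imports Defs "HOL-Complex_Analysis.Great_Picard"
begin

text \<open>
  The Polya-Szego inequality reduces the problem to radial functions; a weak form of it, which avoids the
  isoperimetric inequality, is enough. Polarization with respect to a hyperplane keeps the
  distribution of a function and does not increase its energy: replacing the absolute value in the formula for the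
  polarization by \<open>sqrt (r\<^sup>2 + \<epsilon>\<^sup>2) - \<epsilon>\<close> even keeps it \<open>C\<^sup>1\<close>. By Arzela-Ascoli the functions that are uniform
  limits of \<open>C\<^sup>1\<close> functions with bounded energy and gradient, are supported on a set of given measure
  and have at least the given weighted norm contain a maximiser of \<open>\<integral> v (x \<bullet> e)\<close>. Polarization towards
  the pole \<open>e\<close> fixes it, so it decreases with the distance to \<open>e\<close> and lives in the ball of the same volume.

  On that ball the inequality follows, by Young's inequality, from the divergence theorem for a radial field
  \<open>\<psi> (x \<bullet> e) (e - (x \<bullet> e) x)\<close>. With \<open>\<psi> = k \<eta>\<^bsup>p-1\<^esup> / sin \<theta>\<close> the field yields exactly the
  weight \<open>((p - 1) / p)\<^sup>p \<eta>\<^sup>p\<close>, where \<open>\<eta>\<close> dominates its truncation. The field is cut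
  off at the pole, where the derivative of the cut-off has the right sign, and beyond the support of the
  radial function. The divergence theorem itself is the infinitesimal form of rotation invariance. It
  also shows that \<open>\<integral> |x - e|\<^bsup>-n\<^esup>\<close> diverges, which gives sharpness.
\<close>

section \<open>The measure on the sphere\<close>

text \<open>The truncation of \<open>\<eta>\<close> is dictated by the symmetrization: moving mass
  towards the pole raises a weighted norm only if the weight decreases with the distance to the
  pole, whereas \<open>\<eta>\<close> turns upwards beyond \<open>\<tau>\<close>. The weight must
  also be bounded, hence the additional cut at a height \<open>M\<close>, removed at the very end.

  The vector field is \<open>k |grad \<Phi>|^(p-2) grad \<Phi> / \<Phi>^(p-1)\<close>, as in
  Picone's identity, for the radial p-harmonic function \<open>\<Phi>\<close> that vanishes on the
  boundary of the ball of radius \<open>a\<close>. There \<open>\<eta>\<close> is infinite, so the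
  symmetrized function has to vanish near that boundary. The room for this comes from a strict
  inequality: a compact subset of \<open>\<Omega>\<close> has smaller measure than
  \<open>\<Omega>\<close>, because the sphere is connected and \<open>\<Omega>\<close> is a proper
  part of it.

  The maximiser is only Lipschitz, and its own energy is never formed. It carries a bound for the
  energies of \<open>C1\<close> functions converging to it uniformly, and the radial inequality
  passes to it because its left-hand side involves values only. Neither weak gradients nor
  semicontinuity of the energy enter.\<close>

lemma sets_sphere_measure [simp, measurable_cong]:
  "sets (sphere_measure :: 'a::euclidean_space measure) = sets borel"
  by (simp add: sphere_measure_def)

lemma space_sphere_measure [simp]: "space (sphere_measure :: 'a::euclidean_space measure) = UNIV"
  by (simp add: sphere_measure_def space_scale_measure)

lemma measurable_radial_projection [measurable]:
  "(\<lambda>y::'a::euclidean_space. y /\<^sub>R norm y) \<in> borel_measurable borel"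
  by measurable

lemma emeasure_sphere_measure:
  fixes A :: "'a::euclidean_space set"
  assumes A: "A \<in> sets borel"
  shows "emeasure sphere_measure A =
    of_nat DIM('a) * emeasure lborel {y \<in> ball 0 1 - {0}. y /\<^sub>R norm y \<in> A}"
proof -
  have "emeasure (distr (restrict_space lborel (ball 0 1 - {0})) borel (\<lambda>y. y /\<^sub>R norm y)) A
      = emeasure (restrict_space lborel (ball 0 1 - {0}))
          ((\<lambda>y. y /\<^sub>R norm y) -` A \<inter> space (restrict_space lborel (ball 0 1 - {0})))"
    using A by (intro emeasure_distr measurable_restrict_space1) auto
  also have "\<dots> = emeasure lborel ((\<lambda>y. y /\<^sub>R norm y) -` A \<inter> space (restrict_space lborel (ball 0 1 - {0})))"
    by (rule emeasure_restrict_space) (auto simp: space_restrict_space)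
  also have "(\<lambda>y. y /\<^sub>R norm y) -` A \<inter> space (restrict_space lborel (ball 0 1 - {0}))
     = {y \<in> ball 0 1 - {0}. y /\<^sub>R norm y \<in> A}"
    by (auto simp: space_restrict_space)
  finally show ?thesis by (simp add: sphere_measure_def)
qed

lemma finite_measure_sphere_measure: "finite_measure (sphere_measure :: 'a::euclidean_space measure)"
proof
  have "emeasure lborel {y \<in> ball (0::'a) 1 - {0}. y /\<^sub>R norm y \<in> UNIV} \<le> emeasure lborel (ball (0::'a) 1)"
    by (intro emeasure_mono) auto
  also have "\<dots> < \<infinity>" using emeasure_lborel_ball_finite[of "0::'a" 1] by simp
  finally show "emeasure (sphere_measure::'a measure) (space sphere_measure) \<noteq> \<infinity>"
    by (simp add: emeasure_sphere_measure ennreal_mult_eq_top_iff)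
qed

interpretation sphere: finite_measure "sphere_measure :: 'a::euclidean_space measure"
  by (rule finite_measure_sphere_measure)

lemma AE_sphere_measure: "AE x in (sphere_measure :: 'a::euclidean_space measure). norm x = 1"
proof (rule AE_I)
  have [measurable]: "{x::'a. norm x \<noteq> 1} \<in> sets borel" by measurable
  have "{y \<in> ball (0::'a) 1 - {0}. y /\<^sub>R norm y \<in> {x. norm x \<noteq> 1}} = {}" by (auto simp: field_simps)
  then show "emeasure sphere_measure {x::'a. norm x \<noteq> 1} = 0"
    by (subst emeasure_sphere_measure) (simp_all only: emeasure_empty mult_zero_right, measurable)
qed auto

text \<open>The cone over \<open>U\<close> in the punctured ball is open by continuity of the radial
  projection, and it contains the midpoint of the radius through \<open>x\<close>.\<close>

lemma emeasure_sphere_measure_open_pos: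
  fixes U :: "'a::euclidean_space set"
  assumes "open U" "x \<in> U" "norm x = 1"
  shows "emeasure sphere_measure U > 0"
proof -
  let ?V = "{y \<in> ball (0::'a) 1 - {0}. y /\<^sub>R norm y \<in> U}"
  have "continuous_on (ball (0::'a) 1 - {0}) (\<lambda>y. y /\<^sub>R norm y)"
    by (auto intro!: continuous_intros)
  then have "open ((\<lambda>y. y /\<^sub>R norm y) -` U \<inter> (ball (0::'a) 1 - {0}))"
    using assms(1) by (intro continuous_open_preimage[unfolded Int_commute[of _ "_ -` _"]]) auto
  moreover have "(\<lambda>y. y /\<^sub>R norm y) -` U \<inter> (ball (0::'a) 1 - {0}) = ?V" by auto
  ultimately have op: "open ?V" by simp
  have "(1/2) *\<^sub>R x \<in> ?V" using assms by auto
  then have "?V \<noteq> {}" by blast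
  then have "\<not> negligible ?V" using op open_not_negligible by blast
  then have "?V \<notin> null_sets lborel"
    using null_sets_completionI[of ?V lborel] unfolding negligible_iff_null_sets by blast
  then have "emeasure lborel ?V \<noteq> 0"
    using op by (simp add: null_sets_def)
  then show ?thesis
    using assms(1) by (simp add: emeasure_sphere_measure zero_less_iff_neq_zero)
qed

text \<open>The cone over a point lies on a line, which is a null set from dimension two on.\<close>

lemma emeasure_sphere_measure_singleton:
  fixes x :: "'a::euclidean_space"
  assumes "DIM('a) \<ge> 2"
  shows "emeasure sphere_measure {x} = 0"
proof -
  let ?V = "{y \<in> ball (0::'a) 1 - {0}. y /\<^sub>R norm y \<in> {x}}"
  have "?V \<subseteq> span {x}"
  proof
    fix y assume "y \<in> ?V"
    then have "y = norm y *\<^sub>R x" by auto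
    then show "y \<in> span {x}" by (metis insertI1 span_base span_mul)
  qed
  moreover have "negligible (span {x})"
    by (rule negligible_lowdim) (use assms dim_le_card[of "{x}" "{x}"] in \<open>auto intro: le_less_trans simp: span_superset\<close>)
  ultimately have neg: "negligible ?V" using negligible_subset by blast
  have "?V \<in> sets borel" by measurable
  then have "emeasure lborel ?V = 0"
    using neg unfolding negligible_iff_null_sets
    by (subst (asm) null_sets_completion_iff) auto
  then show ?thesis by (simp add: emeasure_sphere_measure)
qed

text \<open>Uniqueness of Haar measure, normalised on the unit ball, which a linear isometry preserves.\<close>

lemma lborel_distr_isometry:
  fixes f :: "'a::euclidean_space \<Rightarrow> 'a"
  assumes lin: "linear f" and iso: "\<And>x. norm (f x) = norm x"
  shows "distr lborel borel f = lborel"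
proof -
  have [measurable]: "f \<in> borel_measurable borel"
    using lin by (intro borel_measurable_continuous_onI linear_continuous_on) (simp add: linear_conv_bounded_linear)
  have inj: "inj f"
    using lin iso by (metis linear_injective_0 norm_eq_zero)
  define \<mu> where "\<mu> = distr lborel borel f"
  have sets_mu [measurable_cong, simp]: "sets \<mu> = sets borel" by (simp add: \<mu>_def)
  have [simp]: "space \<mu> = UNIV" by (simp add: \<mu>_def)
  have em: "emeasure \<mu> A = emeasure lborel (f -` A)" if "A \<in> sets borel" for A
    using that by (simp add: \<mu>_def emeasure_distr)
  have surj: "surj f" using inj lin by (simp add: linear_injective_imp_surjective)
  have trans: "distr \<mu> borel (\<lambda>y. y + x) = \<mu>" for x
  proof -
    obtain z where z: "f z = x" using surj by (metis surjD)
    have "distr \<mu> borel (\<lambda>y. y + x) = distr lborel borel (\<lambda>y. f y + x)"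
      unfolding \<mu>_def by (subst distr_distr) (auto simp: o_def)
    also have "\<dots> = distr lborel borel (\<lambda>y. f (z + y))"
      using z lin by (simp add: linear_add add.commute)
    also have "\<dots> = distr (distr lborel borel (\<lambda>y. z + y)) borel f"
      by (subst distr_distr) (auto simp: o_def)
    also have "\<dots> = \<mu>" by (simp add: lborel_distr_plus \<mu>_def)
    finally show ?thesis .
  qed
  have sf: "sigma_finite_measure \<mu>"
  proof
    have "\<forall>a\<in>range (\<lambda>n. ball (0::'a) (real n)). emeasure \<mu> a \<noteq> \<infinity>"
    proof safe
      fix n :: nat assume "emeasure \<mu> (ball (0::'a) (real n)) = \<infinity>"
      moreover have "f -` ball 0 (real n) = ball 0 (real n)" using iso by auto
      ultimately show False using emeasure_lborel_ball_finite[of "0::'a" "real n"] by (auto simp: em)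
    qed
    moreover have "\<Union>(range (\<lambda>n. ball (0::'a) (real n))) = UNIV"
      by (auto simp: reals_Archimedean2)
    ultimately show "\<exists>A. countable A \<and> A \<subseteq> sets \<mu> \<and> \<Union> A = space \<mu> \<and> (\<forall>a\<in>A. emeasure \<mu> a \<noteq> \<infinity>)"
      by (intro exI[of _ "range (\<lambda>n. ball (0::'a) (real n))"]) auto
  qed
  interpret M: sigma_finite_measure \<mu> by (rule sf)
  interpret P: pair_sigma_finite lborel \<mu> ..
  let ?A = "{x::'a. norm x < 1}"
  have A_ball: "?A = ball 0 1" by auto
  have "emeasure \<mu> B = emeasure lborel B" if B [measurable]: "B \<in> sets borel" for B
  proof -
    \<comment> \<open>The double integral of \<open>?F\<close> is computed in both orders.
      Translation invariance of \<open>\<mu>\<close> gives \<open>|A| \<mu>(B)\<close>; shifting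
      \<open>x\<close> first, with the symmetry of the ball, gives \<open>\<mu>(A) |B|\<close>. The
      ball has the same finite positive measure under both, so it cancels.\<close>
    let ?F = "\<lambda>x y. indicator ?A x * indicator B (y + x) :: ennreal"
    have "(\<integral>\<^sup>+ x. \<integral>\<^sup>+ y. ?F x y \<partial>\<mu> \<partial>lborel) = (\<integral>\<^sup>+ x. indicator ?A x * emeasure \<mu> B \<partial>lborel)"
    proof (intro nn_integral_cong)
      fix x :: 'a
      have "(\<integral>\<^sup>+ y. ?F x y \<partial>\<mu>) = indicator ?A x * (\<integral>\<^sup>+ y. indicator B (y + x) \<partial>\<mu>)"
        by (subst nn_integral_cmult) auto
      also have "(\<integral>\<^sup>+ y. indicator B (y + x) \<partial>\<mu>) = (\<integral>\<^sup>+ y. indicator B y \<partial>distr \<mu> borel (\<lambda>y. y + x))"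
        by (subst nn_integral_distr) auto
      also have "\<dots> = emeasure \<mu> B" by (simp add: trans)
      finally show "(\<integral>\<^sup>+ y. ?F x y \<partial>\<mu>) = indicator ?A x * emeasure \<mu> B" .
    qed
    also have "\<dots> = emeasure lborel ?A * emeasure \<mu> B"
      by (subst nn_integral_multc) (auto intro!: borel_measurable_indicator)
    finally have 1: "(\<integral>\<^sup>+ x. \<integral>\<^sup>+ y. ?F x y \<partial>\<mu> \<partial>lborel) = emeasure lborel ?A * emeasure \<mu> B" .
    have ms: "sets (lborel \<Otimes>\<^sub>M \<mu>) = sets (borel \<Otimes>\<^sub>M borel)"
      by (intro sets_pair_measure_cong) auto
    have ind: "(\<lambda>z. indicator D (h z) :: ennreal) \<in> borel_measurable (lborel \<Otimes>\<^sub>M \<mu>)"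
      if "D \<in> sets borel" "h \<in> borel \<Otimes>\<^sub>M borel \<rightarrow>\<^sub>M borel" for D :: "'a set" and h
      unfolding measurable_cong_sets[OF ms refl]
      by (rule measurable_compose[OF that(2) borel_measurable_indicator[OF that(1)]])
    have "(\<integral>\<^sup>+ x. \<integral>\<^sup>+ y. ?F x y \<partial>\<mu> \<partial>lborel) = (\<integral>\<^sup>+ y. \<integral>\<^sup>+ x. ?F x y \<partial>lborel \<partial>\<mu>)"
    proof (rule P.Fubini'[symmetric])
      show "(\<lambda>(x, y). ?F x y) \<in> borel_measurable (lborel \<Otimes>\<^sub>M \<mu>)"
        unfolding split_beta by (intro borel_measurable_times_ennreal ind) auto
    qed
    also have "\<dots> = (\<integral>\<^sup>+ y. \<integral>\<^sup>+ x. indicator ?A (x - y) * indicator B x \<partial>lborel \<partial>\<mu>)"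
    proof (rule nn_integral_cong)
      fix y :: 'a
      have "(\<integral>\<^sup>+ x. indicator ?A (x - y) * indicator B x \<partial>lborel)
        = (\<integral>\<^sup>+ x. indicator ?A (x - y) * indicator B x \<partial>distr lborel borel (\<lambda>x. y + x))"
        by (simp add: lborel_distr_plus)
      also have "\<dots> = (\<integral>\<^sup>+ x. ?F x y \<partial>lborel)"
        by (subst nn_integral_distr) auto
      finally show "(\<integral>\<^sup>+ x. ?F x y \<partial>lborel) = (\<integral>\<^sup>+ x. indicator ?A (x - y) * indicator B x \<partial>lborel)" by simp
    qed
    also have "\<dots> = (\<integral>\<^sup>+ x. \<integral>\<^sup>+ y. indicator ?A (x - y) * indicator B x \<partial>\<mu> \<partial>lborel)"
      by (rule P.Fubini', unfold split_beta, intro borel_measurable_times_ennreal ind) auto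
    also have "\<dots> = (\<integral>\<^sup>+ x. emeasure \<mu> ?A * indicator B x \<partial>lborel)"
    proof (intro nn_integral_cong)
      fix x :: 'a
      have "(\<integral>\<^sup>+ y. indicator ?A (x - y) * indicator B x \<partial>\<mu>) = (\<integral>\<^sup>+ y. indicator ?A (x - y) \<partial>\<mu>) * indicator B x"
        by (subst nn_integral_multc) auto
      also have "(\<integral>\<^sup>+ y. indicator ?A (x - y) \<partial>\<mu>) = (\<integral>\<^sup>+ y. indicator ?A (x - y) \<partial>distr \<mu> borel (\<lambda>y. y + x))"
        by (simp add: trans)
      also have "\<dots> = (\<integral>\<^sup>+ y. indicator ?A y \<partial>\<mu>)"
        by (subst nn_integral_distr, simp, measurable) (rule nn_integral_cong, simp add: indicator_def)
      also have "\<dots> = emeasure \<mu> ?A" by (rule nn_integral_indicator) simp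
      finally show "(\<integral>\<^sup>+ y. indicator ?A (x - y) * indicator B x \<partial>\<mu>) = emeasure \<mu> ?A * indicator B x" by simp
    qed
    also have "\<dots> = emeasure \<mu> ?A * emeasure lborel B"
      by (subst nn_integral_cmult) auto
    also have "emeasure \<mu> ?A = emeasure lborel ?A"
    proof -
      have "f -` ?A = ?A" using iso by auto
      then show ?thesis by (simp add: em)
    qed
    finally have "emeasure lborel ?A * emeasure \<mu> B = emeasure lborel ?A * emeasure lborel B" using 1 by simp
    moreover have "emeasure lborel ?A \<noteq> 0" "emeasure lborel ?A \<noteq> \<infinity>"
      using emeasure_lborel_ball_finite[of "0::'a" 1] less_imp_neq[OF unit_ball_vol_pos[OF of_nat_0_le_iff, of "DIM('a)"]]
      by (auto simp: emeasure_ball A_ball)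
    ultimately show ?thesis by (simp add: ennreal_mult_cancel_left)
  qed
  then show ?thesis unfolding \<mu>_def[symmetric]
    by (intro measure_eqI) auto
qed

lemma sphere_measure_distr_isometry:
  fixes f :: "'a::euclidean_space \<Rightarrow> 'a"
  assumes lin: "linear f" and iso: "\<And>x. norm (f x) = norm x"
  shows "distr sphere_measure borel f = sphere_measure"
proof (rule measure_eqI)
  fix A assume "A \<in> sets (distr (sphere_measure::'a measure) borel f)"
  then have A [measurable]: "A \<in> sets borel" by simp
  have [measurable]: "f \<in> borel_measurable borel"
    using lin by (intro borel_measurable_continuous_onI linear_continuous_on) (simp add: linear_conv_bounded_linear)
  have fA: "f -` A \<in> sets borel" using measurable_sets[of f borel borel A] by simp
  have m: "{y \<in> ball 0 1 - {0}. y /\<^sub>R norm y \<in> A} \<in> sets borel" by measurable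
  have "emeasure (distr sphere_measure borel f) A = emeasure sphere_measure (f -` A)"
    by (simp add: emeasure_distr)
  also have "\<dots> = of_nat DIM('a) * emeasure lborel {y \<in> ball 0 1 - {0}. y /\<^sub>R norm y \<in> f -` A}"
    by (rule emeasure_sphere_measure) fact
  also have "{y \<in> ball 0 1 - {0}. y /\<^sub>R norm y \<in> f -` A} = f -` {y \<in> ball 0 1 - {0}. y /\<^sub>R norm y \<in> A}"
    using iso lin by (auto simp: linear_scale linear_0 dist_norm) (metis norm_eq_zero)
  also have "emeasure lborel \<dots> = emeasure (distr lborel borel f) {y \<in> ball 0 1 - {0}. y /\<^sub>R norm y \<in> A}"
    using m by (simp add: emeasure_distr)
  also have "of_nat DIM('a) * \<dots> = emeasure sphere_measure A"
    by (simp add: lborel_distr_isometry[OF lin iso] emeasure_sphere_measure)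
  finally show "emeasure (distr sphere_measure borel f) A = emeasure sphere_measure A" .
qed simp

section \<open>Integrals over the sphere: invariance and integrability\<close>

lemma integral_sphere_isometry:
  fixes f :: "'a::euclidean_space \<Rightarrow> 'a" and g :: "'a \<Rightarrow> real"
  assumes lin: "linear f" and iso: "\<And>x. norm (f x) = norm x" and g: "g \<in> borel_measurable borel"
  shows "(\<integral>x. g (f x) \<partial>sphere_measure) = (\<integral>x. g x \<partial>sphere_measure)"
proof -
  have [measurable]: "f \<in> borel_measurable borel"
    using lin by (intro borel_measurable_continuous_onI linear_continuous_on) (simp add: linear_conv_bounded_linear)
  have "(\<integral>x. g (f x) \<partial>sphere_measure) = (\<integral>x. g x \<partial>distr sphere_measure borel f)"
    using g by (subst integral_distr) auto
  then show ?thesis by (simp add: sphere_measure_distr_isometry[OF lin iso])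
qed

lemma integrable_sphere_bounded:
  fixes g :: "'a::euclidean_space \<Rightarrow> real"
  assumes "g \<in> borel_measurable borel" and "\<And>x. norm x = 1 \<Longrightarrow> \<bar>g x\<bar> \<le> B"
  shows "integrable sphere_measure g"
proof (rule sphere.integrable_const_bound[of _ B])
  show "AE x in sphere_measure. norm (g x) \<le> B"
    using AE_sphere_measure by eventually_elim (simp add: assms(2))
qed (use assms in simp)

lemma integrable_sphere_continuous:
  fixes g :: "'a::euclidean_space \<Rightarrow> real"
  assumes "continuous_on UNIV g"
  shows "integrable sphere_measure g"
proof -
  have "bounded (g ` sphere 0 1)"
    using assms by (intro compact_imp_bounded compact_continuous_image) (auto intro: continuous_on_subset)
  then obtain B where "\<And>x. norm x = 1 \<Longrightarrow> \<bar>g x\<bar> \<le> B"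
    unfolding bounded_iff by (metis image_eqI mem_sphere_0 real_norm_def)
  then show ?thesis
    using assms by (intro integrable_sphere_bounded[of g B]) (auto intro: borel_measurable_continuous_onI)
qed

section \<open>Continuously differentiable functions and the divergence theorem\<close>

text \<open>\<open>C1c_on_sphere\<close> without its support condition, which polarization does not
  preserve.\<close>

definition C1 :: "('a::euclidean_space \<Rightarrow> real) \<Rightarrow> ('a \<Rightarrow> 'a) \<Rightarrow> bool" where
  "C1 U G \<longleftrightarrow> (\<forall>x. (U has_derivative (\<lambda>h. G x \<bullet> h)) (at x)) \<and> continuous_on UNIV G"

lemma C1_has_derivative: "C1 U G \<Longrightarrow> (U has_derivative (\<lambda>h. G x \<bullet> h)) (at x within S)"
  by (auto simp: C1_def intro: has_derivative_at_withinI)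

lemma C1_continuous:
  assumes "C1 U G" shows "continuous_on S U" "continuous_on S G"
proof -
  have "continuous_on UNIV U"
    using C1_has_derivative[OF assms] by (meson has_derivative_continuous_on)
  then show "continuous_on S U" by (rule continuous_on_subset) simp
  show "continuous_on S G" using assms by (auto simp: C1_def intro: continuous_on_subset)
qed

lemma C1_measurable:
  assumes "C1 U G" shows "U \<in> borel_measurable borel" "G \<in> borel_measurable borel"
  using C1_continuous[OF assms, of UNIV] by (auto intro: borel_measurable_continuous_onI)

lemma C1_gradient_bounded:
  fixes U :: "'a::euclidean_space \<Rightarrow> real"
  assumes "C1 U G"
  obtains L where "L \<ge> 0" "\<And>x. x \<in> cball 0 1 \<Longrightarrow> norm (G x) \<le> L"
proof -
  have "compact (G ` cball 0 1)"
    using C1_continuous(2)[OF assms] by (intro compact_continuous_image) auto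
  then have "bounded (G ` cball 0 1)" by (rule compact_imp_bounded)
  then obtain L where L: "\<And>x. x \<in> cball 0 1 \<Longrightarrow> norm (G x) \<le> L"
    unfolding bounded_iff by blast
  moreover have "L \<ge> 0" using L[of 0] norm_ge_zero[of "G 0"] by (simp del: norm_ge_zero)
  ultimately show ?thesis using that by blast
qed

text \<open>Gradient bounds are required on the whole closed ball because the mean value inequality
  needs a convex set: segments between points of the sphere leave the sphere.\<close>

lemma C1_lipschitz:
  fixes U :: "'a::euclidean_space \<Rightarrow> real"
  assumes "C1 U G" and "\<And>x. x \<in> cball 0 1 \<Longrightarrow> norm (G x) \<le> L" and "x \<in> cball 0 1" "y \<in> cball 0 1"
  shows "\<bar>U x - U y\<bar> \<le> L * norm (x - y)"
proof -
  have "norm (U x - U y) \<le> L * norm (x - y)"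
  proof (rule differentiable_bound[where S = "cball 0 1" and f' = "\<lambda>x h. G x \<bullet> h"])
    fix z :: 'a assume z: "z \<in> cball 0 1"
    show "onorm (\<lambda>h. G z \<bullet> h) \<le> L"
    proof (rule onorm_le)
      fix h
      have "norm (G z \<bullet> h) \<le> norm (G z) * norm h" by (simp add: Cauchy_Schwarz_ineq2)
      also have "\<dots> \<le> L * norm h" using assms(2)[OF z] by (intro mult_right_mono) auto
      finally show "norm (G z \<bullet> h) \<le> L * norm h" .
    qed
  qed (use assms C1_has_derivative in auto)
  then show ?thesis by simp
qed

text \<open>\<open>R s\<close> rotates the plane of \<open>e\<close> and \<open>c\<close> by the
  angle \<open>s\<close>; \<open>P\<close> and \<open>Q\<close> are the increments of the two
  coordinates. The integral of \<open>w\<close> composed with \<open>R s\<close> does not depend on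
  \<open>s\<close>, and its difference quotients are dominated by \<open>4 * L\<close> on the
  sphere, so the derivative at 0 may be taken under the integral.\<close>

lemma sphere_integral_rotation_derivative_orthonormal:
  fixes e c :: "'a::euclidean_space"
  assumes e: "norm e = 1" and c: "norm c = 1" and ec: "e \<bullet> c = 0" and w: "C1 w G"
  shows "(\<integral>x. G x \<bullet> ((x \<bullet> c) *\<^sub>R e - (x \<bullet> e) *\<^sub>R c) \<partial>sphere_measure) = 0"
proof -
  define P where "P s x = (cos s - 1) * (x \<bullet> e) + sin s * (x \<bullet> c)" for s and x :: 'a
  define Q where "Q s x = (cos s - 1) * (x \<bullet> c) - sin s * (x \<bullet> e)" for s and x :: 'a
  define R where "R s x = x + P s x *\<^sub>R e + Q s x *\<^sub>R c" for s x
  have ee: "e \<bullet> e = 1" "c \<bullet> c = 1" using e c by (auto simp: dot_square_norm)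
  have ce: "c \<bullet> e = 0" using ec by (simp add: inner_commute)
  have lin: "linear (R s)" for s
    by (rule linearI) (auto simp: R_def P_def Q_def algebra_simps scaleR_add_left scaleR_diff_left)
  have iso: "norm (R s x) = norm x" for s x
  proof -
    have "R s x \<bullet> R s x = x \<bullet> x + 2 * P s x * (x \<bullet> e) + 2 * Q s x * (x \<bullet> c) + (P s x)\<^sup>2 + (Q s x)\<^sup>2"
      unfolding R_def using ee ec ce
      by (simp add: inner_add_left inner_add_right inner_commute[of e x] inner_commute[of c x] power2_eq_square algebra_simps)
    also have "\<dots> = x \<bullet> x + ((sin s)\<^sup>2 + (cos s)\<^sup>2 - 1) * ((x \<bullet> e)\<^sup>2 + (x \<bullet> c)\<^sup>2)"
    proof -
      have "2 * ((C - 1) * a + S * b) * a + 2 * ((C - 1) * b - S * a) * b + ((C - 1) * a + S * b)\<^sup>2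
          + ((C - 1) * b - S * a)\<^sup>2 = (S\<^sup>2 + C\<^sup>2 - 1) * (a\<^sup>2 + b\<^sup>2)" for C S a b :: real
        by (simp add: power2_eq_square algebra_simps)
      from this[of "cos s" "x \<bullet> e" "sin s" "x \<bullet> c"] show ?thesis
        unfolding P_def Q_def by linarith
    qed
    finally show ?thesis by (simp add: norm_eq)
  qed
  obtain L where L: "L \<ge> 0" "\<And>x. x \<in> cball 0 1 \<Longrightarrow> norm (G x) \<le> L"
    using C1_gradient_bounded[OF w] by blast
  define s where "s k = 1 / real (Suc k)" for k
  have s0: "s k > 0" for k by (simp add: s_def)
  have sl: "filterlim s (at 0) sequentially"
  proof -
    have "s = (\<lambda>n. inverse (real (Suc n)))" by (auto simp: s_def inverse_eq_divide)
    then show ?thesis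
      unfolding filterlim_at using s0 LIMSEQ_inverse_real_of_nat by (auto simp: less_imp_neq[symmetric])
  qed
  define h where "h k x = (w (R (s k) x) - w x) / s k" for k x
  have [measurable]: "w \<in> borel_measurable borel" "G \<in> borel_measurable borel"
    using C1_measurable[OF w] by auto
  have Rm [measurable]: "R s \<in> borel_measurable borel" for s
    using lin by (intro borel_measurable_continuous_onI linear_continuous_on) (simp add: linear_conv_bounded_linear)
  have int0: "(\<integral>x. h k x \<partial>sphere_measure) = 0" for k
  proof -
    have iw: "integrable sphere_measure w"
      using C1_continuous[OF w] by (intro integrable_sphere_continuous)
    have "continuous_on UNIV (R (s k))"
      using linear_continuous_on[of "R (s k)" UNIV] lin[of "s k"] by (simp add: linear_conv_bounded_linear)
    then have "continuous_on UNIV (\<lambda>x. w (R (s k) x))"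
      by (rule continuous_on_compose2[OF C1_continuous(1)[OF w, of UNIV]]) simp
    then have iwR: "integrable sphere_measure (\<lambda>x. w (R (s k) x))"
      by (rule integrable_sphere_continuous)
    have "(\<integral>x. w (R (s k) x) \<partial>sphere_measure) = (\<integral>x. w x \<partial>sphere_measure)"
      by (rule integral_sphere_isometry) (use lin iso in auto)
    then show ?thesis unfolding h_def using iw iwR by simp
  qed
  have lim: "(\<lambda>k. h k x) \<longlonglongrightarrow> G x \<bullet> ((x \<bullet> c) *\<^sub>R e - (x \<bullet> e) *\<^sub>R c)" for x
  proof -
    have R0: "R 0 x = x" by (simp add: R_def P_def Q_def)
    have "((\<lambda>s. R s x) has_vector_derivative ((x \<bullet> c) *\<^sub>R e - (x \<bullet> e) *\<^sub>R c)) (at 0)"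
      unfolding R_def P_def Q_def
      by (auto intro!: derivative_eq_intros simp: has_vector_derivative_def algebra_simps)
    then have "((\<lambda>s. w (R s x)) has_derivative (\<lambda>t. G (R 0 x) \<bullet> (t *\<^sub>R ((x \<bullet> c) *\<^sub>R e - (x \<bullet> e) *\<^sub>R c)))) (at 0)"
      unfolding has_vector_derivative_def
      by (rule has_derivative_compose) (rule C1_has_derivative[OF w])
    then have "((\<lambda>s. w (R s x)) has_real_derivative (G x \<bullet> ((x \<bullet> c) *\<^sub>R e - (x \<bullet> e) *\<^sub>R c))) (at 0)"
      unfolding has_field_derivative_def
      by (rule has_derivative_eq_rhs) (simp add: fun_eq_iff R0)
    then have "((\<lambda>s. (w (R s x) - w x) / s) \<longlongrightarrow> G x \<bullet> ((x \<bullet> c) *\<^sub>R e - (x \<bullet> e) *\<^sub>R c)) (at 0)"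
      by (simp add: has_field_derivative_iff R0)
    from filterlim_compose[OF this sl] show ?thesis by (simp add: h_def)
  qed
  have bnd: "\<bar>h k x\<bar> \<le> 4 * L" if x: "norm x = 1" for k x
  proof -
    have a: "\<bar>x \<bullet> e\<bar> \<le> 1" "\<bar>x \<bullet> c\<bar> \<le> 1"
      using Cauchy_Schwarz_ineq2[of x e] Cauchy_Schwarz_ineq2[of x c] x e c by auto
    have b: "\<bar>sin (s k)\<bar> \<le> s k" using abs_sin_x_le_abs_x[of "s k"] s0[of k] by simp
    have "\<bar>cos (s k) - 1\<bar> = 2 * (sin (s k / 2))\<^sup>2"
      using cos_double_sin[of "s k / 2"] by simp
    also have "\<dots> = 2 * (\<bar>sin (s k / 2)\<bar> * \<bar>sin (s k / 2)\<bar>)" by (simp add: power2_eq_square)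
    also have "\<dots> \<le> 2 * (\<bar>s k / 2\<bar> * 1)"
      by (intro mult_left_mono mult_mono abs_sin_x_le_abs_x) auto
    finally have d: "\<bar>cos (s k) - 1\<bar> \<le> s k" using s0[of k] by simp
    have PQ: "\<bar>P (s k) x\<bar> \<le> 2 * s k" "\<bar>Q (s k) x\<bar> \<le> 2 * s k"
    proof -
      have *: "\<bar>(cos (s k) - 1) * y\<bar> \<le> s k" "\<bar>sin (s k) * y\<bar> \<le> s k" if "\<bar>y\<bar> \<le> 1" for y
        using mult_mono[OF d that] mult_mono[OF b that] s0[of k] by (auto simp: abs_mult)
      show "\<bar>P (s k) x\<bar> \<le> 2 * s k" "\<bar>Q (s k) x\<bar> \<le> 2 * s k"
        unfolding P_def Q_def using *[OF a(1)] *[OF a(2)] by linarith+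
    qed
    have "\<bar>w (R (s k) x) - w x\<bar> \<le> L * norm (R (s k) x - x)"
      by (rule C1_lipschitz[OF w L(2)]) (use x iso in auto)
    also have "norm (R (s k) x - x) \<le> norm (P (s k) x *\<^sub>R e) + norm (Q (s k) x *\<^sub>R c)"
      unfolding R_def by (simp add: norm_triangle_ineq add.assoc del: norm_scaleR)
    also have "\<dots> \<le> 4 * s k" using PQ e c by simp
    finally have "\<bar>w (R (s k) x) - w x\<bar> \<le> L * (4 * s k)"
      using L(1) by (simp add: mult_left_mono)
    then show ?thesis using s0[of k] by (simp add: h_def field_simps)
  qed
  have "(\<lambda>k. \<integral>x. h k x \<partial>sphere_measure) \<longlonglongrightarrow> (\<integral>x. G x \<bullet> ((x \<bullet> c) *\<^sub>R e - (x \<bullet> e) *\<^sub>R c) \<partial>sphere_measure)"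
  proof (rule integral_dominated_convergence[where w = "\<lambda>_. 4 * L"])
    show "AE x in sphere_measure. norm (h k x) \<le> 4 * L" for k
      using AE_sphere_measure by eventually_elim (simp add: bnd)
    show "h k \<in> borel_measurable sphere_measure" for k
      unfolding h_def by measurable
  qed (use lim in auto)
  then show ?thesis unfolding int0 by (rule LIMSEQ_unique[OF _ tendsto_const])
qed

text \<open>The component of \<open>b\<close> along \<open>e\<close> cancels in the field; what
  remains is a multiple of the orthonormal case.\<close>

lemma sphere_integral_rotation_derivative:
  fixes e b :: "'a::euclidean_space"
  assumes e: "norm e = 1" and w: "C1 w G"
  shows "(\<integral>x. G x \<bullet> ((x \<bullet> b) *\<^sub>R e - (x \<bullet> e) *\<^sub>R b) \<partial>sphere_measure) = 0"
proof -
  define c where "c = b - (b \<bullet> e) *\<^sub>R e"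
  have ee: "e \<bullet> e = 1" using e by (auto simp: dot_square_norm)
  have A: "(x \<bullet> b) *\<^sub>R e - (x \<bullet> e) *\<^sub>R b = (x \<bullet> c) *\<^sub>R e - (x \<bullet> e) *\<^sub>R c" for x
    by (simp add: c_def inner_diff_right algebra_simps)
  show ?thesis
  proof (cases "c = 0")
    case True
    then show ?thesis by (simp add: A)
  next
    case False
    let ?c = "c /\<^sub>R norm c"
    have "norm ?c = 1" "e \<bullet> ?c = 0"
      using False ee by (auto simp: c_def inner_diff_right inner_commute)
    from sphere_integral_rotation_derivative_orthonormal[OF e this w]
    have 0: "(\<integral>x. G x \<bullet> ((x \<bullet> ?c) *\<^sub>R e - (x \<bullet> e) *\<^sub>R ?c) \<partial>sphere_measure) = 0" .
    have "G x \<bullet> ((x \<bullet> c) *\<^sub>R e - (x \<bullet> e) *\<^sub>R c) = norm c * (G x \<bullet> ((x \<bullet> ?c) *\<^sub>R e - (x \<bullet> e) *\<^sub>R ?c))" for x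
      using False by (simp add: inner_diff_right field_simps)
    then show ?thesis using 0 by (simp only: A) simp
  qed
qed

text \<open>The radial field \<open>e - (x \<bullet> e) x\<close> is the combination \<open>\<Sum>b. (x \<bullet> b) A\<^sub>b x\<close> of the
  rotation fields \<open>A\<^sub>b x = (x \<bullet> b) e - (x \<bullet> e) b\<close>, so the divergence theorem for it
  follows from the rotation invariance of the measure.\<close>

lemma sphere_divergence:
  fixes e :: "'a::euclidean_space"
  assumes e: "norm e = 1" and f: "C1 f F"
    and \<psi>: "\<And>t. (\<psi> has_real_derivative \<psi>' t) (at t)" "continuous_on UNIV \<psi>'"
  shows "(\<integral>x. \<psi> (x \<bullet> e) * (F x \<bullet> (e - (x \<bullet> e) *\<^sub>R x)) +
      f x * (\<psi>' (x \<bullet> e) * (1 - (x \<bullet> e)\<^sup>2) - (real DIM('a) - 1) * \<psi> (x \<bullet> e) * (x \<bullet> e)) \<partial>sphere_measure) = 0"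
proof -
  \<comment> \<open>The coefficient \<open>x \<bullet> b\<close> is moved into the function, so that
    only the pure rotation field \<open>A b\<close> is integrated against its gradient. The price is
    the trace term computed in \<open>sumG\<close>.\<close>
  define w where "w b x = f x * (x \<bullet> b) * \<psi> (x \<bullet> e)" for b x
  define G where "G b x = ((x \<bullet> b) * \<psi> (x \<bullet> e)) *\<^sub>R F x + (f x * \<psi> (x \<bullet> e)) *\<^sub>R b
    + (f x * (x \<bullet> b) * \<psi>' (x \<bullet> e)) *\<^sub>R e" for b x
  define A where "A b x = (x \<bullet> b) *\<^sub>R e - (x \<bullet> e) *\<^sub>R b" for b x :: 'a
  have cpsi: "continuous_on UNIV \<psi>" using \<psi>(1) by (meson DERIV_isCont continuous_at_imp_continuous_on)
  have cont [continuous_intros]: "continuous_on UNIV (\<lambda>x::'a. \<psi> (x \<bullet> e))" "continuous_on UNIV (\<lambda>x::'a. \<psi>' (x \<bullet> e))"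
    "continuous_on UNIV F" "continuous_on UNIV f"
    using C1_continuous[OF f] \<psi>(2) cpsi
    by (auto intro!: continuous_on_compose2[of UNIV \<psi>'] continuous_on_compose2[of UNIV \<psi>] continuous_intros)
  have C1w: "C1 (w b) (G b)" for b
    unfolding C1_def
  proof (intro conjI allI)
    fix x
    have d\<psi>: "((\<lambda>x. \<psi> (x \<bullet> e)) has_derivative (\<lambda>h. \<psi>' (x \<bullet> e) * (h \<bullet> e))) (at x)"
      by (rule has_derivative_compose[OF _ \<psi>(1)[unfolded has_field_derivative_def]])
        (auto intro!: derivative_eq_intros)
    have df: "(f has_derivative (\<lambda>h. F x \<bullet> h)) (at x)" by (rule C1_has_derivative[OF f])
    show "(w b has_derivative (\<lambda>h. G b x \<bullet> h)) (at x)"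
      unfolding w_def G_def
      by (rule has_derivative_eq_rhs[OF has_derivative_mult[OF has_derivative_mult[OF df] d\<psi>]])
        (auto intro!: derivative_eq_intros simp: inner_add_left algebra_simps fun_eq_iff inner_commute)
    show "continuous_on UNIV (G b)"
      unfolding G_def by (intro continuous_intros)
  qed
  have 0: "(\<integral>x. G b x \<bullet> A b x \<partial>sphere_measure) = 0" for b
    unfolding A_def by (rule sphere_integral_rotation_derivative[OF e C1w])
  have int: "integrable sphere_measure (\<lambda>x. G b x \<bullet> A b x)" for b
    unfolding G_def A_def by (intro integrable_sphere_continuous continuous_intros)
  have ee: "e \<bullet> e = 1" using e by (auto simp: dot_square_norm)
  have bas: "(\<Sum>b\<in>Basis. (x \<bullet> b) * (b \<bullet> y)) = x \<bullet> y" for x y :: 'a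
    by (subst (2) euclidean_inner) (simp add: inner_commute)
  have sumA: "(\<Sum>b\<in>Basis. (x \<bullet> b) *\<^sub>R A b x) = (x \<bullet> x) *\<^sub>R e - (x \<bullet> e) *\<^sub>R x" for x
  proof -
    have "(\<Sum>b\<in>Basis. (x \<bullet> b) *\<^sub>R A b x) = (\<Sum>b\<in>Basis. ((x \<bullet> b) * (b \<bullet> x)) *\<^sub>R e) - (\<Sum>b\<in>Basis. (x \<bullet> e) *\<^sub>R ((x \<bullet> b) *\<^sub>R b))"
      by (simp add: A_def scaleR_diff_right sum_subtractf inner_commute mult.commute)
    also have "\<dots> = (x \<bullet> x) *\<^sub>R e - (x \<bullet> e) *\<^sub>R x"
      by (simp add: scaleR_left.sum[symmetric] scaleR_right.sum[symmetric] bas euclidean_representation del: scaleR_scaleR)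
    finally show ?thesis .
  qed
  have sumG: "(\<Sum>b\<in>Basis. G b x \<bullet> A b x) = \<psi> (x \<bullet> e) * (F x \<bullet> (e - (x \<bullet> e) *\<^sub>R x)) +
      f x * (\<psi>' (x \<bullet> e) * (1 - (x \<bullet> e)\<^sup>2) - (real DIM('a) - 1) * \<psi> (x \<bullet> e) * (x \<bullet> e))" if x: "norm x = 1" for x
  proof -
    have xx: "x \<bullet> x = 1" using x by (auto simp: dot_square_norm)
    have "(\<Sum>b\<in>Basis. G b x \<bullet> A b x) = \<psi> (x \<bullet> e) * (F x \<bullet> (\<Sum>b\<in>Basis. (x \<bullet> b) *\<^sub>R A b x))
       + f x * \<psi> (x \<bullet> e) * (\<Sum>b\<in>Basis. b \<bullet> A b x) + f x * \<psi>' (x \<bullet> e) * (e \<bullet> (\<Sum>b\<in>Basis. (x \<bullet> b) *\<^sub>R A b x))"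
      unfolding inner_sum_right sum_distrib_left sum.distrib[symmetric]
      by (intro sum.cong) (auto simp: G_def inner_add_left algebra_simps)
    \<comment> \<open>The trace is the divergence of the radial field,
      \<open>- (DIM - 1) (x \<bullet> e)\<close>: linear functions are eigenfunctions of the
      spherical Laplacian.\<close>
    also have "(\<Sum>b\<in>Basis. b \<bullet> A b x) = x \<bullet> e - real DIM('a) * (x \<bullet> e)"
    proof -
      have "(\<Sum>b\<in>Basis. b \<bullet> A b x) = (\<Sum>b\<in>Basis. (x \<bullet> b) * (b \<bullet> e) - x \<bullet> e)"
        by (intro sum.cong) (auto simp: A_def inner_diff_right)
      then show ?thesis by (simp add: sum_subtractf bas)
    qed
    finally have "(\<Sum>b\<in>Basis. G b x \<bullet> A b x) = \<psi> (x \<bullet> e) * (F x \<bullet> (e - (x \<bullet> e) *\<^sub>R x))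
       + f x * \<psi> (x \<bullet> e) * (x \<bullet> e - real DIM('a) * (x \<bullet> e)) + f x * \<psi>' (x \<bullet> e) * (1 - (x \<bullet> e) * (x \<bullet> e))"
      by (simp add: sumA xx inner_diff_right[of e] ee inner_commute[of e x])
    then show ?thesis by (simp add: power2_eq_square algebra_simps)
  qed
  have "(\<integral>x. (\<Sum>b\<in>Basis. G b x \<bullet> A b x) \<partial>sphere_measure) = 0"
    using int by (subst Bochner_Integration.integral_sum) (auto simp: 0)
  moreover have "(\<integral>x. (\<Sum>b\<in>Basis. G b x \<bullet> A b x) \<partial>sphere_measure) = (\<integral>x. \<psi> (x \<bullet> e) * (F x \<bullet> (e - (x \<bullet> e) *\<^sub>R x)) +
      f x * (\<psi>' (x \<bullet> e) * (1 - (x \<bullet> e)\<^sup>2) - (real DIM('a) - 1) * \<psi> (x \<bullet> e) * (x \<bullet> e)) \<partial>sphere_measure)"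
  proof (rule integral_cong_AE)
    show "AE x in sphere_measure. (\<Sum>b\<in>Basis. G b x \<bullet> A b x) = \<psi> (x \<bullet> e) * (F x \<bullet> (e - (x \<bullet> e) *\<^sub>R x)) +
      f x * (\<psi>' (x \<bullet> e) * (1 - (x \<bullet> e)\<^sup>2) - (real DIM('a) - 1) * \<psi> (x \<bullet> e) * (x \<bullet> e))"
      using AE_sphere_measure by eventually_elim (rule sumG)
    show "(\<lambda>x. \<Sum>b\<in>Basis. G b x \<bullet> A b x) \<in> borel_measurable sphere_measure"
      using int by (intro borel_measurable_sum) auto
    show "(\<lambda>x. \<psi> (x \<bullet> e) * (F x \<bullet> (e - (x \<bullet> e) *\<^sub>R x)) +
      f x * (\<psi>' (x \<bullet> e) * (1 - (x \<bullet> e)\<^sup>2) - (real DIM('a) - 1) * \<psi> (x \<bullet> e) * (x \<bullet> e))) \<in> borel_measurable sphere_measure"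
      by (rule borel_measurable_integrable, intro integrable_sphere_continuous continuous_intros)
  qed
  ultimately show ?thesis by simp
qed

section \<open>Polarization\<close>

lemma powr_convex_combination:
  fixes a b t p :: real
  assumes "p \<ge> 1" "0 \<le> t" "t \<le> 1" "a \<ge> 0" "b \<ge> 0"
  shows "(t * a + (1 - t) * b) powr p \<le> t * a powr p + (1 - t) * b powr p"
proof -
  have *: "t powr p \<le> t" if "0 \<le> t" "t \<le> 1" for t :: real
    using that assms(1) powr_mono'[of 1 p t] by (cases "t = 0") auto
  consider "a = 0" | "b = 0" | "a > 0" "b > 0" using assms by linarith
  then show ?thesis
  proof cases
    case 1
    have "(1 - t) powr p * b powr p \<le> (1 - t) * b powr p"
      using *[of "1 - t"] assms by (intro mult_right_mono) auto
    then show ?thesis using 1 assms by (simp add: powr_mult)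
  next
    case 2
    have "t powr p * a powr p \<le> t * a powr p"
      using *[of t] assms by (intro mult_right_mono) auto
    then show ?thesis using 2 assms by (simp add: powr_mult)
  next
    case 3
    then show ?thesis
      using convex_onD[OF powr_convex[OF assms(1)], of "1 - t" a b] assms by simp
  qed
qed

section \<open>Calculus of \<open>C1\<close> functions\<close>

lemma C1_add: "C1 U G \<Longrightarrow> C1 V H \<Longrightarrow> C1 (\<lambda>x. U x + V x) (\<lambda>x. G x + H x)"
  unfolding C1_def by (auto intro!: derivative_eq_intros continuous_intros simp: inner_add_left)

lemma C1_cmult: "C1 U G \<Longrightarrow> C1 (\<lambda>x. c * U x) (\<lambda>x. c *\<^sub>R G x)"
  unfolding C1_def by (auto intro!: derivative_eq_intros continuous_intros)

text \<open>Differentiability is asked only at values of \<open>U\<close>. This admits negative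
  powers of the squared distance plus \<open>\<epsilon>\<close>, which are singular elsewhere on the
  line.\<close>

lemma C1_real_compose_range:
  fixes \<phi> :: "real \<Rightarrow> real"
  assumes "C1 U G" "\<And>x. (\<phi> has_real_derivative \<phi>' (U x)) (at (U x))" "continuous_on UNIV (\<lambda>x. \<phi>' (U x))"
  shows "C1 (\<lambda>x. \<phi> (U x)) (\<lambda>x. \<phi>' (U x) *\<^sub>R G x)"
  unfolding C1_def
proof (intro conjI allI)
  fix x
  show "((\<lambda>x. \<phi> (U x)) has_derivative (\<lambda>h. \<phi>' (U x) *\<^sub>R G x \<bullet> h)) (at x)"
    using has_derivative_compose[OF C1_has_derivative[OF assms(1)] assms(2)[unfolded has_field_derivative_def]]
    by simp
  show "continuous_on UNIV (\<lambda>x. \<phi>' (U x) *\<^sub>R G x)"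
    using C1_continuous[OF assms(1)] assms(3) by (intro continuous_intros)
qed

lemma C1_real_compose:
  fixes \<phi> :: "real \<Rightarrow> real"
  assumes "C1 U G" "\<And>r. (\<phi> has_real_derivative \<phi>' r) (at r)" "continuous_on UNIV \<phi>'"
  shows "C1 (\<lambda>x. \<phi> (U x)) (\<lambda>x. \<phi>' (U x) *\<^sub>R G x)"
  by (rule C1_real_compose_range[OF assms(1,2) continuous_on_compose2[OF assms(3) C1_continuous(1)[OF assms(1)]]]) auto

text \<open>Off the hyperplane the sign is locally constant. On the hyperplane \<open>f\<close>
  vanishes to first order, so a bounded factor cannot spoil differentiability, and both sides of the
  gradient tend to 0.\<close>

lemma C1_sgn_mult:
  fixes f :: "'a::euclidean_space \<Rightarrow> real"
  assumes f: "C1 f F" and z: "\<And>x. x \<bullet> \<nu> = 0 \<Longrightarrow> f x = 0 \<and> F x = 0"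
  shows "C1 (\<lambda>x. sgn (x \<bullet> \<nu>) * f x) (\<lambda>x. sgn (x \<bullet> \<nu>) *\<^sub>R F x)"
proof -
  have loc: "\<forall>\<^sub>F y in at x. sgn (y \<bullet> \<nu>) = sgn (x \<bullet> \<nu>)" if "x \<bullet> \<nu> \<noteq> 0" for x
  proof -
    have "((\<lambda>y. y \<bullet> \<nu>) \<longlongrightarrow> x \<bullet> \<nu>) (at x)" by (intro tendsto_intros)
    from order_tendstoD(1)[OF this, of 0] order_tendstoD(2)[OF this, of 0] show ?thesis
      using that by (cases "x \<bullet> \<nu> > 0") (auto elim!: eventually_mono)
  qed
  show ?thesis
    unfolding C1_def
  proof (intro conjI allI)
    fix x
    have df: "(f has_derivative (\<lambda>h. F x \<bullet> h)) (at x)" by (rule C1_has_derivative[OF f])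
    show "((\<lambda>x. sgn (x \<bullet> \<nu>) * f x) has_derivative (\<lambda>h. sgn (x \<bullet> \<nu>) *\<^sub>R F x \<bullet> h)) (at x)"
    proof (cases "x \<bullet> \<nu> = 0")
      case False
      have "((\<lambda>y. sgn (x \<bullet> \<nu>) * f y) has_derivative (\<lambda>h. sgn (x \<bullet> \<nu>) *\<^sub>R F x \<bullet> h)) (at x)"
        by (auto intro!: derivative_eq_intros df)
      then show ?thesis
        by (rule has_derivative_transform_eventually) (use loc[OF False] in \<open>auto elim: eventually_mono\<close>)
    next
      case True
      then have fx: "f x = 0" "F x = 0" using z by auto
      have "((\<lambda>h. norm (f (x + h)) / norm h) \<longlongrightarrow> 0) (at 0)"
        using df unfolding has_derivative_at by (simp add: fx)
      then have "((\<lambda>h. norm (sgn ((x + h) \<bullet> \<nu>) * f (x + h)) / norm h) \<longlongrightarrow> 0) (at 0)"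
        by (rule Lim_null_comparison[rotated])
          (auto simp: abs_mult abs_sgn_eq intro!: always_eventually divide_right_mono)
      then show ?thesis unfolding has_derivative_at by (simp add: fx True bounded_linear_inner_right)
    qed
  next
    have "isCont (\<lambda>y. sgn (y \<bullet> \<nu>) *\<^sub>R F y) x" for x
    proof -
      have F: "(F \<longlongrightarrow> F x) (at x)"
        using C1_continuous(2)[OF f, of UNIV] by (simp add: continuous_on_eq_continuous_at isCont_def)
      show ?thesis
      proof (cases "x \<bullet> \<nu> = 0")
        case False
        have "((\<lambda>y. sgn (x \<bullet> \<nu>) *\<^sub>R F y) \<longlongrightarrow> sgn (x \<bullet> \<nu>) *\<^sub>R F x) (at x)"
          by (intro tendsto_intros F)
        then show ?thesis
          unfolding isCont_def
          by (rule Lim_transform_eventually) (use loc[OF False] in \<open>auto elim: eventually_mono\<close>)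
      next
        case True
        then have "((\<lambda>y. norm (F y)) \<longlongrightarrow> 0) (at x)" using F z tendsto_norm_zero by fastforce
        then have "((\<lambda>y. sgn (y \<bullet> \<nu>) *\<^sub>R F y) \<longlongrightarrow> 0) (at x)"
          by (rule Lim_null_comparison[rotated]) (auto simp: abs_sgn_eq intro!: always_eventually)
        then show ?thesis by (simp add: isCont_def True)
      qed
    qed
    then show "continuous_on UNIV (\<lambda>x. sgn (x \<bullet> \<nu>) *\<^sub>R F x)"
      by (simp add: continuous_at_imp_continuous_on)
  qed
qed

section \<open>Energy and hyperplane reflections\<close>

definition energy :: "real \<Rightarrow> ('a::euclidean_space \<Rightarrow> 'a) \<Rightarrow> real" where
  "energy p G = (\<integral>x. norm (tgrad G x) powr p \<partial>sphere_measure)"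

lemma integrable_energy:
  fixes G :: "'a::euclidean_space \<Rightarrow> 'a"
  assumes "continuous_on UNIV G" "p > 0"
  shows "integrable sphere_measure (\<lambda>x. norm (tgrad G x) powr p)"
  unfolding tgrad_def using assms by (intro integrable_sphere_continuous continuous_intros continuous_on_powr') auto

definition reflection :: "'a::euclidean_space \<Rightarrow> 'a \<Rightarrow> 'a" where
  "reflection \<nu> x = x - (2 * (x \<bullet> \<nu>)) *\<^sub>R \<nu>"

lemma linear_refl: "linear (reflection \<nu>)"
  by (rule linearI) (auto simp: reflection_def algebra_simps scaleR_add_left)

lemma refl_scaleR: "reflection \<nu> (c *\<^sub>R x) = c *\<^sub>R reflection \<nu> x"
  and refl_diff: "reflection \<nu> (x - y) = reflection \<nu> x - reflection \<nu> y"
  using linear_refl[of \<nu>] by (simp_all add: linear_scale linear_diff)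

lemma refl_adjoint: "reflection \<nu> x \<bullet> y = x \<bullet> reflection \<nu> y"
  by (simp add: reflection_def inner_diff_left inner_diff_right inner_commute)

lemma refl_fixed: "x \<bullet> \<nu> = 0 \<Longrightarrow> reflection \<nu> x = x"
  by (simp add: reflection_def)

lemma continuous_refl [continuous_intros]: "continuous_on S f \<Longrightarrow> continuous_on S (\<lambda>x. reflection \<nu> (f x))"
  unfolding reflection_def by (intro continuous_intros)

lemma measurable_refl [measurable]: "reflection \<nu> \<in> borel_measurable borel"
  using continuous_refl[of UNIV "\<lambda>x. x" \<nu>] by (auto intro: borel_measurable_continuous_onI)

context
  fixes \<nu> :: "'a::euclidean_space"
  assumes nu: "norm \<nu> = 1"
begin

lemma refl_inner_axis: "reflection \<nu> x \<bullet> \<nu> = - (x \<bullet> \<nu>)"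
  using nu by (simp add: reflection_def inner_diff_left dot_square_norm)

lemma refl_refl: "reflection \<nu> (reflection \<nu> x) = x"
  by (subst (1) reflection_def) (simp add: refl_inner_axis, simp add: reflection_def)

lemma norm_refl: "norm (reflection \<nu> x) = norm x"
proof -
  have "reflection \<nu> x \<bullet> reflection \<nu> x = x \<bullet> x" by (simp add: refl_adjoint refl_refl)
  then show ?thesis by (simp add: norm_eq)
qed

lemma C1_refl:
  assumes "C1 U G"
  shows "C1 (\<lambda>x. U (reflection \<nu> x)) (\<lambda>x. reflection \<nu> (G (reflection \<nu> x)))"
  unfolding C1_def
proof (intro conjI allI)
  fix x
  have "(reflection \<nu> has_derivative reflection \<nu>) (at x)"
    using linear_refl[of \<nu>] by (simp add: linear_conv_bounded_linear bounded_linear_imp_has_derivative)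
  from has_derivative_compose[OF this C1_has_derivative[OF assms]]
  show "((\<lambda>x. U (reflection \<nu> x)) has_derivative (\<lambda>h. reflection \<nu> (G (reflection \<nu> x)) \<bullet> h)) (at x)"
    by (simp add: refl_adjoint)
  show "continuous_on UNIV (\<lambda>x. reflection \<nu> (G (reflection \<nu> x)))"
    by (intro continuous_intros continuous_on_compose2[OF C1_continuous(2)[OF assms, of UNIV]]) simp
qed

lemma integral_refl:
  fixes g :: "'a \<Rightarrow> real"
  assumes "g \<in> borel_measurable borel"
  shows "(\<integral>x. g (reflection \<nu> x) \<partial>sphere_measure) = (\<integral>x. g x \<partial>sphere_measure)"
  by (rule integral_sphere_isometry) (use assms linear_refl norm_refl in auto)

end

text \<open>The two-point rearrangement: of the values at a point and its mirror image, the larger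
  goes to the side of \<open>\<nu>\<close>, see \<open>pol_eq\<close>. Written as half sum plus
  signed half difference, it has the absolute value as the part to be smoothed; the jump of the sign
  is harmless by \<open>C1_sgn_mult\<close>.\<close>

definition pol :: "'a::euclidean_space \<Rightarrow> ('a \<Rightarrow> real) \<Rightarrow> 'a \<Rightarrow> real" where
  "pol \<nu> v x = (v x + v (reflection \<nu> x)) / 2 + sgn (x \<bullet> \<nu>) * \<bar>(v x - v (reflection \<nu> x)) / 2\<bar>"

lemma pol_eq: "pol \<nu> v x = (if x \<bullet> \<nu> \<ge> 0 then max (v x) (v (reflection \<nu> x)) else min (v x) (v (reflection \<nu> x)))"
proof (cases "x \<bullet> \<nu> = 0")
  case True
  then show ?thesis by (simp add: pol_def refl_fixed)
next
  case False
  then show ?thesis by (auto simp: pol_def sgn_real_def max_def min_def abs_if field_simps)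
qed

lemma pol_measurable [measurable]:
  assumes [measurable]: "v \<in> borel_measurable borel"
  shows "pol \<nu> v \<in> borel_measurable borel"
  unfolding pol_def by measurable

text \<open>Monotone maps commute with maximum and minimum. Hence whatever holds for integrals of
  polarizations also holds for their powers and for the measure of their positivity sets.\<close>

lemma pol_mono_compose: "mono \<phi> \<Longrightarrow> pol \<nu> (\<lambda>x. \<phi> (v x)) x = \<phi> (pol \<nu> v x)"
  by (auto simp: pol_eq max_of_mono min_of_mono)

lemma pol_diff_mult_nonneg:
  assumes "norm \<nu> = 1" "\<And>x. norm x = 1 \<Longrightarrow> x \<bullet> \<nu> > 0 \<Longrightarrow> h (reflection \<nu> x) \<le> h x" "norm x = 1"
  shows "(pol \<nu> f x - f x) * (h x - h (reflection \<nu> x)) \<ge> 0"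
proof -
  consider "x \<bullet> \<nu> > 0" | "x \<bullet> \<nu> = 0" | "x \<bullet> \<nu> < 0" by linarith
  then show ?thesis
  proof cases
    case 1
    then show ?thesis using assms(2)[of x] assms(3) by (simp add: pol_eq)
  next
    case 2
    then show ?thesis by (simp add: refl_fixed)
  next
    case 3
    then have "h x \<le> h (reflection \<nu> x)"
      using assms(2)[of "reflection \<nu> x"] assms(1,3) by (simp add: norm_refl refl_refl refl_inner_axis)
    then show ?thesis using 3 by (simp add: pol_eq mult_nonpos_nonpos)
  qed
qed

text \<open>The change \<open>q\<close> made by the polarization is odd under the reflection, so
  integrating it against \<open>h\<close> only sees the odd part of \<open>h\<close>. An exact
  formula is kept, not just the inequality, because the equality case identifies the maximiser in
  \<open>symmetrization\<close>.\<close>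

lemma integral_pol_diff:
  fixes f h :: "'a::euclidean_space \<Rightarrow> real"
  assumes nu: "norm \<nu> = 1" and [measurable]: "f \<in> borel_measurable borel" "h \<in> borel_measurable borel"
    and fB: "\<And>x. norm x = 1 \<Longrightarrow> \<bar>f x\<bar> \<le> B" and hB: "\<And>x. norm x = 1 \<Longrightarrow> \<bar>h x\<bar> \<le> H"
  shows "(\<integral>x. pol \<nu> f x * h x \<partial>sphere_measure) - (\<integral>x. f x * h x \<partial>sphere_measure)
    = (\<integral>x. (pol \<nu> f x - f x) * (h x - h (reflection \<nu> x)) / 2 \<partial>sphere_measure)"
proof -
  have pB: "\<bar>pol \<nu> f x\<bar> \<le> B" if "norm x = 1" for x
    using fB[OF that] fB[of "reflection \<nu> x"] that nu by (auto simp: pol_eq norm_refl max_def min_def)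
  have int1: "integrable sphere_measure (\<lambda>x. g x * k x)"
    if [measurable]: "g \<in> borel_measurable borel" "k \<in> borel_measurable borel"
     and "\<And>x. norm x = 1 \<Longrightarrow> \<bar>g x\<bar> \<le> B" "\<And>x. norm x = 1 \<Longrightarrow> \<bar>k x\<bar> \<le> H" for g k :: "'a \<Rightarrow> real"
  proof (rule integrable_sphere_bounded[of _ "B * H"])
    show "\<bar>g x * k x\<bar> \<le> B * H" if "norm x = 1" for x
      using that \<open>\<And>x. norm x = 1 \<Longrightarrow> \<bar>g x\<bar> \<le> B\<close>[of x] \<open>\<And>x. norm x = 1 \<Longrightarrow> \<bar>k x\<bar> \<le> H\<close>[of x]
      by (simp add: abs_mult mult_mono')
  qed measurable
  define q where "q x = pol \<nu> f x - f x" for x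
  have [measurable]: "q \<in> borel_measurable borel" unfolding q_def by measurable
  have qR: "q (reflection \<nu> x) = - q x" for x
    by (simp add: q_def pol_def refl_refl[OF nu] refl_inner_axis[OF nu] sgn_minus abs_minus_commute field_simps)
  have i: "integrable sphere_measure (\<lambda>x. q x * h x)"
    unfolding q_def left_diff_distrib using fB hB pB
    by (intro Bochner_Integration.integrable_diff int1) auto
  have i': "integrable sphere_measure (\<lambda>x. q x * h (reflection \<nu> x))"
    unfolding q_def left_diff_distrib using fB hB pB nu
    by (intro Bochner_Integration.integrable_diff int1) (auto simp: norm_refl)
  have "(\<integral>x. q x * h x \<partial>sphere_measure) = (\<integral>x. q (reflection \<nu> x) * h (reflection \<nu> x) \<partial>sphere_measure)"
    by (rule integral_refl[OF nu, symmetric]) measurable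
  also have "\<dots> = - (\<integral>x. q x * h (reflection \<nu> x) \<partial>sphere_measure)" by (simp add: qR)
  finally have "(\<integral>x. q x * h x \<partial>sphere_measure) = ((\<integral>x. q x * h x \<partial>sphere_measure) - (\<integral>x. q x * h (reflection \<nu> x) \<partial>sphere_measure)) / 2"
    by simp
  also have "\<dots> = (\<integral>x. q x * (h x - h (reflection \<nu> x)) / 2 \<partial>sphere_measure)"
    using i i' by (simp add: right_diff_distrib)
  finally show ?thesis
    using fB hB pB by (simp add: q_def left_diff_distrib int1)
qed

lemma integral_pol_ge:
  fixes f h :: "'a::euclidean_space \<Rightarrow> real"
  assumes nu: "norm \<nu> = 1" and "f \<in> borel_measurable borel" "h \<in> borel_measurable borel"
    and "\<And>x. norm x = 1 \<Longrightarrow> \<bar>f x\<bar> \<le> B" "\<And>x. norm x = 1 \<Longrightarrow> \<bar>h x\<bar> \<le> H"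
    and hR: "\<And>x. norm x = 1 \<Longrightarrow> x \<bullet> \<nu> > 0 \<Longrightarrow> h (reflection \<nu> x) \<le> h x"
  shows "(\<integral>x. f x * h x \<partial>sphere_measure) \<le> (\<integral>x. pol \<nu> f x * h x \<partial>sphere_measure)"
proof -
  have "0 \<le> (\<integral>x. (pol \<nu> f x - f x) * (h x - h (reflection \<nu> x)) / 2 \<partial>sphere_measure)"
  proof (rule integral_nonneg_AE)
    show "AE x in sphere_measure. 0 \<le> (pol \<nu> f x - f x) * (h x - h (reflection \<nu> x)) / 2"
      using AE_sphere_measure by eventually_elim (use pol_diff_mult_nonneg[OF nu, of h _ f] hR in auto)
  qed
  then show ?thesis using integral_pol_diff[OF assms(1-5)] by linarith
qed

lemma integral_pol:
  fixes f :: "'a::euclidean_space \<Rightarrow> real"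
  assumes nu: "norm \<nu> = 1" and "f \<in> borel_measurable borel" "\<And>x. norm x = 1 \<Longrightarrow> \<bar>f x\<bar> \<le> B"
  shows "(\<integral>x. pol \<nu> f x \<partial>sphere_measure) = (\<integral>x. f x \<partial>sphere_measure)"
  using integral_pol_diff[OF assms(1,2), of "\<lambda>_. 1" B 1] assms(3) by simp

text \<open>Subtracting \<open>\<epsilon>\<close> makes the function vanish at 0 together with its
  derivative, as \<open>C1_sgn_mult\<close> requires.\<close>

definition smooth_abs :: "real \<Rightarrow> real \<Rightarrow> real" where
  "smooth_abs \<epsilon> r = sqrt (r\<^sup>2 + \<epsilon>\<^sup>2) - \<epsilon>"

definition smooth_abs' :: "real \<Rightarrow> real \<Rightarrow> real" where
  "smooth_abs' \<epsilon> r = r / sqrt (r\<^sup>2 + \<epsilon>\<^sup>2)"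

lemma smooth_abs:
  assumes "\<epsilon> > 0"
  shows "(smooth_abs \<epsilon> has_real_derivative smooth_abs' \<epsilon> r) (at r)" "continuous_on UNIV (smooth_abs' \<epsilon>)"
    "\<bar>smooth_abs' \<epsilon> r\<bar> \<le> 1" "\<bar>smooth_abs \<epsilon> r - \<bar>r\<bar>\<bar> \<le> \<epsilon>" "smooth_abs \<epsilon> 0 = 0" "smooth_abs' \<epsilon> 0 = 0" "smooth_abs' \<epsilon> (- r) = - smooth_abs' \<epsilon> r"
proof -
  have pos: "r\<^sup>2 + \<epsilon>\<^sup>2 > 0" for r :: real using assms by (simp add: add_nonneg_pos)
  show "(smooth_abs \<epsilon> has_real_derivative smooth_abs' \<epsilon> r) (at r)"
    unfolding smooth_abs_def smooth_abs'_def using pos[of r]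
    by (auto intro!: derivative_eq_intros simp: field_simps)
  show "continuous_on UNIV (smooth_abs' \<epsilon>)"
    unfolding smooth_abs'_def using pos by (auto intro!: continuous_intros simp: less_imp_neq[symmetric])
  have ge: "\<bar>r\<bar> \<le> sqrt (r\<^sup>2 + \<epsilon>\<^sup>2)" by (rule real_le_rsqrt) simp
  show "\<bar>smooth_abs' \<epsilon> r\<bar> \<le> 1"
    using ge pos[of r] by (simp add: smooth_abs'_def abs_divide divide_le_eq)
  have "sqrt (r\<^sup>2 + \<epsilon>\<^sup>2) \<le> \<bar>r\<bar> + \<epsilon>"
    using assms by (intro real_le_lsqrt) (auto simp: power2_sum)
  then show "\<bar>smooth_abs \<epsilon> r - \<bar>r\<bar>\<bar> \<le> \<epsilon>" using ge by (simp add: smooth_abs_def)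
  show "smooth_abs \<epsilon> 0 = 0" "smooth_abs' \<epsilon> 0 = 0" "smooth_abs' \<epsilon> (- r) = - smooth_abs' \<epsilon> r"
    using assms by (auto simp: smooth_abs_def smooth_abs'_def)
qed

text \<open>The uniform closure of the \<open>C1\<close> functions with gradient at most
  \<open>L\<close> on the ball and energy at most \<open>E\<close>. \<open>L\<close> provides the
  equicontinuity for Arzela-Ascoli; \<open>E\<close> replaces the energy of \<open>v\<close>, which
  need not be differentiable.\<close>

definition approximable :: "real \<Rightarrow> real \<Rightarrow> real \<Rightarrow> ('a::euclidean_space \<Rightarrow> real) \<Rightarrow> bool" where
  "approximable p L E v \<longleftrightarrow> (\<forall>\<delta>>0. \<exists>U G. C1 U G \<and> (\<forall>x\<in>cball 0 1. norm (G x) \<le> L) \<and>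
     energy p G \<le> E \<and> (\<forall>x. norm x = 1 \<longrightarrow> \<bar>U x - v x\<bar> \<le> \<delta>))"

lemma approximable_lipschitz:
  assumes "approximable p L E v" "norm x = 1" "norm y = 1"
  shows "\<bar>v x - v y\<bar> \<le> L * norm (x - y)"
proof (rule field_le_epsilon)
  fix d :: real assume "d > 0"
  then obtain U G where U: "C1 U G" "\<And>x. x\<in>cball 0 1 \<Longrightarrow> norm (G x) \<le> L" "\<And>x. norm x = 1 \<Longrightarrow> \<bar>U x - v x\<bar> \<le> d/2"
    using assms(1) unfolding approximable_def by (metis half_gt_zero)
  have "\<bar>U x - U y\<bar> \<le> L * norm (x - y)"
    using assms by (intro C1_lipschitz[OF U(1,2)]) auto
  then show "\<bar>v x - v y\<bar> \<le> L * norm (x - y) + d"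
    using U(3)[OF assms(2)] U(3)[OF assms(3)] by linarith
qed

lemma approximable_continuous:
  assumes "approximable p L E v"
  shows "continuous_on (sphere 0 1) v"
proof (rule continuous_onI)
  fix x :: 'a and \<epsilon> :: real assume x: "x \<in> sphere 0 1" and "\<epsilon> > 0"
  show "\<exists>d>0. \<forall>x'\<in>sphere 0 1. dist x' x < d \<longrightarrow> dist (v x') (v x) \<le> \<epsilon>"
  proof (intro exI[of _ "\<epsilon> / (\<bar>L\<bar> + 1)"] conjI ballI impI)
    fix y :: 'a assume y: "y \<in> sphere 0 1" "dist y x < \<epsilon> / (\<bar>L\<bar> + 1)"
    have "\<bar>v y - v x\<bar> \<le> L * norm (y - x)"
      using approximable_lipschitz[OF assms] x y by simp
    also have "\<dots> \<le> (\<bar>L\<bar> + 1) * norm (y - x)" by (intro mult_right_mono) auto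
    also have "\<dots> \<le> \<epsilon>" using y(2) by (simp add: dist_norm field_simps)
    finally show "dist (v y) (v x) \<le> \<epsilon>" by (simp add: dist_real_def)
  qed (use \<open>\<epsilon> > 0\<close> in auto)
qed

text \<open>Smoothed absolute values have slope at most 1, so they increase neither the gradient nor
  the energy.\<close>

lemma approximable_abs:
  assumes U: "C1 U G" and L: "\<And>x. x \<in> cball 0 1 \<Longrightarrow> norm (G x) \<le> L" and p: "p > 0"
  shows "approximable p L (energy p G) (\<lambda>x. \<bar>U x\<bar>)"
  unfolding approximable_def
proof (intro allI impI)
  fix \<delta> :: real assume d: "\<delta> > 0"
  let ?G = "\<lambda>x. smooth_abs' \<delta> (U x) *\<^sub>R G x"
  have C: "C1 (\<lambda>x. smooth_abs \<delta> (U x)) ?G"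
    by (rule C1_real_compose[OF U]) (use smooth_abs[OF d] in auto)
  have nb: "norm (s *\<^sub>R y) \<le> norm y" if "\<bar>s\<bar> \<le> 1" for s and y :: 'a
    using that mult_left_le_one_le[of "norm y" "\<bar>s\<bar>"] by simp
  have "energy p ?G \<le> energy p G"
    unfolding energy_def
  proof (rule integral_mono)
    show "integrable sphere_measure (\<lambda>x. norm (tgrad ?G x) powr p)"
      "integrable sphere_measure (\<lambda>x. norm (tgrad G x) powr p)"
      using C1_continuous[OF C] C1_continuous[OF U] p by (intro integrable_energy; simp)+
    fix x
    have "tgrad ?G x = smooth_abs' \<delta> (U x) *\<^sub>R tgrad G x" by (simp add: tgrad_def algebra_simps)
    then show "norm (tgrad ?G x) powr p \<le> norm (tgrad G x) powr p"
      using p nb[OF smooth_abs(3)[OF d]] by (intro powr_mono2) auto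
  qed
  moreover have "\<forall>x\<in>cball 0 1. norm (?G x) \<le> L"
    using nb[OF smooth_abs(3)[OF d]] L order_trans by blast
  ultimately show "\<exists>V H. C1 V H \<and> (\<forall>x\<in>cball 0 1. norm (H x) \<le> L) \<and> energy p H \<le> energy p G \<and>
      (\<forall>x. norm x = 1 \<longrightarrow> \<bar>V x - \<bar>U x\<bar>\<bar> \<le> \<delta>)"
    using C smooth_abs(4)[OF d] by blast
qed

lemma approximable_limit:
  assumes "\<And>k::nat. approximable p L E (v k)" "\<And>\<epsilon>. \<epsilon> > 0 \<Longrightarrow> \<exists>N. \<forall>k\<ge>N. \<forall>x. norm x = 1 \<longrightarrow> \<bar>v k x - w x\<bar> < \<epsilon>"
  shows "approximable p L E w"
  unfolding approximable_def
proof (intro allI impI)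
  fix \<delta> :: real assume "\<delta> > 0"
  then have d: "\<delta> / 2 > 0" by simp
  obtain k where k: "\<And>x. norm x = 1 \<Longrightarrow> \<bar>v k x - w x\<bar> < \<delta>/2"
    using assms(2)[OF d] by blast
  obtain U G where UG: "C1 U G" "\<forall>x\<in>cball 0 1. norm (G x) \<le> L" "energy p G \<le> E"
     "\<And>x. norm x = 1 \<Longrightarrow> \<bar>U x - v k x\<bar> \<le> \<delta>/2"
    using assms(1)[of k] d unfolding approximable_def by blast
  have "\<bar>U x - w x\<bar> \<le> \<delta>" if "norm x = 1" for x
    using k[OF that] UG(4)[OF that] by linarith
  then show "\<exists>U G. C1 U G \<and> (\<forall>x\<in>cball 0 1. norm (G x) \<le> L) \<and> energy p G \<le> E \<and>
      (\<forall>x. norm x = 1 \<longrightarrow> \<bar>U x - w x\<bar> \<le> \<delta>)"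
    using UG by blast
qed

text \<open>Replacing the absolute value in the definition of the polarization by a smooth one
  keeps the function \<open>C\<^sup>1\<close>: its argument vanishes on the reflecting hyperplane. The new gradient
  is a convex combination of the gradient and of its reflection, with weights that are invariant
  under the reflection, so convexity bounds the energy.\<close>

lemma approximable_pol:
  fixes \<nu> :: "'a::euclidean_space"
  assumes nu: "norm \<nu> = 1" and p: "p \<ge> 1" and v: "approximable p L E v"
  shows "approximable p L E (pol \<nu> v)"
  unfolding approximable_def
proof (intro allI impI)
  fix \<delta> :: real assume "\<delta> > 0"
  then have d: "\<delta> / 2 > 0" by simp
  \<comment> \<open>One half of the tolerance pays for replacing \<open>v\<close> by
    \<open>U\<close>, the other for smoothing the absolute value; \<open>pol \<nu>\<close> does not
    increase uniform distances.\<close>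
  define \<epsilon> where "\<epsilon> = \<delta> / 2"
  have e: "\<epsilon> > 0" using d by (simp add: \<epsilon>_def)
  obtain U G where U: "C1 U G" and L: "\<And>x. x\<in>cball 0 1 \<Longrightarrow> norm (G x) \<le> L" and E: "energy p G \<le> E"
    and Uv: "\<And>x. norm x = 1 \<Longrightarrow> \<bar>U x - v x\<bar> \<le> \<epsilon>"
    using v d unfolding approximable_def \<epsilon>_def by blast
  let ?R = "reflection \<nu>"
  define D where "D x = (1/2) * (U x + (-1) * U (?R x))" for x
  define DG where "DG x = (1/2) *\<^sub>R (G x + (-1) *\<^sub>R ?R (G (?R x)))" for x
  define T where "T x = (1/2) * (U x + U (?R x)) + sgn (x \<bullet> \<nu>) * smooth_abs \<epsilon> (D x)" for x
  define TG where "TG x = (1/2) *\<^sub>R (G x + ?R (G (?R x))) + sgn (x \<bullet> \<nu>) *\<^sub>R (smooth_abs' \<epsilon> (D x) *\<^sub>R DG x)" for x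
  have UR: "C1 (\<lambda>x. U (?R x)) (\<lambda>x. ?R (G (?R x)))" by (rule C1_refl[OF nu U])
  have "C1 D DG" unfolding D_def DG_def by (intro C1_add C1_cmult U UR)
  then have "C1 (\<lambda>x. smooth_abs \<epsilon> (D x)) (\<lambda>x. smooth_abs' \<epsilon> (D x) *\<^sub>R DG x)"
    by (rule C1_real_compose) (use smooth_abs[OF e] in auto)
  then have "C1 (\<lambda>x. sgn (x \<bullet> \<nu>) * smooth_abs \<epsilon> (D x)) (\<lambda>x. sgn (x \<bullet> \<nu>) *\<^sub>R (smooth_abs' \<epsilon> (D x) *\<^sub>R DG x))"
    by (rule C1_sgn_mult) (simp add: D_def refl_fixed smooth_abs[OF e])
  then have C: "C1 T TG"
    unfolding T_def TG_def by (intro C1_add C1_cmult U UR)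
  \<comment> \<open>Both factors are odd under the reflection, hence \<open>\<tau>\<close> and the
    weight \<open>l\<close> are invariant.\<close>
  define \<tau> where "\<tau> x = sgn (x \<bullet> \<nu>) * smooth_abs' \<epsilon> (D x)" for x
  have \<tau>R: "\<tau> (?R x) = \<tau> x" for x
  proof -
    have "D (?R x) = - D x" by (simp add: D_def refl_refl[OF nu] field_simps)
    then show ?thesis by (simp add: \<tau>_def refl_inner_axis[OF nu] smooth_abs(7)[OF e] sgn_minus)
  qed
  have \<tau>1: "\<bar>\<tau> x\<bar> \<le> 1" for x
    using smooth_abs(3)[OF e, of "D x"] by (auto simp: \<tau>_def abs_mult abs_sgn_eq)
  define l where "l x = (1 + \<tau> x) / 2" for x
  have lam: "0 \<le> l x" "l x \<le> 1" "l (?R x) = l x" for x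
    using \<tau>1[of x] by (auto simp: l_def \<tau>R abs_le_iff)
  have TG: "TG x = l x *\<^sub>R G x + (1 - l x) *\<^sub>R ?R (G (?R x))" for x
  proof -
    have gen: "(1/2) *\<^sub>R (X + Y) + g *\<^sub>R (a *\<^sub>R ((1/2) *\<^sub>R (X + (-1) *\<^sub>R Y)))
        = ((1 + g * a) / 2) *\<^sub>R X + (1 - (1 + g * a) / 2) *\<^sub>R Y" for X Y :: 'a and g a
    proof -
      have "(1/2) *\<^sub>R (X + Y) + g *\<^sub>R (a *\<^sub>R ((1/2) *\<^sub>R (X + (-1) *\<^sub>R Y)))
        = (1/2 + g * a / 2) *\<^sub>R X + (1/2 - g * a / 2) *\<^sub>R Y"
        by (simp add: scaleR_add_right scaleR_add_left scaleR_diff_left scaleR_diff_right)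
      also have "1/2 + g * a / 2 = (1 + g * a) / 2" by (simp add: add_divide_distrib)
      also have "1/2 - g * a / 2 = 1 - (1 + g * a) / 2" by (simp add: field_simps)
      finally show ?thesis .
    qed
    show ?thesis unfolding TG_def DG_def l_def \<tau>_def by (rule gen)
  qed
  have TGL: "norm (TG x) \<le> L" if x: "x \<in> cball 0 1" for x
  proof -
    have "norm (TG x) \<le> l x * norm (G x) + (1 - l x) * norm (G (?R x))"
      unfolding TG using lam[of x] by (intro order_trans[OF norm_triangle_ineq]) (simp add: norm_refl[OF nu])
    also have "\<dots> \<le> l x * L + (1 - l x) * L"
      using lam[of x] x L[of x] L[of "?R x"] by (intro add_mono mult_left_mono) (auto simp: norm_refl[OF nu])
    finally show ?thesis by (simp add: algebra_simps)
  qed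
  have tg: "tgrad TG x = l x *\<^sub>R tgrad G x + (1 - l x) *\<^sub>R ?R (tgrad G (?R x))" for x
    unfolding tgrad_def TG
    by (simp add: refl_diff refl_scaleR refl_refl[OF nu] refl_adjoint algebra_simps scaleR_add_left)
  have iG: "integrable sphere_measure (\<lambda>x. norm (tgrad G x) powr p)"
    using C1_continuous[OF U] p by (intro integrable_energy) auto
  have iT: "integrable sphere_measure (\<lambda>x. norm (tgrad TG x) powr p)"
    using C1_continuous[OF C] p by (intro integrable_energy) auto
  let ?g = "\<lambda>x. norm (tgrad G x) powr p"
  have [measurable]: "?g \<in> borel_measurable borel" using borel_measurable_integrable[OF iG] by simp
  have [measurable]: "l \<in> borel_measurable borel"
  proof -
    have "continuous_on UNIV (smooth_abs' \<epsilon>)" by (rule smooth_abs(2)[OF e])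
    then have [measurable]: "smooth_abs' \<epsilon> \<in> borel_measurable borel" by (rule borel_measurable_continuous_onI)
    have [measurable]: "U \<in> borel_measurable borel" using C1_measurable[OF U] by simp
    show ?thesis unfolding l_def \<tau>_def D_def by measurable
  qed
  have mult_int: "integrable sphere_measure (\<lambda>x. m x * ?g x)"
    if [measurable]: "m \<in> borel_measurable borel" and m: "\<And>x. 0 \<le> m x \<and> m x \<le> 1" for m
  proof (rule Bochner_Integration.integrable_bound[OF iG])
    show "AE x in sphere_measure. norm (m x * ?g x) \<le> norm (?g x)"
      using m by (auto intro!: mult_left_le_one_le simp: abs_mult)
  qed measurable
  have i1: "integrable sphere_measure (\<lambda>x. l x * ?g x)" and i2: "integrable sphere_measure (\<lambda>x. (1 - l x) * ?g x)"
    using lam by (intro mult_int; simp)+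
  \<comment> \<open>By the invariance of \<open>l\<close> the reflected gradient is folded back onto
    the original one with the same weight, and the two weights then add up to 1.\<close>
  have eqR: "(\<integral>x. (1 - l x) * ?g (?R x) \<partial>sphere_measure) = (\<integral>x. (1 - l x) * ?g x \<partial>sphere_measure)"
    using integral_refl[OF nu, of "\<lambda>x. (1 - l x) * ?g x"] by (simp add: lam(3))
  have i3: "integrable sphere_measure (\<lambda>x. (1 - l x) * ?g (?R x))"
  proof -
    have "integrable (distr sphere_measure borel ?R) (\<lambda>x. (1 - l x) * ?g x)"
      using i2 by (simp add: sphere_measure_distr_isometry[OF linear_refl norm_refl[OF nu]])
    then show ?thesis by (subst (asm) integrable_distr_eq) (auto simp: lam(3))
  qed
  have "energy p TG \<le> (\<integral>x. l x * ?g x + (1 - l x) * ?g (?R x) \<partial>sphere_measure)"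
    unfolding energy_def
  proof (rule integral_mono[OF iT])
    show "integrable sphere_measure (\<lambda>x. l x * ?g x + (1 - l x) * ?g (?R x))"
      using i1 i3 by simp
    fix x
    have "norm (tgrad TG x) \<le> l x * norm (tgrad G x) + (1 - l x) * norm (tgrad G (?R x))"
      unfolding tg using lam[of x] by (intro order_trans[OF norm_triangle_ineq]) (simp add: norm_refl[OF nu])
    then have "norm (tgrad TG x) powr p \<le> (l x * norm (tgrad G x) + (1 - l x) * norm (tgrad G (?R x))) powr p"
      using p by (intro powr_mono2) auto
    also have "\<dots> \<le> l x * ?g x + (1 - l x) * ?g (?R x)"
      using lam[of x] p by (intro powr_convex_combination) auto
    finally show "norm (tgrad TG x) powr p \<le> l x * ?g x + (1 - l x) * ?g (?R x)" .
  qed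
  also have "\<dots> = (\<integral>x. l x * ?g x \<partial>sphere_measure) + (\<integral>x. (1 - l x) * ?g x \<partial>sphere_measure)"
    using i1 i3 by (simp add: eqR)
  also have "\<dots> = (\<integral>x. l x * ?g x + (1 - l x) * ?g x \<partial>sphere_measure)"
    using i1 i2 by simp
  also have "\<dots> = energy p G" by (simp add: energy_def algebra_simps)
  finally have En: "energy p TG \<le> E" using E by simp
  have "\<bar>T x - pol \<nu> v x\<bar> \<le> \<delta>" if x: "norm x = 1" for x
  proof -
    have "(U x - U (?R x)) / 2 = D x" by (simp add: D_def diff_divide_distrib)
    then have "T x - pol \<nu> U x = sgn (x \<bullet> \<nu>) * (smooth_abs \<epsilon> (D x) - \<bar>D x\<bar>)"
      by (simp add: T_def pol_def right_diff_distrib)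
    then have "\<bar>T x - pol \<nu> U x\<bar> \<le> \<epsilon>"
      using smooth_abs(4)[OF e, of "D x"] e by (auto simp: abs_mult abs_sgn_eq)
    moreover have "\<bar>pol \<nu> U x - pol \<nu> v x\<bar> \<le> \<epsilon>"
      using Uv[OF x] Uv[of "?R x"] x by (auto simp: pol_eq norm_refl[OF nu] max_def min_def abs_le_iff)
    ultimately show ?thesis unfolding \<epsilon>_def by linarith
  qed
  then show "\<exists>U G. C1 U G \<and> (\<forall>x\<in>cball 0 1. norm (G x) \<le> L) \<and> energy p G \<le> E \<and>
      (\<forall>x. norm x = 1 \<longrightarrow> \<bar>U x - pol \<nu> v x\<bar> \<le> \<delta>)"
    using C TGL En by blast
qed

section \<open>Symmetrization\<close>

lemma AE_zero_continuous_on_sphere: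
  fixes f :: "'a::euclidean_space \<Rightarrow> real"
  assumes f: "continuous_on (sphere 0 1) f" and ae: "AE x in sphere_measure. f x = 0" and x: "norm x = 1"
  shows "f x = 0"
proof (rule ccontr)
  assume "f x \<noteq> 0"
  have "openin (top_of_set (sphere 0 1)) (sphere 0 1 \<inter> f -` (- {0}))"
    using f by (rule continuous_openin_preimage_gen) auto
  then obtain U where U: "open U" "sphere 0 1 \<inter> f -` (- {0}) = sphere 0 1 \<inter> U"
    unfolding openin_open by (elim exE conjE) (rule that)
  have U': "y \<in> U \<longleftrightarrow> f y \<noteq> 0" if "norm y = 1" for y
    using that arg_cong[OF U(2), of "\<lambda>S. y \<in> S"] by simp
  have "x \<in> U" using U'[OF x] \<open>f x \<noteq> 0\<close> by simp
  from emeasure_sphere_measure_open_pos[OF U(1) this x] have "emeasure sphere_measure U \<noteq> 0"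
    unfolding zero_less_iff_neq_zero .
  moreover have "AE x in sphere_measure. x \<notin> U"
    using ae AE_sphere_measure by eventually_elim (use U' in simp)
  then have "emeasure sphere_measure U = 0"
    using U(1) by (subst (asm) AE_iff_measurable[of U]) auto
  ultimately show False by simp
qed

text \<open>The conditions on the positivity set and on the weighted integral are inequalities, in
  the directions that survive a uniform limit: the positivity set may shrink in the limit, and
  polarization may raise the weighted integral.\<close>

definition admissible :: "real \<Rightarrow> real \<Rightarrow> real \<Rightarrow> real \<Rightarrow> real \<Rightarrow> ('a::euclidean_space \<Rightarrow> real) \<Rightarrow> real \<Rightarrow> ('a \<Rightarrow> real) \<Rightarrow> bool"
  where "admissible p L E B m h I v \<longleftrightarrow> v \<in> borel_measurable borel \<and> approximable p L E v \<and>
    (\<forall>x. 0 \<le> v x) \<and> (\<forall>x. norm x = 1 \<longrightarrow> v x \<le> B) \<and> measure sphere_measure {x. v x > 0} \<le> m \<and>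
    I \<le> (\<integral>x. v x powr p * h x \<partial>sphere_measure)"

lemma admissible_pol:
  fixes h :: "'a::euclidean_space \<Rightarrow> real"
  assumes nu: "norm \<nu> = 1" and p: "p \<ge> 1" and [measurable]: "h \<in> borel_measurable borel"
    and H: "\<And>x. norm x = 1 \<Longrightarrow> \<bar>h x\<bar> \<le> H"
    and hR: "\<And>x. norm x = 1 \<Longrightarrow> x \<bullet> \<nu> > 0 \<Longrightarrow> h (reflection \<nu> x) \<le> h x"
    and adm: "admissible p L E B m h I v"
  shows "admissible p L E B m h I (pol \<nu> v)"
proof -
  have [measurable]: "v \<in> borel_measurable borel" and appr: "approximable p L E v" and v0: "\<And>x. 0 \<le> v x"
    and vB: "\<And>x. norm x = 1 \<Longrightarrow> v x \<le> B" and vm: "measure sphere_measure {x. v x > 0} \<le> m"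
    and vI: "I \<le> (\<integral>x. v x powr p * h x \<partial>sphere_measure)"
    using adm by (auto simp: admissible_def)
  have p0: "0 \<le> pol \<nu> v x" for x using v0 by (auto simp: pol_eq le_max_iff_disj)
  have pB: "pol \<nu> v x \<le> B" if "norm x = 1" for x
    using vB[OF that] vB[of "reflection \<nu> x"] that nu by (auto simp: pol_eq norm_refl max_def min_def)
  have "measure sphere_measure {x. pol \<nu> v x > 0} = measure sphere_measure {x. v x > 0}"
  proof -
    \<comment> \<open>The measure of the positivity set is the integral of a monotone function of
      \<open>v\<close>, to which \<open>pol_mono_compose\<close> applies.\<close>
    let ?\<phi> = "\<lambda>r. indicator {0<..} r :: real"
    have eq: "measure sphere_measure {x. w x > 0} = (\<integral>x. ?\<phi> (w x) \<partial>sphere_measure)"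
      if [measurable]: "w \<in> borel_measurable borel" for w :: "'a \<Rightarrow> real"
    proof -
      have "(\<integral>x. ?\<phi> (w x) \<partial>sphere_measure) = (\<integral>x. indicator {x. w x > 0} x \<partial>sphere_measure)"
        by (intro Bochner_Integration.integral_cong) (auto simp: indicator_def)
      then show ?thesis by simp
    qed
    have "mono ?\<phi>" by (auto simp: mono_def indicator_def)
    then have "pol \<nu> (\<lambda>x. ?\<phi> (v x)) = (\<lambda>x. ?\<phi> (pol \<nu> v x))"
      by (intro ext pol_mono_compose)
    then have "(\<integral>x. ?\<phi> (pol \<nu> v x) \<partial>sphere_measure) = (\<integral>x. pol \<nu> (\<lambda>x. ?\<phi> (v x)) x \<partial>sphere_measure)"
      by (simp only:)
    also have "\<dots> = (\<integral>x. ?\<phi> (v x) \<partial>sphere_measure)"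
    proof (rule integral_pol[OF nu])
      show "(\<lambda>x. ?\<phi> (v x)) \<in> borel_measurable borel" by measurable
      show "\<bar>?\<phi> (v x)\<bar> \<le> 1" for x by (simp add: indicator_def)
    qed
    finally show ?thesis by (simp add: eq)
  qed
  moreover have "I \<le> (\<integral>x. pol \<nu> v x powr p * h x \<partial>sphere_measure)"
  proof -
    \<comment> \<open>With \<open>max 0\<close> the power is monotone on the whole line;
      \<open>v\<close> is nonnegative, so nothing changes.\<close>
    let ?\<phi> = "\<lambda>r. max 0 r powr p"
    have "mono ?\<phi>" using p by (auto simp: mono_def intro!: powr_mono2)
    then have "pol \<nu> v x powr p = pol \<nu> (\<lambda>x. ?\<phi> (v x)) x" for x
      using pol_mono_compose[of ?\<phi> \<nu> v x] p0[of x] by simp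
    moreover have "(\<integral>x. ?\<phi> (v x) * h x \<partial>sphere_measure) \<le> (\<integral>x. pol \<nu> (\<lambda>x. ?\<phi> (v x)) x * h x \<partial>sphere_measure)"
    proof (rule integral_pol_ge[where h = h, OF nu _ _ _ H hR])
      show "\<bar>?\<phi> (v x)\<bar> \<le> B powr p" if "norm x = 1" for x
        using v0[of x] vB[OF that] p by (auto intro!: powr_mono2)
      show "(\<lambda>x. ?\<phi> (v x)) \<in> borel_measurable borel" by measurable
    qed auto
    ultimately show ?thesis using vI v0 by simp
  qed
  ultimately show ?thesis
    using approximable_pol[OF nu p appr] p0 pB vm by (simp add: admissible_def)
qed

lemma tendsto_integral_uniform_sphere:
  fixes v :: "nat \<Rightarrow> 'a::euclidean_space \<Rightarrow> real"
  assumes [measurable]: "\<And>k. v k \<in> borel_measurable borel" "h \<in> borel_measurable borel"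
    and vB: "\<And>k x. norm x = 1 \<Longrightarrow> \<bar>v k x\<bar> \<le> B" and H: "\<And>x. norm x = 1 \<Longrightarrow> \<bar>h x\<bar> \<le> H"
    and lim: "\<And>x. norm x = 1 \<Longrightarrow> (\<lambda>k. v k x) \<longlonglongrightarrow> w x"
    and [measurable]: "w \<in> borel_measurable borel"
  shows "(\<lambda>k. \<integral>x. v k x * h x \<partial>sphere_measure) \<longlonglongrightarrow> (\<integral>x. w x * h x \<partial>sphere_measure)"
proof (rule integral_dominated_convergence[where w = "\<lambda>_. B * H"])
  show "AE x in sphere_measure. (\<lambda>k. v k x * h x) \<longlonglongrightarrow> w x * h x"
    using AE_sphere_measure by eventually_elim (intro tendsto_intros lim)
  show "AE x in sphere_measure. norm (v k x * h x) \<le> B * H" for k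
    using AE_sphere_measure by eventually_elim (use vB H in \<open>auto simp: abs_mult intro!: mult_mono'\<close>)
qed auto

lemma admissible_limit:
  fixes v :: "nat \<Rightarrow> 'a::euclidean_space \<Rightarrow> real" and h :: "'a::euclidean_space \<Rightarrow> real"
  assumes p: "p \<ge> 1" and [measurable]: "h \<in> borel_measurable borel"
    and H: "\<And>x. norm x = 1 \<Longrightarrow> \<bar>h x\<bar> \<le> H"
    and adm: "\<And>k. admissible p L E B m h I (v k)"
    and lim: "\<And>\<epsilon>. \<epsilon> > 0 \<Longrightarrow> \<exists>N. \<forall>k\<ge>N. \<forall>x. norm x = 1 \<longrightarrow> \<bar>v k x - w x\<bar> < \<epsilon>"
    and w0: "\<And>x. norm x \<noteq> 1 \<Longrightarrow> w x = 0" and [measurable]: "w \<in> borel_measurable borel"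
  shows "admissible p L E B m h I w"
proof -
  have [measurable]: "v k \<in> borel_measurable borel" and v0: "0 \<le> v k x"
    and vm: "measure sphere_measure {x. v k x > 0} \<le> m"
    and vI: "I \<le> (\<integral>x. v k x powr p * h x \<partial>sphere_measure)" for k x
    using adm by (auto simp: admissible_def)
  have vB: "v k x \<le> B" if "norm x = 1" for k x
    using adm that by (auto simp: admissible_def)
  have ptw: "(\<lambda>k. v k x) \<longlonglongrightarrow> w x" if "norm x = 1" for x
    using lim that unfolding LIMSEQ_def dist_real_def by blast
  have wB: "w x \<le> B" and wn: "0 \<le> w x" if "norm x = 1" for x
    using ptw[OF that] vB[OF that] v0 by (auto intro: LIMSEQ_le_const2 LIMSEQ_le_const)
  then have wn: "0 \<le> w x" for x using w0[of x] by (cases "norm x = 1") auto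
  have "(\<lambda>k. \<integral>x. v k x powr p * h x \<partial>sphere_measure) \<longlonglongrightarrow> (\<integral>x. w x powr p * h x \<partial>sphere_measure)"
  proof (rule tendsto_integral_uniform_sphere[OF _ _ _ H])
    show "\<bar>v k x powr p\<bar> \<le> B powr p" if "norm x = 1" for k x
      using v0[of k x] vB[OF that, of k] p by (auto intro!: powr_mono2)
    show "(\<lambda>k. v k x powr p) \<longlonglongrightarrow> w x powr p" if "norm x = 1" for x
      using p v0 by (intro tendsto_powr'[OF ptw[OF that] tendsto_const]) auto
  qed auto
  then have "I \<le> (\<integral>x. w x powr p * h x \<partial>sphere_measure)"
    using vI by (intro LIMSEQ_le_const) auto
  moreover have "measure sphere_measure {x. w x > 0} \<le> m"
  proof (rule LIMSEQ_le_const2)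
    \<comment> \<open>Where \<open>w\<close> exceeds a fixed level, some \<open>v k\<close> is
      positive as soon as the uniform error is below that level. Thus each level set obeys the
      bound, and the levels decrease to 0.\<close>
    let ?A = "\<lambda>n. {x. w x > 1 / real (Suc n)}"
    have "(\<lambda>n. measure sphere_measure (?A n)) \<longlonglongrightarrow> measure sphere_measure (\<Union>n. ?A n)"
    proof (rule sphere.finite_Lim_measure_incseq)
      show "incseq ?A"
      proof (rule incseq_SucI)
        fix n
        have "1 / real (Suc (Suc n)) \<le> 1 / real (Suc n)" by (intro divide_left_mono) auto
        then show "?A n \<subseteq> ?A (Suc n)" by (meson Collect_mono order.strict_trans1)
      qed
    qed auto
    also have "(\<Union>n. ?A n) = {x. w x > 0}"
    proof safe
      fix x n assume "1 / real (Suc n) < w x"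
      moreover have "0 < 1 / real (Suc n)" by simp
      ultimately show "0 < w x" by linarith
    next
      fix x assume "0 < w x"
      then obtain n where "1 / real (Suc n) < w x" by (rule nat_approx_posE)
      then show "x \<in> (\<Union>n. ?A n)" by blast
    qed
    finally show "(\<lambda>n. measure sphere_measure (?A n)) \<longlonglongrightarrow> measure sphere_measure {x. w x > 0}" .
    have "measure sphere_measure (?A n) \<le> m" for n
    proof -
      obtain k where k: "\<And>x. norm x = 1 \<Longrightarrow> \<bar>v k x - w x\<bar> < 1 / real (Suc n)"
        using lim[of "1 / real (Suc n)"] by auto
      have "?A n \<subseteq> {x. v k x > 0}"
      proof safe
        fix x assume x: "w x > 1 / real (Suc n)"
        have "1 / real (Suc n) > 0" by simp
        then have "norm x = 1" using w0[of x] x by linarith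
        from k[OF this] x show "v k x > 0" by linarith
      qed
      then have "measure sphere_measure (?A n) \<le> measure sphere_measure {x. v k x > 0}"
        by (intro sphere.finite_measure_mono) auto
      then show ?thesis using vm[of k] by linarith
    qed
    then show "\<exists>N. \<forall>n\<ge>N. measure sphere_measure (?A n) \<le> m" by blast
  qed
  moreover have "approximable p L E w"
    by (rule approximable_limit[OF _ lim]) (use adm in \<open>auto simp: admissible_def\<close>)
  ultimately show ?thesis using wB wn by (simp add: admissible_def)
qed

text \<open>Maximising \<open>\<integral> v (x \<bullet> e)\<close> over the admissible class, which is compact by Arzela-Ascoli and stable under
  polarization, produces a function that every polarization towards the pole \<open>e\<close> fixes. Such
  a function decreases with the distance to the pole.\<close>

theorem symmetrization:
  fixes h :: "'a::euclidean_space \<Rightarrow> real"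
  assumes p: "p \<ge> 1" and e: "norm e = 1" and U: "C1 U G"
    and [measurable]: "h \<in> borel_measurable borel" and H: "\<And>x. norm x = 1 \<Longrightarrow> \<bar>h x\<bar> \<le> H"
    and hmono: "\<And>x y. norm x = 1 \<Longrightarrow> norm y = 1 \<Longrightarrow> x \<bullet> e \<le> y \<bullet> e \<Longrightarrow> h x \<le> h y"
  obtains v L where "v \<in> borel_measurable borel" "\<And>x. 0 \<le> v x" "approximable p L (energy p G) v"
    "\<And>x y. norm x = 1 \<Longrightarrow> norm y = 1 \<Longrightarrow> x \<bullet> e < y \<bullet> e \<Longrightarrow> v x \<le> v y"
    "measure sphere_measure {x. v x > 0} \<le> measure sphere_measure {x. U x \<noteq> 0}"
    "(\<integral>x. \<bar>U x\<bar> powr p * h x \<partial>sphere_measure) \<le> (\<integral>x. v x powr p * h x \<partial>sphere_measure)"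
proof -
  obtain L where L: "\<And>x. x \<in> cball 0 1 \<Longrightarrow> norm (G x) \<le> L"
    using C1_gradient_bounded[OF U] by blast
  define E where "E = energy p G"
  define m where "m = measure sphere_measure {x. U x \<noteq> 0}"
  define I where "I = (\<integral>x. \<bar>U x\<bar> powr p * h x \<partial>sphere_measure)"
  have [measurable]: "U \<in> borel_measurable borel" using C1_measurable[OF U] by simp
  have "bounded (U ` sphere 0 1)"
    using C1_continuous(1)[OF U] by (intro compact_imp_bounded compact_continuous_image) auto
  then obtain B where "\<forall>y\<in>U ` sphere 0 1. norm y \<le> B" unfolding bounded_iff by blast
  then have B: "\<bar>U x\<bar> \<le> B" if "norm x = 1" for x using that by auto
  define \<F> where "\<F> = {v. admissible p L E B m h I v}"
  define J where "J v = (\<integral>x. v x * (x \<bullet> e) \<partial>sphere_measure)" for v :: "'a \<Rightarrow> real"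
  have xe: "\<bar>x \<bullet> e\<bar> \<le> 1" if "norm x = 1" for x using Cauchy_Schwarz_ineq2[of x e] that e by simp
  have "(\<lambda>x. \<bar>U x\<bar>) \<in> \<F>"
    using approximable_abs[OF U L, of p] p B unfolding \<F>_def admissible_def E_def m_def I_def by simp
  then have ne: "\<F> \<noteq> {}" by blast
  have bdd: "bdd_above (J ` \<F>)"
  proof (rule bdd_aboveI2)
    fix v assume v: "v \<in> \<F>"
    have "J v \<le> (\<integral>x. B \<partial>(sphere_measure :: 'a measure))"
      unfolding J_def
    proof (rule integral_mono_AE)
      have [measurable]: "v \<in> borel_measurable borel" using v by (simp add: \<F>_def admissible_def)
      have le: "\<bar>v x * (x \<bullet> e)\<bar> \<le> B" if "norm x = 1" for x
      proof -
        have "\<bar>v x\<bar> * \<bar>x \<bullet> e\<bar> \<le> B * 1"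
          using v that xe[OF that] by (intro mult_mono') (auto simp: \<F>_def admissible_def)
        then show ?thesis by (simp add: abs_mult)
      qed
      then show "integrable sphere_measure (\<lambda>x. v x * (x \<bullet> e))"
        by (intro integrable_sphere_bounded[of _ B]) auto
      show "AE x in sphere_measure. v x * (x \<bullet> e) \<le> B"
        using AE_sphere_measure by eventually_elim (use le in force)
    qed simp
    then show "J v \<le> (\<integral>x. B \<partial>(sphere_measure :: 'a measure))" .
  qed
  define s where "s = Sup (J ` \<F>)"
  have "\<exists>v\<in>\<F>. J v > s - 1 / real (Suc k)" for k
  proof -
    have "s - 1 / real (Suc k) < s" by simp
    then show ?thesis unfolding s_def by (subst (asm) less_cSup_iff) (use ne bdd in auto)
  qed
  then obtain V where V: "\<And>k. V k \<in> \<F>" "\<And>k. J (V k) > s - 1 / real (Suc k)" by metis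
  obtain g r where g: "continuous_on (sphere 0 1) g" and r: "strict_mono (r :: nat \<Rightarrow> nat)"
    and conv: "\<And>\<epsilon>. 0 < \<epsilon> \<Longrightarrow> \<exists>N. \<forall>n x. n \<ge> N \<and> x \<in> sphere 0 1 \<longrightarrow> norm (V (r n) x - g x) < \<epsilon>"
  proof (rule Arzela_Ascoli[of "sphere (0::'a) 1" V B])
    fix n and x :: 'a assume "x \<in> sphere 0 1"
    then show "norm (V n x) \<le> B" using V(1)[of n] by (auto simp: \<F>_def admissible_def)
  next
    fix x :: 'a and \<epsilon> :: real assume x: "x \<in> sphere 0 1" and "\<epsilon> > 0"
    show "\<exists>d>0. \<forall>n y. y \<in> sphere 0 1 \<and> norm (x - y) < d \<longrightarrow> norm (V n x - V n y) < \<epsilon>"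
    proof (intro exI[of _ "\<epsilon> / (\<bar>L\<bar> + 1)"] conjI allI impI)
      fix n y assume y: "y \<in> sphere 0 1 \<and> norm (x - y) < \<epsilon> / (\<bar>L\<bar> + 1)"
      have "\<bar>V n x - V n y\<bar> \<le> L * norm (x - y)"
        using x y V(1)[of n] by (intro approximable_lipschitz) (auto simp: \<F>_def admissible_def)
      also have "\<dots> \<le> (\<bar>L\<bar> + 1) * norm (x - y)" by (intro mult_right_mono) auto
      also have "\<dots> < \<epsilon>" using y by (simp add: field_simps)
      finally show "norm (V n x - V n y) < \<epsilon>" by simp
    qed (use \<open>\<epsilon> > 0\<close> in auto)
  qed auto
  \<comment> \<open>The limit exists on the sphere only. The value 0 elsewhere keeps
    \<open>v\<close> measurable and nonnegative everywhere and the positivity set inside the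
    sphere.\<close>
  define v where "v x = (if x \<in> sphere 0 1 then g x else 0)" for x
  have [measurable]: "v \<in> borel_measurable borel"
    unfolding v_def by (rule borel_measurable_continuous_on_if) (use g in auto)
  have lim: "\<exists>N. \<forall>k\<ge>N. \<forall>x. norm x = 1 \<longrightarrow> \<bar>V (r k) x - v x\<bar> < \<epsilon>" if "\<epsilon> > 0" for \<epsilon>
    using conv[OF that] by (auto simp: v_def)
  have adm: "admissible p L E B m h I v"
    by (rule admissible_limit[OF p _ H _ lim]) (use V(1) \<open>v \<in> borel_measurable borel\<close> in \<open>auto simp: \<F>_def\<close>, simp add: v_def)
  have "(\<lambda>k. J (V (r k))) \<longlonglongrightarrow> J v"
    unfolding J_def
  proof (rule tendsto_integral_uniform_sphere[OF _ _ _ xe])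
    show "V (r k) \<in> borel_measurable borel" for k using V(1)[of "r k"] by (auto simp: \<F>_def admissible_def)
    show "\<bar>V (r k) x\<bar> \<le> B" if "norm x = 1" for k x
      using V(1)[of "r k"] that by (auto simp: \<F>_def admissible_def)
    show "(\<lambda>k. V (r k) x) \<longlonglongrightarrow> v x" if "norm x = 1" for x
      using lim that unfolding LIMSEQ_def dist_real_def by blast
  qed auto
  moreover have "(\<lambda>k. s - 1 / real (Suc (r k))) \<longlonglongrightarrow> s - 0"
  proof (intro tendsto_intros)
    have "(\<lambda>k. inverse (real (Suc k))) \<longlonglongrightarrow> 0" by (rule LIMSEQ_inverse_real_of_nat)
    from LIMSEQ_subseq_LIMSEQ[OF this r] show "(\<lambda>k. 1 / real (Suc (r k))) \<longlonglongrightarrow> 0"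
      by (simp add: o_def inverse_eq_divide)
  qed
  ultimately have "s \<le> J v"
    using V(2) by (intro LIMSEQ_le[where X = "\<lambda>k. s - 1 / real (Suc (r k))"]) (auto intro: less_imp_le)
  have max: "J w \<le> J v" if "w \<in> \<F>" for w
  proof -
    have "J w \<le> s" unfolding s_def using that bdd by (intro cSUP_upper) auto
    then show ?thesis using \<open>s \<le> J v\<close> by linarith
  qed
  have vcont: "continuous_on (sphere 0 1) v"
    using adm by (intro approximable_continuous) (auto simp: admissible_def)
  have vB: "\<bar>v x\<bar> \<le> B" if "norm x = 1" for x using adm that by (auto simp: admissible_def)
  have dec: "v y \<le> v x" if x: "norm x = 1" and y: "norm y = 1" and xy: "y \<bullet> e < x \<bullet> e" for x y
  proof -
    \<comment> \<open>The reflection in the bisecting hyperplane of \<open>x\<close> and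
      \<open>y\<close> exchanges them, and \<open>y \<bullet> e < x \<bullet> e\<close> puts the
      pole on the side of \<open>x\<close>.\<close>
    define \<nu> where "\<nu> = (x - y) /\<^sub>R norm (x - y)"
    have "x \<noteq> y" using xy by auto
    then have n0: "norm (x - y) > 0" by simp
    have nu: "norm \<nu> = 1" using n0 by (simp add: \<nu>_def)
    have nue: "\<nu> \<bullet> e > 0" using n0 xy by (simp add: \<nu>_def inner_diff_left)
    have d2: "(x - y) \<bullet> (x - y) = 2 * ((x - y) \<bullet> x)"
    proof -
      have "x \<bullet> x = 1" "y \<bullet> y = 1" using x y by (auto simp: dot_square_norm)
      then show ?thesis by (simp add: inner_diff_left inner_diff_right inner_commute[of y x])
    qed
    have xnu: "x \<bullet> \<nu> = norm (x - y) / 2"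
    proof -
      have "x \<bullet> \<nu> = ((x - y) \<bullet> x) / norm (x - y)" by (simp add: \<nu>_def inner_commute divide_inverse_commute)
      also have "\<dots> = ((x - y) \<bullet> (x - y)) / (2 * norm (x - y))" using d2 by simp
      finally show ?thesis by (simp add: dot_square_norm power2_eq_square)
    qed
    have Rx: "reflection \<nu> x = y"
      using n0 by (simp add: reflection_def xnu) (simp add: \<nu>_def)
    have ee: "x \<bullet> e - reflection \<nu> x \<bullet> e = 2 * (x \<bullet> \<nu>) * (\<nu> \<bullet> e)" for x
      by (simp add: reflection_def inner_diff_left)
    have "pol \<nu> v \<in> \<F>"
      unfolding \<F>_def
    proof (rule CollectI, rule admissible_pol[OF nu p _ H _ adm])
      fix z assume z: "norm z = 1" "z \<bullet> \<nu> > 0"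
      have "2 * (z \<bullet> \<nu>) * (\<nu> \<bullet> e) \<ge> 0" using z(2) nue by simp
      then have "reflection \<nu> z \<bullet> e \<le> z \<bullet> e" using ee[of z] by linarith
      then show "h (reflection \<nu> z) \<le> h z" using z(1) nu by (intro hmono) (auto simp: norm_refl)
    qed auto
    define D where "D z = (v z - v (reflection \<nu> z)) / 2" for z
    have Q: "(pol \<nu> v z - v z) * (z \<bullet> e - reflection \<nu> z \<bullet> e) / 2
       = (\<nu> \<bullet> e) * (\<bar>D z\<bar> * \<bar>z \<bullet> \<nu>\<bar> - D z * (z \<bullet> \<nu>))" for z
    proof -
      have "pol \<nu> v z - v z = sgn (z \<bullet> \<nu>) * \<bar>D z\<bar> - D z"
        by (simp add: pol_def D_def field_simps)
      then have "(pol \<nu> v z - v z) * (z \<bullet> e - reflection \<nu> z \<bullet> e) / 2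
        = (sgn (z \<bullet> \<nu>) * \<bar>D z\<bar> - D z) * (2 * (z \<bullet> \<nu>) * (\<nu> \<bullet> e)) / 2"
        by (simp only: ee)
      also have "\<dots> = (\<nu> \<bullet> e) * (\<bar>D z\<bar> * ((z \<bullet> \<nu>) * sgn (z \<bullet> \<nu>)) - D z * (z \<bullet> \<nu>))"
        by (simp add: field_simps)
      finally show ?thesis by (simp add: abs_sgn)
    qed
    \<comment> \<open>\<open>q\<close> is the nonnegative integrand of the gain of \<open>J\<close>
      under this polarization. Maximality forces the integral to vanish, and continuity makes
      \<open>q\<close> zero at every point of the sphere. At \<open>x\<close> this says that
      \<open>D x\<close> has the sign of \<open>x \<bullet> \<nu>\<close>.\<close>
    define q where "q z = (\<nu> \<bullet> e) * (\<bar>D z\<bar> * \<bar>z \<bullet> \<nu>\<bar> - D z * (z \<bullet> \<nu>))" for z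
    have "continuous_on (sphere 0 1) (\<lambda>z. v (reflection \<nu> z))"
      by (rule continuous_on_compose2[OF vcont]) (auto intro!: continuous_intros simp: norm_refl[OF nu])
    then have qc: "continuous_on (sphere 0 1) q"
      unfolding q_def D_def by (intro continuous_intros vcont) auto
    have [measurable]: "q \<in> borel_measurable borel" unfolding q_def D_def by measurable
    have q0: "q z \<ge> 0" for z
      using nue abs_ge_self[of "D z * (z \<bullet> \<nu>)"] by (simp add: q_def abs_mult)
    have "J (pol \<nu> v) - J v = (\<integral>z. q z \<partial>sphere_measure)"
      unfolding J_def q_def Q[symmetric] by (rule integral_pol_diff[OF nu _ _ vB xe]) auto
    then have "(\<integral>z. q z \<partial>sphere_measure) \<le> 0" using max[OF \<open>pol \<nu> v \<in> \<F>\<close>] by linarith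
    moreover have "(\<integral>z. q z \<partial>sphere_measure) \<ge> 0" using q0 by simp
    ultimately have "(\<integral>z. q z \<partial>sphere_measure) = 0" by linarith
    moreover have "integrable sphere_measure q"
    proof -
      have "bounded (q ` sphere 0 1)" using qc by (intro compact_imp_bounded compact_continuous_image) auto
      then obtain C where "\<forall>y\<in>q ` sphere 0 1. norm y \<le> C" unfolding bounded_iff by blast
      then show ?thesis by (intro integrable_sphere_bounded[of q C]) auto
    qed
    ultimately have "AE z in sphere_measure. q z = 0"
      using q0 integral_nonneg_eq_0_iff_AE[of sphere_measure q] by auto
    from AE_zero_continuous_on_sphere[OF qc this x] have "\<bar>D x\<bar> * \<bar>x \<bullet> \<nu>\<bar> = D x * (x \<bullet> \<nu>)"
      using nue by (simp add: q_def)
    then have "D x \<ge> 0" using xnu n0 by (simp add: abs_mult)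
    then show ?thesis by (simp add: D_def Rx)
  qed
  show ?thesis
    by (rule that[of v L]) (use adm dec in \<open>auto simp: admissible_def E_def m_def I_def\<close>)
qed

section \<open>Hardy inequalities from radial vector fields\<close>

lemma abs_powr_has_real_derivative:
  fixes p r :: real
  assumes p: "p > 1"
  shows "((\<lambda>r. \<bar>r\<bar> powr p) has_real_derivative p * sgn r * \<bar>r\<bar> powr (p - 1)) (at r)"
proof -
  consider "r > 0" | "r < 0" | "r = 0" by linarith
  then show ?thesis
  proof cases
    case 1
    have "((\<lambda>r. r powr p) has_real_derivative p * r powr (p - 1)) (at r)"
      using 1 by (auto intro!: derivative_eq_intros)
    then have "((\<lambda>r. r powr p) has_real_derivative p * sgn r * \<bar>r\<bar> powr (p - 1)) (at r)" using 1 by simp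
    then show ?thesis
      by (rule has_field_derivative_transform_within_open[of _ _ _ "{0<..}"]) (use 1 in auto)
  next
    case 2
    have "((\<lambda>r. (- r) powr p) has_real_derivative p * (- r) powr (p - 1) * (-1)) (at r)"
      using 2 by (auto intro!: derivative_eq_intros)
    then have "((\<lambda>r. (- r) powr p) has_real_derivative p * sgn r * \<bar>r\<bar> powr (p - 1)) (at r)" using 2 by simp
    then show ?thesis
      by (rule has_field_derivative_transform_within_open[of _ _ _ "{..<0}"]) (use 2 in auto)
  next
    case 3
    have "((\<lambda>h::real. \<bar>h\<bar> powr (p - 1)) \<longlongrightarrow> 0) (at 0)"
      using p by (auto intro!: tendsto_eq_intros tendsto_powr')
    then have "((\<lambda>h. \<bar>h\<bar> powr p / h) \<longlongrightarrow> 0) (at 0)"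
    proof (rule Lim_null_comparison[rotated])
      show "\<forall>\<^sub>F h in at 0. norm (\<bar>h\<bar> powr p / h) \<le> \<bar>h\<bar> powr (p - 1)"
        by (intro always_eventually allI) (simp add: powr_diff)
    qed
    then show ?thesis using 3 p by (simp add: has_field_derivative_iff)
  qed
qed

lemma continuous_sgn_abs_powr:
  fixes q :: real
  assumes q: "q > 0"
  shows "continuous_on UNIV (\<lambda>r::real. sgn r * \<bar>r\<bar> powr q)"
proof -
  have "isCont (\<lambda>r::real. sgn r * \<bar>r\<bar> powr q) r" for r
  proof (cases "r = 0")
    case False
    then show ?thesis
      by (intro continuous_intros) auto
  next
    case True
    have "((\<lambda>h::real. \<bar>h\<bar> powr q) \<longlongrightarrow> 0) (at 0)"
      using q by (auto intro!: tendsto_eq_intros tendsto_powr')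
    then have "((\<lambda>h. sgn h * \<bar>h\<bar> powr q) \<longlongrightarrow> 0) (at 0)"
      by (rule Lim_null_comparison[rotated]) (auto simp: abs_mult abs_sgn_eq intro!: always_eventually)
    then show ?thesis by (simp add: True isCont_def)
  qed
  then show ?thesis by (simp add: continuous_at_imp_continuous_on)
qed

lemma inner_radial_field:
  fixes x e :: "'a::euclidean_space"
  assumes "norm x = 1" "norm e = 1"
  shows "G x \<bullet> (e - (x \<bullet> e) *\<^sub>R x) = tgrad G x \<bullet> (e - (x \<bullet> e) *\<^sub>R x)"
    and "norm (e - (x \<bullet> e) *\<^sub>R x) = sqrt (1 - (x \<bullet> e)\<^sup>2)"
proof -
  have 1: "x \<bullet> x = 1" "e \<bullet> e = 1" using assms by (auto simp: dot_square_norm)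
  then show "G x \<bullet> (e - (x \<bullet> e) *\<^sub>R x) = tgrad G x \<bullet> (e - (x \<bullet> e) *\<^sub>R x)"
    by (simp add: tgrad_def inner_diff_left inner_diff_right)
  have "(e - (x \<bullet> e) *\<^sub>R x) \<bullet> (e - (x \<bullet> e) *\<^sub>R x) = 1 - (x \<bullet> e)\<^sup>2"
    using 1 by (simp add: inner_diff_left inner_diff_right inner_commute[of e x] power2_eq_square)
  then show "norm (e - (x \<bullet> e) *\<^sub>R x) = sqrt (1 - (x \<bullet> e)\<^sup>2)" by (simp add: norm_eq_sqrt_inner)
qed

text \<open>The divergence theorem is applied to \<open>|U|^p\<close>. Its gradient term
  \<open>p X b\<close>, with \<open>b = \<psi> S |U|^(p-1)\<close> and \<open>X\<close> the length
  of the tangential gradient, is at most \<open>X^p + (p-1) b^(p/(p-1))\<close> by Young's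
  inequality. The second summand is again a multiple of \<open>|U|^p\<close> and is subtracted in
  \<open>K\<close>.\<close>

lemma hardy_radial_field:
  fixes e :: "'a::euclidean_space"
  assumes e: "norm e = 1" and p: "p > 1" and U: "C1 U G"
    and \<psi>: "\<And>t. (\<psi> has_real_derivative \<psi>' t) (at t)" "continuous_on UNIV \<psi>'" "\<And>t. \<psi> t \<ge> 0"
    and K: "\<And>t. K t = (real DIM('a) - 1) * \<psi> t * t - \<psi>' t * (1 - t\<^sup>2)
      - (p - 1) * (\<psi> t * sqrt (1 - t\<^sup>2)) powr (p / (p - 1))"
  shows "(\<integral>x. \<bar>U x\<bar> powr p * K (x \<bullet> e) \<partial>sphere_measure) \<le> energy p G"
proof -
  let ?n = "real DIM('a) - 1" and ?q = "p / (p - 1)"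
  define f where "f x = \<bar>U x\<bar> powr p" for x
  define F where "F x = (p * sgn (U x) * \<bar>U x\<bar> powr (p - 1)) *\<^sub>R G x" for x
  have f: "C1 f F"
    unfolding f_def F_def
  proof (rule C1_real_compose[OF U abs_powr_has_real_derivative[OF p]])
    show "continuous_on UNIV (\<lambda>r. p * sgn r * \<bar>r\<bar> powr (p - 1))"
      using continuous_on_mult_left[OF continuous_sgn_abs_powr[of "p - 1"], of p] p by (simp add: mult.assoc)
  qed
  define D where "D x = \<psi> (x \<bullet> e) * (F x \<bullet> (e - (x \<bullet> e) *\<^sub>R x)) +
      f x * (\<psi>' (x \<bullet> e) * (1 - (x \<bullet> e)\<^sup>2) - ?n * \<psi> (x \<bullet> e) * (x \<bullet> e))" for x
  have D0: "(\<integral>x. D x \<partial>sphere_measure) = 0"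
    unfolding D_def by (rule sphere_divergence[OF e f \<psi>(1,2)])
  have cpsi: "continuous_on UNIV \<psi>" using \<psi>(1) by (meson DERIV_isCont continuous_at_imp_continuous_on)
  have c1: "continuous_on UNIV (\<lambda>x::'a. \<psi> (x \<bullet> e))" "continuous_on UNIV (\<lambda>x::'a. \<psi>' (x \<bullet> e))"
    by (rule continuous_on_compose2[OF cpsi] continuous_on_compose2[OF \<psi>(2)]; auto intro!: continuous_intros)+
  note cf = C1_continuous[OF f, of UNIV]
  have iD: "integrable sphere_measure D"
    unfolding D_def by (intro integrable_sphere_continuous continuous_intros c1 cf)
  have "(\<lambda>x. \<psi> (x \<bullet> e) * sqrt (1 - (x \<bullet> e)\<^sup>2)) \<in> borel_measurable borel"
    by (intro borel_measurable_continuous_onI continuous_intros c1)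
  then have [measurable]: "(\<lambda>x::'a. \<psi> (x \<bullet> e) * sqrt (1 - (x \<bullet> e)\<^sup>2)) \<in> borel_measurable borel" .
  have [measurable]: "f \<in> borel_measurable borel" "D \<in> borel_measurable borel"
    using cf iD by (auto intro: borel_measurable_continuous_onI dest: borel_measurable_integrable)
  have cZ: "continuous_on UNIV (\<lambda>x. (\<psi> (x \<bullet> e) * sqrt \<bar>1 - (x \<bullet> e)\<^sup>2\<bar>) powr ?q)"
    using p \<psi>(3) by (intro continuous_on_powr' continuous_intros c1) auto
  have cK: "continuous_on UNIV (\<lambda>x::'a. f x * (?n * \<psi> (x \<bullet> e) * (x \<bullet> e) - \<psi>' (x \<bullet> e) * (1 - (x \<bullet> e)\<^sup>2)
      - (p - 1) * (\<psi> (x \<bullet> e) * sqrt \<bar>1 - (x \<bullet> e)\<^sup>2\<bar>) powr ?q))"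
    by (intro continuous_on_mult[OF cf(1)] continuous_on_diff continuous_on_mult continuous_on_const
        cZ c1 continuous_on_inner continuous_on_id continuous_on_power)
  have xe: "(x \<bullet> e)\<^sup>2 \<le> 1" if "norm x = 1" for x
    using Cauchy_Schwarz_ineq2[of x e] that e by (simp add: abs_square_le_1)
  \<comment> \<open>The absolute value under the root makes the integrand continuous on the whole
    space; on the sphere it agrees with \<open>K\<close>.\<close>
  define K' where "K' t = ?n * \<psi> t * t - \<psi>' t * (1 - t\<^sup>2) - (p - 1) * (\<psi> t * sqrt \<bar>1 - t\<^sup>2\<bar>) powr ?q" for t
  have iK: "integrable sphere_measure (\<lambda>x. f x * K' (x \<bullet> e))"
    using integrable_sphere_continuous[OF cK] by (simp add: K'_def)
  have iE: "integrable sphere_measure (\<lambda>x. norm (tgrad G x) powr p)"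
    using C1_continuous[OF U] p by (intro integrable_energy) auto
  have pw: "f x * K' (x \<bullet> e) \<le> norm (tgrad G x) powr p - D x" if x: "norm x = 1" for x
  proof -
    define t where "t = x \<bullet> e"
    define S where "S = sqrt (1 - t\<^sup>2)"
    have S: "S \<ge> 0" "sqrt \<bar>1 - t\<^sup>2\<bar> = S" using xe[OF x] by (auto simp: S_def t_def)
    define b where "b = \<psi> t * S * \<bar>U x\<bar> powr (p - 1)"
    have b0: "b \<ge> 0" using \<psi>(3) S by (simp add: b_def)
    have bq: "b powr ?q = (\<psi> t * S) powr ?q * f x"
      using p \<psi>(3)[of t] S by (simp add: b_def powr_mult powr_powr f_def)
    let ?X = "norm (tgrad G x)"
    have "F x \<bullet> (e - t *\<^sub>R x) = (p * sgn (U x) * \<bar>U x\<bar> powr (p - 1)) * (tgrad G x \<bullet> (e - t *\<^sub>R x))"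
      using inner_radial_field(1)[OF x e, of G] by (simp add: F_def t_def)
    also have "\<dots> \<le> \<bar>(p * sgn (U x) * \<bar>U x\<bar> powr (p - 1)) * (tgrad G x \<bullet> (e - t *\<^sub>R x))\<bar>" by simp
    also have "\<dots> \<le> (p * \<bar>U x\<bar> powr (p - 1)) * (?X * S)"
      unfolding abs_mult
    proof (rule mult_mono)
      show "\<bar>p\<bar> * \<bar>sgn (U x)\<bar> * \<bar>\<bar>U x\<bar> powr (p - 1)\<bar> \<le> p * \<bar>U x\<bar> powr (p - 1)"
        using p by (simp add: abs_sgn_eq)
      show "\<bar>tgrad G x \<bullet> (e - t *\<^sub>R x)\<bar> \<le> ?X * S"
        using Cauchy_Schwarz_ineq2[of "tgrad G x" "e - t *\<^sub>R x"] inner_radial_field(2)[OF x e] by (simp add: t_def S_def)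
    qed (use p in auto)
    finally have "\<psi> t * (F x \<bullet> (e - t *\<^sub>R x)) \<le> \<psi> t * ((p * \<bar>U x\<bar> powr (p - 1)) * (?X * S))"
      using \<psi>(3) by (intro mult_left_mono) auto
    also have "\<dots> = p * (?X * b)" by (simp add: b_def)
    also have "\<dots> \<le> p * (?X powr p / p + b powr ?q / ?q)"
      using p b0 by (intro mult_left_mono Youngs_inequality) (auto simp: field_simps)
    also have "\<dots> = ?X powr p + (p - 1) * (\<psi> t * S) powr ?q * f x"
      using p by (simp add: bq field_simps)
    finally show ?thesis
      by (simp add: D_def K'_def t_def[symmetric] S algebra_simps)
  qed
  have "(\<integral>x. \<bar>U x\<bar> powr p * K (x \<bullet> e) \<partial>sphere_measure) = (\<integral>x. f x * K' (x \<bullet> e) \<partial>sphere_measure)"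
  proof (rule integral_cong_AE)
    have eqx: "f x * K' (x \<bullet> e) = \<bar>U x\<bar> powr p * K (x \<bullet> e)" if "norm x = 1" for x
      using xe[OF that] by (simp add: f_def K K'_def)
    show "AE x in sphere_measure. \<bar>U x\<bar> powr p * K (x \<bullet> e) = f x * K' (x \<bullet> e)"
      using AE_sphere_measure by eventually_elim (simp add: eqx)
    show "(\<lambda>x. f x * K' (x \<bullet> e)) \<in> borel_measurable sphere_measure" using iK by (rule borel_measurable_integrable)
    have [measurable]: "(\<lambda>x::'a. \<psi> (x \<bullet> e)) \<in> borel_measurable borel" "(\<lambda>x::'a. \<psi>' (x \<bullet> e)) \<in> borel_measurable borel"
      using c1 by (auto intro: borel_measurable_continuous_onI)
    have [measurable]: "U \<in> borel_measurable borel" using C1_measurable[OF U] by simp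
    show "(\<lambda>x. \<bar>U x\<bar> powr p * K (x \<bullet> e)) \<in> borel_measurable sphere_measure"
      unfolding K by measurable
  qed
  also have "\<dots> \<le> (\<integral>x. norm (tgrad G x) powr p - D x \<partial>sphere_measure)"
  proof (rule integral_mono_AE[OF iK])
    show "integrable sphere_measure (\<lambda>x. norm (tgrad G x) powr p - D x)" using iE iD by simp
    show "AE x in sphere_measure. f x * K' (x \<bullet> e) \<le> norm (tgrad G x) powr p - D x"
      using AE_sphere_measure by eventually_elim (rule pw)
  qed
  also have "\<dots> = energy p G" using iE iD D0 by (simp add: energy_def)
  finally show ?thesis .
qed

text \<open>The left-hand side depends on values only and converges along uniform approximants by
  boundedness of \<open>k\<close>, whereas the right-hand side is the common bound \<open>E\<close>.
  The sign of \<open>k\<close> is arbitrary, so the kernel of a cut-off field is allowed.\<close>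

lemma approximable_hardy:
  fixes v :: "'a::euclidean_space \<Rightarrow> real" and k :: "'a \<Rightarrow> real"
  assumes appr: "approximable p L E v" and p: "p \<ge> 1" and v0: "\<And>x. 0 \<le> v x"
    and [measurable]: "v \<in> borel_measurable borel" "k \<in> borel_measurable borel"
    and kB: "\<And>x. norm x = 1 \<Longrightarrow> \<bar>k x\<bar> \<le> H"
    and hardy: "\<And>U G. C1 U G \<Longrightarrow> (\<integral>x. \<bar>U x\<bar> powr p * k x \<partial>sphere_measure) \<le> energy p G"
  shows "(\<integral>x. v x powr p * k x \<partial>sphere_measure) \<le> E"
proof -
  have "\<exists>U G. C1 U G \<and> energy p G \<le> E \<and> (\<forall>x. norm x = 1 \<longrightarrow> \<bar>U x - v x\<bar> \<le> 1 / real (Suc j))" for j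
    using appr[unfolded approximable_def, rule_format, of "1 / real (Suc j)"] by force
  then obtain U G where U: "\<And>j. C1 (U j) (G j)" "\<And>j. energy p (G j) \<le> E"
    "\<And>j x. norm x = 1 \<Longrightarrow> \<bar>U j x - v x\<bar> \<le> 1 / real (Suc j)"
    by metis
  have "bounded (v ` sphere 0 1)"
    using approximable_continuous[OF appr] by (intro compact_imp_bounded compact_continuous_image) auto
  then obtain B where "\<forall>y\<in>v ` sphere 0 1. norm y \<le> B" unfolding bounded_iff by blast
  then have B: "\<bar>v x\<bar> \<le> B" if "norm x = 1" for x using that by auto
  have UB: "\<bar>U j x\<bar> \<le> B + 1" if "norm x = 1" for j x
  proof -
    have "1 / real (Suc j) \<le> 1" by simp
    then show ?thesis using U(3)[OF that, of j] B[OF that] by linarith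
  qed
  have ptw: "(\<lambda>j. U j x) \<longlonglongrightarrow> v x" if "norm x = 1" for x
  proof -
    have "(\<lambda>j. U j x - v x) \<longlonglongrightarrow> 0"
    proof (rule Lim_null_comparison)
      show "\<forall>\<^sub>F j in sequentially. norm (U j x - v x) \<le> inverse (real (Suc j))"
        using U(3)[OF that] by (auto simp: inverse_eq_divide)
    qed (rule LIMSEQ_inverse_real_of_nat)
    then show ?thesis by (simp add: LIM_zero_iff)
  qed
  have "(\<lambda>j. \<integral>x. \<bar>U j x\<bar> powr p * k x \<partial>sphere_measure) \<longlonglongrightarrow> (\<integral>x. \<bar>v x\<bar> powr p * k x \<partial>sphere_measure)"
  proof (rule tendsto_integral_uniform_sphere[OF _ _ _ kB])
    show "(\<lambda>x. \<bar>U j x\<bar> powr p) \<in> borel_measurable borel" for j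
      using C1_measurable(1)[OF U(1)[of j]] by measurable
    show "\<bar>\<bar>U j x\<bar> powr p\<bar> \<le> (B + 1) powr p" if "norm x = 1" for j x
      using UB[OF that, of j] p by (auto intro!: powr_mono2)
    show "(\<lambda>j. \<bar>U j x\<bar> powr p) \<longlonglongrightarrow> \<bar>v x\<bar> powr p" if "norm x = 1" for x
      using p by (intro tendsto_powr' tendsto_rabs ptw[OF that] tendsto_const) auto
  qed auto
  then have "(\<integral>x. \<bar>v x\<bar> powr p * k x \<partial>sphere_measure) \<le> E"
    using hardy[OF U(1)] U(2) by (intro LIMSEQ_le_const2) (auto intro: order_trans)
  then show ?thesis using v0 by simp
qed

text \<open>Between 0 and 1 this is \<open>1 - (1 - r^2)^2\<close>. Squares of positive parts are
  continuously differentiable, so truncating twice produces a \<open>C1\<close> step from 0 to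
  1.\<close>

definition smoothstep :: "real \<Rightarrow> real" where
  "smoothstep r = 1 - (max 0 (1 - (max 0 r)\<^sup>2))\<^sup>2"

definition smoothstep' :: "real \<Rightarrow> real" where
  "smoothstep' r = 4 * max 0 (1 - (max 0 r)\<^sup>2) * max 0 r"

lemma max0_power2_has_real_derivative: "((\<lambda>r::real. (max 0 r)\<^sup>2) has_real_derivative 2 * max 0 r) (at r)"
proof -
  have "((\<lambda>r::real. (max 0 r)\<^sup>2) has_real_derivative 2 * max 0 r) (at r)" if "r > 0"
  proof (rule has_field_derivative_transform_within_open[of "\<lambda>r. r\<^sup>2" _ _ "{0<..}"])
    show "((\<lambda>r. r\<^sup>2) has_real_derivative 2 * max 0 r) (at r)"
      using that by (auto intro!: derivative_eq_intros)
  qed (use that in auto)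
  moreover have "((\<lambda>r::real. (max 0 r)\<^sup>2) has_real_derivative 2 * max 0 r) (at r)" if "r < 0"
  proof (rule has_field_derivative_transform_within_open[of "\<lambda>r. 0" _ _ "{..<0}"])
    show "((\<lambda>r. 0) has_real_derivative 2 * max 0 r) (at r)"
      using that by (auto intro!: derivative_eq_intros)
  qed (use that in auto)
  moreover have "((\<lambda>r::real. (max 0 r)\<^sup>2) has_real_derivative 2 * max 0 r) (at r)" if "r = 0"
  proof -
    have "((\<lambda>h::real. (max 0 h)\<^sup>2 / h) \<longlongrightarrow> 0) (at 0)"
    proof (rule Lim_null_comparison)
      show "\<forall>\<^sub>F h::real in at 0. norm ((max 0 h)\<^sup>2 / h) \<le> \<bar>h\<bar>"
        by (intro always_eventually allI) (auto simp: max_def power2_eq_square)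
    qed (auto intro!: tendsto_eq_intros)
    then show ?thesis using that by (simp add: has_field_derivative_iff)
  qed
  ultimately show ?thesis by linarith
qed

lemma smoothstep_has_real_derivative: "(smoothstep has_real_derivative smoothstep' r) (at r)"
  unfolding smoothstep_def[abs_def] smoothstep'_def
  by (rule derivative_eq_intros DERIV_chain2[OF max0_power2_has_real_derivative] max0_power2_has_real_derivative refl)+ simp

lemma continuous_smoothstep': "continuous_on UNIV smoothstep'"
  unfolding smoothstep'_def[abs_def] by (intro continuous_intros)

lemma smoothstep_bounds: "0 \<le> smoothstep r" "smoothstep r \<le> 1" "smoothstep' r \<ge> 0"
  by (auto simp: smoothstep_def smoothstep'_def power_le_one_iff abs_square_le_1 intro!: power_le_one)

lemma smoothstep_eq:
  "r \<le> 0 \<Longrightarrow> smoothstep r = 0" "r \<le> 0 \<Longrightarrow> smoothstep' r = 0"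
  "r \<ge> 1 \<Longrightarrow> smoothstep r = 1" "r \<ge> 1 \<Longrightarrow> smoothstep' r = 0"
  by (auto simp: smoothstep_def smoothstep'_def max_def intro!: antisym one_le_power)

section \<open>The one-dimensional weight\<close>

locale hardy_weight =
  fixes n p a :: real
  assumes p1: "1 < p" and pn: "p < n" and a0: "0 < a" and api: "a < pi"
begin

abbreviation "\<eta> \<equiv> eta n p a"

definition "\<beta> = (n - 1) / (p - 1)"

definition w :: "real \<Rightarrow> real" where "w s = sin s powr (- \<beta>)"

text \<open>The radial p-harmonic function, zero at distance \<open>a\<close> and singular at the
  pole: \<open>w\<close> is chosen so that \<open>w^(p-1) sin^(n-1)\<close>, the flux through the
  spheres around the pole, is constant. By \<open>eta_eq\<close>, \<open>\<eta>\<close> is minus its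
  logarithmic derivative.\<close>

definition \<Phi> :: "real \<Rightarrow> real" where "\<Phi> t = integral {t..a} w"

lemma beta: "\<beta> > 1" "(p - 1) * \<beta> = n - 1" "(p - 1) * (\<beta> - 1) = n - p"
  using p1 pn by (auto simp: \<beta>_def field_simps)

lemma eta_eq: "\<eta> t = w t / \<Phi> t"
proof -
  have "- (n - 1) / (p - 1) = - \<beta>" by (simp only: \<beta>_def minus_divide_left)
  then show ?thesis by (simp add: eta_def w_def[abs_def] \<Phi>_def)
qed

lemma sin_pos: "0 < t \<Longrightarrow> t \<le> a \<Longrightarrow> 0 < sin t"
  using api by (intro sin_gt_zero) auto

lemma w_pos: "0 < t \<Longrightarrow> t \<le> a \<Longrightarrow> 0 < w t"
  using sin_pos[of t] by (simp add: w_def)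

lemma w_continuous:
  assumes "0 < l"
  shows "continuous_on {l..a} w"
  unfolding w_def using assms by (intro continuous_intros) (fastforce dest: sin_pos[rotated])

lemma \<Phi>_pos:
  assumes "0 < t" "t < a"
  shows "0 < \<Phi> t"
proof -
  have "0 \<le> \<Phi> t"
    unfolding \<Phi>_def using assms by (intro integral_nonneg integrable_continuous_real w_continuous) (auto simp: w_def)
  moreover have "\<Phi> t \<noteq> 0"
  proof
    assume "\<Phi> t = 0"
    moreover have "(w has_integral \<Phi> t) (cbox t a)"
      unfolding \<Phi>_def box_real
      using assms by (intro integrable_integral integrable_continuous_real w_continuous)
    ultimately have "w a = 0"
      using assms has_integral_0_cbox_imp_0[of t a w a] w_continuous[OF assms(1)] by (auto simp: w_def)
    then show False using w_pos[of a] a0 by simp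
  qed
  ultimately show ?thesis by linarith
qed

lemma \<Phi>_continuous:
  assumes "0 < l"
  shows "continuous_on {l..a} \<Phi>"
proof -
  have "continuous_on {l..a} (\<lambda>x. integral {x..a} w)"
    using assms by (intro indefinite_integral_continuous_1' integrable_continuous_real w_continuous)
  then show ?thesis by (simp add: \<Phi>_def[abs_def])
qed

lemma \<Phi>_has_derivative:
  assumes "0 < t" "t < a"
  shows "(\<Phi> has_real_derivative - w t) (at t)"
proof -
  have "((\<lambda>u. integral {u..a} w) has_real_derivative - w t) (at t within {t / 2..a})"
    using assms by (intro integral_has_real_derivative' w_continuous) auto
  then show ?thesis
    using assms by (simp add: at_within_Icc_at \<Phi>_def[abs_def])
qed

lemma w_has_derivative:
  assumes "0 < t" "t < a"
  shows "(w has_real_derivative - \<beta> * w t * cos t / sin t) (at t)"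
proof -
  have s: "sin t > 0" using assms by (intro sin_pos) auto
  have "((\<lambda>t. sin t powr (- \<beta>)) has_real_derivative (- \<beta>) * sin t powr (- \<beta> - 1) * cos t) (at t)"
    using s by (auto intro!: derivative_eq_intros)
  then show ?thesis using s by (simp add: w_def[abs_def] powr_diff)
qed

lemma eta_pos: "0 < t \<Longrightarrow> t < a \<Longrightarrow> 0 < \<eta> t"
  using w_pos \<Phi>_pos by (simp add: eta_eq)

text \<open>A Riccati equation. The monotonicity of \<open>\<eta>\<close> is thereby a comparison of
  \<open>\<eta>\<close> with \<open>\<beta>\<close> times the cotangent.\<close>

lemma eta_has_derivative:
  assumes "0 < t" "t < a"
  shows "(\<eta> has_real_derivative \<eta> t * (\<eta> t - \<beta> * cos t / sin t)) (at t)"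
proof -
  have \<Phi>: "\<Phi> t > 0" by (rule \<Phi>_pos[OF assms])
  have s: "sin t > 0" using assms by (intro sin_pos) auto
  have "((\<lambda>t. w t / \<Phi> t) has_real_derivative ((- \<beta> * w t * cos t / sin t) * \<Phi> t - w t * (- w t)) / (\<Phi> t * \<Phi> t)) (at t)"
    using \<Phi> by (intro DERIV_divide w_has_derivative \<Phi>_has_derivative assms) auto
  moreover have "((- \<beta> * w t * cos t / sin t) * \<Phi> t - w t * (- w t)) / (\<Phi> t * \<Phi> t) = \<eta> t * (\<eta> t - \<beta> * cos t / sin t)"
    using \<Phi> s unfolding eta_eq by (simp add: field_simps)
  ultimately show ?thesis by (simp add: eta_eq[abs_def])
qed

lemma eta_continuous: "continuous_on {0<..<a} \<eta>"
  by (rule continuous_at_imp_continuous_on) (auto intro!: DERIV_isCont eta_has_derivative)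

text \<open>\<open>E\<close> is the difference \<open>\<eta> - \<beta> cot\<close> with the positive
  denominators cleared. Once nonnegative, it is positive ever after: trivially beyond
  \<open>pi / 2\<close>, and before because \<open>E / cos\<close> is increasing. It is negative
  somewhere, since otherwise \<open>\<eta>\<close> would be nondecreasing, hence bounded near 0,
  although it dominates the cotangent. At \<open>a\<close> it is positive because
  \<open>\<Phi>\<close> vanishes there.\<close>

lemma eta_sign_change:
  obtains T where "0 < T" "T < a"
    "\<And>t. 0 < t \<Longrightarrow> t < T \<Longrightarrow> \<eta> t < \<beta> * cos t / sin t"
    "\<And>t. T < t \<Longrightarrow> t < a \<Longrightarrow> \<eta> t > \<beta> * cos t / sin t"
proof -
  define E where "E t = w t * sin t - \<beta> * cos t * \<Phi> t" for t
  have Eneg: "\<eta> t < \<beta> * cos t / sin t \<longleftrightarrow> E t < 0" and Epos: "\<eta> t > \<beta> * cos t / sin t \<longleftrightarrow> E t > 0"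
    if "0 < t" "t < a" for t
    using sin_pos[of t] \<Phi>_pos[of t] that by (auto simp: eta_eq E_def field_simps)
  have b: "\<beta> > 1" by (rule beta)
  have Ebig: "E t > 0" if "t \<ge> pi / 2" "t < a" for t
  proof -
    have "0 < t" using that(1) pi_gt_zero by linarith
    have "cos t \<le> 0" using cos_monotone_0_pi_le[of "pi / 2" t] that api by simp
    then have "\<beta> * cos t * \<Phi> t \<le> 0" using b \<Phi>_pos[of t] that \<open>0 < t\<close> by (simp add: mult_nonneg_nonpos mult_nonpos_nonneg)
    moreover have "w t * sin t > 0" using w_pos[of t] sin_pos[of t] that \<open>0 < t\<close> by simp
    ultimately show ?thesis by (simp add: E_def)
  qed
  have mono: "E t2 > 0" if t: "0 < t1" "t1 < t2" "t2 < a" "E t1 \<ge> 0" for t1 t2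
  proof (cases "t2 \<ge> pi / 2")
    case True
    then show ?thesis using Ebig t by auto
  next
    case False
    \<comment> \<open>Dividing \<open>E\<close> by the cosine makes the terms with
      \<open>\<beta>\<close> cancel in the derivative, leaving \<open>w / cos^2\<close>.\<close>
    define D where "D t = w t * tan t - \<beta> * \<Phi> t" for t
    have c: "cos t > 0" if "0 < t" "t \<le> t2" for t using that False by (intro cos_gt_zero) auto
    have DE: "E t = D t * cos t" if "0 < t" "t \<le> t2" for t
      using c[OF that] by (simp add: D_def E_def tan_def field_simps)
    have der: "(D has_real_derivative w t / (cos t)\<^sup>2) (at t)" if "0 < t" "t \<le> t2" for t
    proof -
      have s: "sin t > 0" and c': "cos t > 0" using that t c by (auto intro: sin_pos)
      have "(D has_real_derivative (- \<beta> * w t * cos t / sin t) * tan t + inverse ((cos t)\<^sup>2) * w t - \<beta> * (- w t)) (at t)"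
        unfolding D_def[abs_def] using that t c'
        by (intro DERIV_diff DERIV_mult DERIV_cmult w_has_derivative \<Phi>_has_derivative DERIV_tan) auto
      moreover have *: "(- \<beta> * w t * cos t / sin t) * tan t = - \<beta> * w t" using s c' by (simp add: tan_def)
      have "(- \<beta> * w t * cos t / sin t) * tan t + inverse ((cos t)\<^sup>2) * w t - \<beta> * (- w t) = w t / (cos t)\<^sup>2"
        unfolding * by (simp add: divide_inverse)
      ultimately show ?thesis by (simp only:)
    qed
    have "D t1 < D t2"
    proof (rule DERIV_pos_imp_increasing[OF t(2)])
      fix x assume "t1 \<le> x" "x \<le> t2"
      then show "\<exists>y. DERIV D x :> y \<and> y > 0"
        using der[of x] c[of x] w_pos[of x] t by (intro exI[of _ "w x / (cos x)\<^sup>2"]) auto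
    qed
    moreover have "D t1 \<ge> 0" using DE[of t1] c[of t1] t by (simp add: zero_le_mult_iff)
    ultimately show ?thesis using DE[of t2] c[of t2] t by simp
  qed
  obtain t0 where t0: "0 < t0" "t0 < a" "E t0 < 0"
  proof (rule ccontr)
    assume neg: "\<not> thesis"
    then have ge: "E t \<ge> 0" if "0 < t" "t < a" for t using that that not_le \<open>\<And>t0. 0 < t0 \<Longrightarrow> t0 < a \<Longrightarrow> E t0 < 0 \<Longrightarrow> thesis\<close> by blast
    define b where "b = min (a / 2) (pi / 3)"
    have b': "0 < b" "b < a" "b \<le> pi / 3" using a0 by (auto simp: b_def)
    \<comment> \<open>Chosen so that \<open>\<eta> b\<close> is at most
      \<open>\<beta> / (4 * t)\<close>. Since \<open>b \<le> pi / 3\<close> gives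
      \<open>cos t \<ge> 1/2\<close>, the assumption would force at least
      \<open>\<beta> / (2 * t)\<close>.\<close>
    define t where "t = min b (\<beta> / (4 * \<eta> b))"
    have eb: "\<eta> b > 0" using b' by (intro eta_pos) auto
    have t: "0 < t" "t \<le> b" "t \<le> \<beta> / (4 * \<eta> b)" using b' eb b by (auto simp: t_def)
    have "\<eta> t \<le> \<eta> b"
    proof (rule DERIV_nonneg_imp_nondecreasing[OF t(2)])
      fix x assume x: "t \<le> x" "x \<le> b"
      then have x': "0 < x" "x < a" using t b' by auto
      have "\<eta> x - \<beta> * cos x / sin x \<ge> 0" using Eneg[OF x'] ge[OF x'] by linarith
      then have "\<eta> x * (\<eta> x - \<beta> * cos x / sin x) \<ge> 0" using eta_pos[OF x'] by simp
      then show "\<exists>y. DERIV \<eta> x :> y \<and> y \<ge> 0" using eta_has_derivative[OF x'] by blast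
    qed
    moreover have "\<eta> t \<ge> \<beta> * cos t / sin t" using Eneg[of t] ge[of t] t b' by force
    moreover have "\<beta> * cos t / sin t \<ge> \<beta> * (1/2) / t"
    proof (rule frac_le)
      have "cos (pi / 3) \<le> cos t" using t b' by (intro cos_monotone_0_pi_le) auto
      then show "\<beta> * (1/2) \<le> \<beta> * cos t" using b by (simp add: cos_60)
      show "sin t \<le> t" using t by (intro sin_x_le_x) auto
      show "0 < sin t" using t b' by (intro sin_pos) auto
      show "0 \<le> \<beta> * cos t" using b t b' by (intro mult_nonneg_nonneg cos_ge_zero) auto
    qed
    ultimately have "\<beta> * (1/2) / t \<le> \<eta> b" by linarith
    then have "\<beta> \<le> 2 * (t * \<eta> b)" using t by (simp add: field_simps)
    moreover have "4 * (t * \<eta> b) \<le> \<beta>" using t(3) eb by (simp add: field_simps)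
    ultimately show False using b by linarith
  qed
  have Ea: "E a > 0" using w_pos[of a] sin_pos[of a] a0 by (simp add: E_def \<Phi>_def)
  have "continuous_on {t0..a} E"
    unfolding E_def using t0 by (intro continuous_intros w_continuous \<Phi>_continuous)
  then obtain T where T: "t0 \<le> T" "T \<le> a" "E T = 0"
    using IVT'[of E t0 0 a] t0 Ea by auto
  have T': "0 < T" "T < a" using T t0 Ea by (auto simp: less_le)
  show ?thesis
  proof (rule that[OF T'])
    fix t assume t: "0 < t" "t < T"
    have "E t < 0" using mono[OF t T'(2)] T(3) by force
    then show "\<eta> t < \<beta> * cos t / sin t" using Eneg t T' by auto
  next
    fix t assume t: "T < t" "t < a"
    then show "\<eta> t > \<beta> * cos t / sin t" using mono[OF T'(1) t] T(3) Epos T' by auto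
  qed
qed

lemma eta_minimum:
  obtains T where "0 < T" "T < a"
    "\<And>s t. 0 < s \<Longrightarrow> s < t \<Longrightarrow> t \<le> T \<Longrightarrow> \<eta> t < \<eta> s"
    "\<And>s t. T \<le> s \<Longrightarrow> s < t \<Longrightarrow> t < a \<Longrightarrow> \<eta> s < \<eta> t"
proof -
  obtain T where T: "0 < T" "T < a"
    "\<And>t. 0 < t \<Longrightarrow> t < T \<Longrightarrow> \<eta> t < \<beta> * cos t / sin t"
    "\<And>t. T < t \<Longrightarrow> t < a \<Longrightarrow> \<eta> t > \<beta> * cos t / sin t"
    by (rule eta_sign_change) blast
  show ?thesis
  proof (rule that[OF T(1,2)])
    fix s t assume st: "0 < s" "s < t" "t \<le> T"
    show "\<eta> t < \<eta> s"
    proof (rule DERIV_neg_imp_decreasing_open[OF st(2)])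
      fix x assume x: "s < x" "x < t"
      have "\<eta> x * (\<eta> x - \<beta> * cos x / sin x) < 0"
        using eta_pos[of x] T(3)[of x] x st T by (intro mult_pos_neg) auto
      then show "\<exists>y. DERIV \<eta> x :> y \<and> y < 0" using eta_has_derivative[of x] x st T by (meson less_le_trans less_trans)
    qed (use st T eta_continuous in \<open>auto intro: continuous_on_subset\<close>)
  next
    fix s t assume st: "T \<le> s" "s < t" "t < a"
    show "\<eta> s < \<eta> t"
    proof (rule DERIV_pos_imp_increasing_open[OF st(2)])
      fix x assume x: "s < x" "x < t"
      have "\<eta> x * (\<eta> x - \<beta> * cos x / sin x) > 0"
        using eta_pos[of x] T(4)[of x] x st T by (intro mult_pos_pos) auto
      then show "\<exists>y. DERIV \<eta> x :> y \<and> y > 0" using eta_has_derivative[of x] x st T by (meson less_le_trans less_trans le_less_trans)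
    qed (use st T eta_continuous in \<open>auto intro: continuous_on_subset\<close>)
  qed
qed

section \<open>The turning point and the behaviour of the weight at the pole\<close>

abbreviation "\<tau> \<equiv> eta_T n p a"

text \<open>Two different candidates would make \<open>\<eta>\<close> both increase and decrease
  between them, so the definite description is justified. In contrast to the definition,
  monotonicity here includes the turning point itself, which the comparisons with
  \<open>\<eta> \<tau>\<close> need.\<close>

lemma eta_T:
  shows "0 < \<tau>" "\<tau> < a"
    "\<And>s t. 0 < s \<Longrightarrow> s < t \<Longrightarrow> t \<le> \<tau> \<Longrightarrow> \<eta> t < \<eta> s"
    "\<And>s t. \<tau> \<le> s \<Longrightarrow> s < t \<Longrightarrow> t < a \<Longrightarrow> \<eta> s < \<eta> t"
proof -
  obtain T where T: "0 < T" "T < a"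
    "\<And>s t. 0 < s \<Longrightarrow> s < t \<Longrightarrow> t \<le> T \<Longrightarrow> \<eta> t < \<eta> s"
    "\<And>s t. T \<le> s \<Longrightarrow> s < t \<Longrightarrow> t < a \<Longrightarrow> \<eta> s < \<eta> t"
    by (rule eta_minimum) blast
  let ?P = "\<lambda>T. 0 < T \<and> T < a \<and> strict_antimono_on {0<..<T} \<eta> \<and> strict_mono_on {T<..<a} \<eta>"
  have ge: "\<not> T1 < T2" if "?P T1" "?P T2" for T1 T2
  proof
    assume "T1 < T2"
    then obtain x where x: "T1 < x" "x < T2" using dense by blast
    then obtain y where y: "x < y" "y < T2" using dense by blast
    have "\<eta> x < \<eta> y" using that x y by (auto simp: monotone_on_def)
    moreover have "\<eta> y < \<eta> x" using that x y by (auto simp: monotone_on_def)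
    ultimately show False by simp
  qed
  have PT: "?P T" using T by (auto simp: monotone_on_def)
  have "\<tau> = T"
    unfolding eta_T_def
  proof (rule the_equality)
    show "?P T" by (rule PT)
    fix T' assume "?P T'"
    then show "T' = T" using ge[OF PT] ge[OF _ PT] by (meson linorder_neqE_linordered_idom)
  qed
  then show "0 < \<tau>" "\<tau> < a"
    "\<And>s t. 0 < s \<Longrightarrow> s < t \<Longrightarrow> t \<le> \<tau> \<Longrightarrow> \<eta> t < \<eta> s"
    "\<And>s t. \<tau> \<le> s \<Longrightarrow> s < t \<Longrightarrow> t < a \<Longrightarrow> \<eta> s < \<eta> t"
    using T by auto
qed

text \<open>Near 0 the integral \<open>\<Phi>\<close> behaves like
  \<open>sin^(1-\<beta>) / (\<beta> - 1)\<close>, so \<open>\<eta>\<close> behaves like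
  \<open>(\<beta> - 1) / sin\<close>. For the upper bound on \<open>\<Phi>\<close> it is compared
  with this primitive divided by \<open>C = cos \<theta>\<close>, where \<open>\<theta>\<close> is
  so small that \<open>C > c\<close>; the additive constant \<open>\<Phi> \<theta>\<close> is
  negligible in the limit.\<close>

lemma eta_asymptotic:
  assumes "c < 1"
  shows "\<exists>\<delta>>0. \<delta> \<le> \<tau> \<and> (\<forall>t. 0 < t \<and> t < \<delta> \<longrightarrow> c * (\<beta> - 1) / sin t \<le> \<eta> t)"
proof -
  have b: "\<beta> > 1" by (rule beta)
  have "((\<lambda>t. cos t) \<longlongrightarrow> cos 0) (at_right (0::real))" by (intro tendsto_intros)
  then have "\<forall>\<^sub>F t in at_right (0::real). cos t > c" using assms by (intro order_tendstoD) auto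
  moreover have "\<forall>\<^sub>F t in at_right (0::real). 0 < t \<and> t < \<tau> \<and> t < pi / 2"
    using eta_T(1) by (auto simp: eventually_at_right[of 0 1] intro!: exI[of _ "min \<tau> (pi/2)"])
  ultimately have "\<forall>\<^sub>F t in at_right (0::real). cos t > c \<and> 0 < t \<and> t < \<tau> \<and> t < pi / 2" by eventually_elim auto
  then obtain \<theta> where \<theta>: "cos \<theta> > c" "0 < \<theta>" "\<theta> < \<tau>" "\<theta> < pi / 2"
    using eventually_happens'[OF trivial_limit_at_right_real] by blast
  have ta: "\<theta> < a" using \<theta> eta_T(2) by simp
  define C where "C = cos \<theta>"
  have C: "C > c" "C > 0" using \<theta> by (auto simp: C_def intro!: cos_gt_zero)
  have bound: "\<Phi> t \<le> sin t powr (1 - \<beta>) / ((\<beta> - 1) * C) + \<Phi> \<theta>" if t: "0 < t" "t \<le> \<theta>" for t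
  proof -
    let ?\<Psi> = "\<lambda>t. sin t powr (1 - \<beta>) / ((\<beta> - 1) * C) - \<Phi> t"
    have "?\<Psi> \<theta> \<le> ?\<Psi> t"
    proof (rule DERIV_nonpos_imp_nonincreasing[OF t(2)])
      fix x assume x: "t \<le> x" "x \<le> \<theta>"
      then have x': "0 < x" "x < a" "sin x > 0" using t ta by (auto intro: sin_pos)
      have "((\<lambda>t. sin t powr (1 - \<beta>)) has_real_derivative (1 - \<beta>) * sin x powr (1 - \<beta> - 1) * cos x) (at x)"
        using x' by (auto intro!: derivative_eq_intros)
      then have "((\<lambda>t. sin t powr (1 - \<beta>)) has_real_derivative (1 - \<beta>) * w x * cos x) (at x)"
        by (simp add: w_def)
      from DERIV_diff[OF DERIV_cdivide[OF this] \<Phi>_has_derivative[OF x'(1,2)]]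
      have "(?\<Psi> has_real_derivative (1 - \<beta>) * w x * cos x / ((\<beta> - 1) * C) - - w x) (at x)" .
      moreover have "(1 - \<beta>) * w x * cos x / ((\<beta> - 1) * C) - - w x = w x * (1 - cos x / C)"
        using b C by (simp add: field_simps)
      moreover have "w x * (1 - cos x / C) \<le> 0"
      proof -
        have "C \<le> cos x" unfolding C_def using x t \<theta> by (intro cos_monotone_0_pi_le) auto
        then show ?thesis using C w_pos[of x] x' by (simp add: mult_nonneg_nonpos)
      qed
      ultimately show "\<exists>y. DERIV ?\<Psi> x :> y \<and> y \<le> 0" by metis
    qed
    moreover have "0 \<le> sin \<theta> powr (1 - \<beta>) / ((\<beta> - 1) * C)" using b C by simp
    ultimately show ?thesis by linarith
  qed
  have "((\<lambda>t. 1 / ((\<beta> - 1) * C) + \<Phi> \<theta> * sin t powr (\<beta> - 1)) \<longlongrightarrow> 1 / ((\<beta> - 1) * C) + \<Phi> \<theta> * 0) (at_right 0)"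
  proof (intro tendsto_intros)
    have "((\<lambda>t. sin t powr (\<beta> - 1)) \<longlongrightarrow> sin 0 powr (\<beta> - 1)) (at_right 0)"
      by (intro tendsto_powr' tendsto_intros)
        (use b a0 api in \<open>auto simp: eventually_at_right[of 0 1] intro!: exI[of _ a] less_imp_le[OF sin_pos]\<close>)
    then show "((\<lambda>t. sin t powr (\<beta> - 1)) \<longlongrightarrow> 0) (at_right 0)" by simp
  qed
  then have "((\<lambda>t. c * (\<beta> - 1) * (1 / ((\<beta> - 1) * C) + \<Phi> \<theta> * sin t powr (\<beta> - 1))) \<longlongrightarrow> c * (\<beta> - 1) * (1 / ((\<beta> - 1) * C) + \<Phi> \<theta> * 0)) (at_right 0)"
    by (rule tendsto_mult_left)
  moreover have lt1: "c * (\<beta> - 1) * (1 / ((\<beta> - 1) * C) + \<Phi> \<theta> * 0) < 1"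
  proof -
    have "c * (\<beta> - 1) * (1 / ((\<beta> - 1) * C)) = c / C" using b by simp
    then show ?thesis using C by simp
  qed
  ultimately have "\<forall>\<^sub>F t in at_right 0. c * (\<beta> - 1) * (1 / ((\<beta> - 1) * C) + \<Phi> \<theta> * sin t powr (\<beta> - 1)) < 1"
    by (rule order_tendstoD)
  then obtain d where d: "d > 0" "\<And>t. 0 < t \<Longrightarrow> t < d \<Longrightarrow> c * (\<beta> - 1) * (1 / ((\<beta> - 1) * C) + \<Phi> \<theta> * sin t powr (\<beta> - 1)) < 1"
    by (auto simp: eventually_at_right[of 0 1])
  show ?thesis
  proof (intro exI[of _ "min d \<theta>"] conjI allI impI)
    show "0 < min d \<theta>" "min d \<theta> \<le> \<tau>" using d \<theta> by auto
    fix t assume "0 < t \<and> t < min d \<theta>"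
    then have t: "0 < t" "t < d" "t < \<theta>" by auto
    have s: "sin t > 0" using t ta by (intro sin_pos) auto
    have ph: "\<Phi> t > 0" using t ta by (intro \<Phi>_pos) auto
    show "c * (\<beta> - 1) / sin t \<le> \<eta> t"
    proof (cases "c \<le> 0")
      case True
      then have "c * (\<beta> - 1) / sin t \<le> 0" using b s by (simp add: divide_nonpos_pos mult_nonpos_nonneg)
      also have "\<dots> \<le> \<eta> t" using eta_pos[of t] t ta by simp
      finally show ?thesis .
    next
      case False
      have sp: "sin t powr (1 - \<beta>) * sin t powr (\<beta> - 1) = 1" using s by (simp flip: powr_add)
      have "c * (\<beta> - 1) * \<Phi> t \<le> c * (\<beta> - 1) * (sin t powr (1 - \<beta>) / ((\<beta> - 1) * C) + \<Phi> \<theta>)"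
        using bound[of t] t False b by (intro mult_left_mono) auto
      also have "\<dots> = sin t powr (1 - \<beta>) * (c * (\<beta> - 1) * (1 / ((\<beta> - 1) * C) + \<Phi> \<theta> * sin t powr (\<beta> - 1)))"
      proof -
        have "sin t powr (1 - \<beta>) * (1 / ((\<beta> - 1) * C) + \<Phi> \<theta> * sin t powr (\<beta> - 1))
          = sin t powr (1 - \<beta>) / ((\<beta> - 1) * C) + \<Phi> \<theta> * (sin t powr (1 - \<beta>) * sin t powr (\<beta> - 1))"
          by (simp only: distrib_left mult_ac times_divide_eq_right mult_1_right)
        then show ?thesis by (simp add: sp)
      qed
      also have "\<dots> \<le> sin t powr (1 - \<beta>) * 1"
        using d(2)[of t] t by (intro mult_left_mono) auto
      also have "\<dots> = w t * sin t" using s by (simp add: w_def powr_diff powr_minus divide_inverse)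
      finally show ?thesis using s ph by (simp add: eta_eq field_simps)
    qed
  qed
qed

end

section \<open>The Hardy inequality for smooth functions\<close>

text \<open>Extension by zero of a product whose factor \<open>g\<close> lives on an open interval
  and whose cut-off \<open>X\<close> vanishes near both ends. The interval and the complement of
  \<open>{l'..u'}\<close> form an open cover of the line, on each part of which the claim is
  immediate.\<close>

lemma C1_glue:
  fixes g X :: "real \<Rightarrow> real"
  assumes lu: "l < l'" "u' < u"
    and g: "\<And>t. l < t \<Longrightarrow> t < u \<Longrightarrow> (g has_real_derivative g' t) (at t)" "continuous_on {l<..<u} g'"
    and X: "\<And>t. (X has_real_derivative X' t) (at t)" "continuous_on UNIV X'"
    and z: "\<And>t. t \<le> l' \<or> t \<ge> u' \<Longrightarrow> X t = 0 \<and> X' t = 0"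
  shows "((\<lambda>t. if l < t \<and> t < u then X t * g t else 0) has_real_derivative
      (if l < t \<and> t < u then X' t * g t + X t * g' t else 0)) (at t)"
    and "continuous_on UNIV (\<lambda>t. if l < t \<and> t < u then X' t * g t + X t * g' t else 0)"
proof -
  let ?A = "{l<..<u}" and ?B = "- {l'..u'}"
  have zB: "X t = 0 \<and> X' t = 0" if "t \<in> ?B" for t using z that by auto
  have AB: "t \<in> ?A \<or> t \<in> ?B" for t using lu by auto
  show "((\<lambda>t. if l < t \<and> t < u then X t * g t else 0) has_real_derivative
      (if l < t \<and> t < u then X' t * g t + X t * g' t else 0)) (at t)"
  proof (cases "t \<in> ?A")
    case True
    then have "((\<lambda>t. X t * g t) has_real_derivative X' t * g t + g' t * X t) (at t)"
      by (intro DERIV_mult X(1) g(1)) auto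
    then have "((\<lambda>t. X t * g t) has_real_derivative
      (if l < t \<and> t < u then X' t * g t + X t * g' t else 0)) (at t)" using True by (simp add: mult.commute)
    then show ?thesis
      by (rule has_field_derivative_transform_within_open[of _ _ _ ?A]) (use True in auto)
  next
    case False
    then have t: "t \<in> ?B" using AB by blast
    have "((\<lambda>t. 0) has_real_derivative
      (if l < t \<and> t < u then X' t * g t + X t * g' t else 0)) (at t)" using False by auto
    then show ?thesis
      by (rule has_field_derivative_transform_within_open[of _ _ _ ?B]) (use t zB in auto)
  qed
  have "continuous_on ?A g" by (intro continuous_at_imp_continuous_on) (auto intro!: DERIV_isCont[OF g(1)])
  moreover have "continuous_on ?A X" by (intro continuous_at_imp_continuous_on) (auto intro!: DERIV_isCont[OF X(1)])
  ultimately have "continuous_on ?A (\<lambda>t. X' t * g t + X t * g' t)"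
    using g(2) X(2) by (intro continuous_intros) (auto intro: continuous_on_subset)
  then have "continuous_on ?A (\<lambda>t. if l < t \<and> t < u then X' t * g t + X t * g' t else 0)"
    by (rule continuous_on_eq) auto
  moreover have "continuous_on ?B (\<lambda>t. if l < t \<and> t < u then X' t * g t + X t * g' t else 0)"
    by (rule continuous_on_eq[of _ "\<lambda>_. 0"]) (use zB in auto)
  ultimately have "continuous_on (?A \<union> ?B) (\<lambda>t. if l < t \<and> t < u then X' t * g t + X t * g' t else 0)"
    by (intro continuous_on_open_Un) auto
  moreover have "?A \<union> ?B = UNIV" using AB by blast
  ultimately show "continuous_on UNIV (\<lambda>t. if l < t \<and> t < u then X' t * g t + X t * g' t else 0)" by simp
qed

context hardy_weight
begin

text \<open>The product of the Hardy constant and the \<open>p\<close>-th power of the factor in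
  \<open>rho\<close>: \<open>n - p\<close> cancels.\<close>

definition "c\<^sub>0 = ((p - 1) / p) powr p"

section \<open>The radial field in the variable \<open>t = cos \<theta>\<close>\<close>

lemma arccos_range:
  assumes "cos a < t" "t < 1"
  shows "0 < arccos t" "arccos t < a" "sqrt (1 - t\<^sup>2) > 0" "sin (arccos t) = sqrt (1 - t\<^sup>2)" "cos (arccos t) = t" "-1 < t"
proof -
  show t: "-1 < t" using assms(1) cos_ge_minus_one[of a] by linarith
  have "arccos 1 < arccos t" using assms t by (intro arccos_less_arccos) auto
  then show "0 < arccos t" by simp
  have "arccos t < arccos (cos a)" using assms by (intro arccos_less_arccos) auto
  then show "arccos t < a" using a0 api by (simp add: arccos_cos)
  have "t\<^sup>2 < 1" using t assms(2) by (simp add: abs_square_less_1)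
  then show "sqrt (1 - t\<^sup>2) > 0" by simp
  show "sin (arccos t) = sqrt (1 - t\<^sup>2)" using t assms by (intro sin_arccos) auto
  show "cos (arccos t) = t" using t assms by simp
qed

definition "\<psi>\<^sub>0 t = \<eta> (arccos t) powr (p - 1) / sqrt (1 - t\<^sup>2)"

text \<open>Solved from the requirement that the divergence
  \<open>(1 - t^2) \<psi>' - n t \<psi>\<close> of the field equal
  \<open>- (p - 1) \<eta>^p\<close>.\<close>

definition "\<psi>\<^sub>0' t = (n * t * \<psi>\<^sub>0 t - (p - 1) * \<eta> (arccos t) powr p) / (1 - t\<^sup>2)"

lemma eta_arccos_has_derivative:
  assumes "cos a < t" "t < 1"
  shows "((\<lambda>t. \<eta> (arccos t)) has_real_derivative
    \<eta> (arccos t) * (\<eta> (arccos t) - \<beta> * t / sqrt (1 - t\<^sup>2)) * inverse (- sqrt (1 - t\<^sup>2))) (at t)"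
proof -
  note r = arccos_range[OF assms]
  have "(arccos has_real_derivative inverse (- sqrt (1 - t\<^sup>2))) (at t)"
    using r(6) assms by (intro DERIV_arccos) auto
  from DERIV_chain2[OF eta_has_derivative[OF r(1,2)] this] show ?thesis by (simp add: r(4,5))
qed

text \<open>The cotangent term of the Riccati equation contributes
  \<open>(p - 1) * \<beta> = n - 1\<close> and the factor \<open>1 / sqrt (1 - t^2)\<close> one
  more, which together form the coefficient \<open>n\<close>.\<close>

lemma \<psi>\<^sub>0_has_derivative:
  assumes t: "cos a < t" "t < 1"
  shows "(\<psi>\<^sub>0 has_real_derivative \<psi>\<^sub>0' t) (at t)"
proof -
  note r = arccos_range[OF t]
  define S where "S = sqrt (1 - t\<^sup>2)"
  have S: "S > 0" "S\<^sup>2 = 1 - t\<^sup>2" using r(3) by (auto simp: S_def)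
  define y where "y = \<eta> (arccos t)"
  have y: "y > 0" using eta_pos[OF r(1,2)] by (simp add: y_def)
  let ?d = "y * (y - \<beta> * t / S) * inverse (- S)"
  have d1: "((\<lambda>t. \<eta> (arccos t) powr (p - 1)) has_real_derivative (p - 1) * y powr (p - 1 - 1) * ?d) (at t)"
    using y unfolding y_def S_def
    by (auto intro!: derivative_eq_intros eta_arccos_has_derivative[OF t])
  have t2: "1 - t\<^sup>2 > 0" using r(3) by simp
  have d2: "((\<lambda>t. sqrt (1 - t\<^sup>2)) has_real_derivative - t / S) (at t)"
    unfolding S_def using t2 by (auto intro!: derivative_eq_intros simp: field_simps)
  have "(\<psi>\<^sub>0 has_real_derivative (((p - 1) * y powr (p - 1 - 1) * ?d) * S - y powr (p - 1) * (- t / S)) / (S * S)) (at t)"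
    unfolding \<psi>\<^sub>0_def[abs_def] using DERIV_divide[OF d1 d2] S by (simp add: S_def y_def)
  moreover have "(((p - 1) * y powr (p - 1 - 1) * ?d) * S - y powr (p - 1) * (- t / S)) / (S * S) = \<psi>\<^sub>0' t"
  proof -
    have y1: "y powr (p - 1 - 1) * y = y powr (p - 1)" "y powr (p - 1) * y = y powr p"
      using y powr_add[of y "p - 1 - 1" 1] powr_add[of y "p - 1" 1] by simp_all
    have "(p - 1) * y powr (p - 1 - 1) * ?d * S = - (p - 1) * ((y powr (p - 1 - 1) * y) * (y - \<beta> * t / S))"
      using S by (simp add: field_simps)
    also have "\<dots> = - (p - 1) * (y powr (p - 1) * y) + ((p - 1) * \<beta>) * y powr (p - 1) * t / S"
      unfolding y1(1) using S by (simp add: field_simps)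
    finally have "(p - 1) * y powr (p - 1 - 1) * ?d * S = - (p - 1) * y powr p + (n - 1) * y powr (p - 1) * t / S"
      unfolding y1(2) beta(2) .
    moreover have "- (p - 1) * y powr p + (n - 1) * y powr (p - 1) * t / S - y powr (p - 1) * (- t / S)
        = n * t * (y powr (p - 1) / S) - (p - 1) * y powr p"
      using S by (simp add: field_simps)
    ultimately have "(((p - 1) * y powr (p - 1 - 1) * ?d) * S - y powr (p - 1) * (- t / S))
        = n * t * (y powr (p - 1) / S) - (p - 1) * y powr p"
      by (simp only:)
    moreover have "\<psi>\<^sub>0 t = y powr (p - 1) / S" by (simp add: \<psi>\<^sub>0_def y_def S_def)
    moreover have "1 - t\<^sup>2 = S * S" using S(2) by (simp add: power2_eq_square)
    ultimately show ?thesis by (simp only: \<psi>\<^sub>0'_def y_def[symmetric])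
  qed
  ultimately show ?thesis by simp
qed

lemma \<psi>\<^sub>0'_continuous: "continuous_on {cos a<..<1} \<psi>\<^sub>0'"
proof -
  have "continuous_on {cos a<..<1} \<psi>\<^sub>0"
    by (rule continuous_at_imp_continuous_on) (auto intro!: DERIV_isCont[OF \<psi>\<^sub>0_has_derivative])
  note c0 = this
  have e: "continuous_on {cos a<..<1} (\<lambda>t. \<eta> (arccos t))"
    by (rule continuous_at_imp_continuous_on) (auto intro!: DERIV_isCont[OF eta_arccos_has_derivative])
  have c1: "continuous_on {cos a<..<1} (\<lambda>t. \<eta> (arccos t) powr p)"
    by (intro continuous_on_powr e continuous_on_const) (use eta_pos arccos_range in force)
  have "1 - t\<^sup>2 \<noteq> 0" if "t \<in> {cos a<..<1}" for t using arccos_range(3)[of t] that by auto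
  then show ?thesis
    unfolding \<psi>\<^sub>0'_def[abs_def]
    by (intro continuous_on_divide continuous_on_diff continuous_on_mult continuous_on_const
        continuous_on_id continuous_on_power c0 c1) auto
qed

text \<open>The cut-off vanishes near the pole, and its derivative has the favourable sign there; this
  is why the singular weight can be truncated without a loss in the constant.\<close>

lemma radial_kernel:
  assumes t1: "cos a < t1" and \<epsilon>: "0 < \<epsilon>" "t1 < 1 - 2 * \<epsilon>"
  obtains \<psi> \<psi>' where "\<And>t. (\<psi> has_real_derivative \<psi>' t) (at t)" "continuous_on UNIV \<psi>'" "\<And>t. \<psi> t \<ge> 0"
    "\<And>t. t1 \<le> t \<Longrightarrow> 0 \<le> n * \<psi> t * t - \<psi>' t * (1 - t\<^sup>2) - (p - 1) * (\<psi> t * sqrt (1 - t\<^sup>2)) powr (p / (p - 1))"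
    "\<And>t. t1 \<le> t \<Longrightarrow> t \<le> 1 - 2 * \<epsilon> \<Longrightarrow> c\<^sub>0 * \<eta> (arccos t) powr p
       \<le> n * \<psi> t * t - \<psi>' t * (1 - t\<^sup>2) - (p - 1) * (\<psi> t * sqrt (1 - t\<^sup>2)) powr (p / (p - 1))"
proof -
  \<comment> \<open>The field yields \<open>(p - 1) * (k - k^(p/(p-1)))\<close> times
    \<open>\<eta>^p\<close>. This \<open>k\<close> maximises the factor, and the maximum is
    \<open>c\<^sub>0\<close>.\<close>
  define k where "k = ((p - 1) / p) powr (p - 1)"
  let ?q = "p / (p - 1)"
  \<comment> \<open>The lower transition of the cut-off takes place between \<open>l\<close> and
    \<open>t1\<close>, strictly inside the ball of radius \<open>a\<close> but outside the region
    where the kernel is needed. The upper transition lies between \<open>1 - 2 * \<epsilon>\<close>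
    and \<open>1 - \<epsilon>\<close>.\<close>
  define l where "l = (cos a + t1) / 2"
  have l: "cos a < l" "l < t1" using t1 by (auto simp: l_def)
  define X where "X t = k * (smoothstep ((t - l) / (t1 - l)) * smoothstep ((1 - \<epsilon> - t) / \<epsilon>))" for t
  define X' where "X' t = k * (smoothstep' ((t - l) / (t1 - l)) / (t1 - l) * smoothstep ((1 - \<epsilon> - t) / \<epsilon>)
     - smoothstep' ((1 - \<epsilon> - t) / \<epsilon>) / \<epsilon> * smoothstep ((t - l) / (t1 - l)))" for t
  have k: "k > 0" "k powr ?q = c\<^sub>0" "c\<^sub>0 * p = (p - 1) * k"
  proof -
    show "k > 0" using p1 by (simp add: k_def)
    have "(p - 1) * ?q = p" using p1 by simp
    then show "k powr ?q = c\<^sub>0" by (simp only: k_def powr_powr c\<^sub>0_def)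
    have "((p - 1) / p) powr p = ((p - 1) / p) powr (p - 1) * ((p - 1) / p)"
      using powr_add[of "(p - 1) / p" "p - 1" 1] p1 by simp
    then show "c\<^sub>0 * p = (p - 1) * k" using p1 by (simp add: k_def c\<^sub>0_def)
  qed
  define \<psi> where "\<psi> t = (if cos a < t \<and> t < 1 then X t * \<psi>\<^sub>0 t else 0)" for t
  define \<psi>' where "\<psi>' t = (if cos a < t \<and> t < 1 then X' t * \<psi>\<^sub>0 t + X t * \<psi>\<^sub>0' t else 0)" for t
  have dX: "(X has_real_derivative X' t) (at t)" for t
  proof -
    have d1: "((\<lambda>t. smoothstep ((t - l) / (t1 - l))) has_real_derivative smoothstep' ((t - l) / (t1 - l)) * (1 / (t1 - l))) (at t)"
      using l by (intro DERIV_chain2[OF smoothstep_has_real_derivative]) (auto intro!: derivative_eq_intros)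
    have d2: "((\<lambda>t. smoothstep ((1 - \<epsilon> - t) / \<epsilon>)) has_real_derivative smoothstep' ((1 - \<epsilon> - t) / \<epsilon>) * (- 1 / \<epsilon>)) (at t)"
      using \<epsilon> by (intro DERIV_chain2[OF smoothstep_has_real_derivative]) (auto intro!: derivative_eq_intros)
    show ?thesis
      unfolding X_def[abs_def] X'_def
      by (rule DERIV_cong[OF DERIV_cmult[OF DERIV_mult[OF d1 d2]]]) simp
  qed
  have cX: "continuous_on UNIV X'"
  proof -
    have "continuous_on UNIV smoothstep"
      by (rule continuous_at_imp_continuous_on) (auto intro!: DERIV_isCont[OF smoothstep_has_real_derivative])
    then have cs: "continuous_on UNIV (\<lambda>t. smoothstep (f t))" "continuous_on UNIV (\<lambda>t. smoothstep' (f t))"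
      if "continuous_on UNIV f" for f :: "real \<Rightarrow> real"
      using continuous_smoothstep' that by (auto intro: continuous_on_compose2)
    have f: "continuous_on UNIV (\<lambda>t. (t - l) / (t1 - l))" "continuous_on UNIV (\<lambda>t. (1 - \<epsilon> - t) / \<epsilon>)"
      using l \<epsilon> by (auto intro!: continuous_intros)
    show ?thesis unfolding X'_def[abs_def]
      using l \<epsilon> by (intro continuous_intros cs(1)[OF f(1)] cs(1)[OF f(2)] cs(2)[OF f(1)] cs(2)[OF f(2)]) auto
  qed
  have z: "X t = 0 \<and> X' t = 0" if "t \<le> l \<or> t \<ge> 1 - \<epsilon>" for t
  proof -
    have "(t - l) / (t1 - l) \<le> 0 \<or> (1 - \<epsilon> - t) / \<epsilon> \<le> 0"
      using that l \<epsilon> by (auto simp: divide_nonpos_pos)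
    then show ?thesis by (auto simp: X_def X'_def smoothstep_eq)
  qed
  have \<epsilon>1: "1 - \<epsilon> < 1" using \<epsilon> by simp
  have d\<psi>: "(\<psi> has_real_derivative \<psi>' t) (at t)" for t
    unfolding \<psi>_def[abs_def] \<psi>'_def
    by (rule C1_glue(1)[OF l(1) \<epsilon>1]) (use z in \<open>auto intro!: \<psi>\<^sub>0_has_derivative \<psi>\<^sub>0'_continuous dX cX\<close>)
  have c\<psi>: "continuous_on UNIV \<psi>'"
    unfolding \<psi>'_def[abs_def]
    by (rule C1_glue(2)[OF l(1) \<epsilon>1 \<psi>\<^sub>0_has_derivative _ dX cX]) (use z in \<open>auto intro!: \<psi>\<^sub>0'_continuous\<close>)
  have psi0: "\<psi>\<^sub>0 t > 0" if "cos a < t" "t < 1" for t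
    using arccos_range[OF that] eta_pos[of "arccos t"] by (simp add: \<psi>\<^sub>0_def)
  have X0: "X t \<ge> 0" for t using k smoothstep_bounds by (simp add: X_def)
  have X'neg: "X' t \<le> 0" if "t1 \<le> t" for t
  proof -
    have "(t - l) / (t1 - l) \<ge> 1" using that l by simp
    then show ?thesis using k \<epsilon> smoothstep_bounds by (simp add: X'_def smoothstep_eq)
  qed
  have key: "c\<^sub>0 * (X t / k) * \<eta> (arccos t) powr p
       \<le> n * \<psi> t * t - \<psi>' t * (1 - t\<^sup>2) - (p - 1) * (\<psi> t * sqrt (1 - t\<^sup>2)) powr ?q"
    if t: "t1 \<le> t" "t < 1" for t
  proof -
    have ta: "cos a < t" using t t1 by simp
    note r = arccos_range[OF ta t(2)]
    define S where "S = sqrt (1 - t\<^sup>2)"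
    have S: "S > 0" "1 - t\<^sup>2 = S\<^sup>2" "1 - t\<^sup>2 \<noteq> 0" "1 - t\<^sup>2 > 0" using r(3) by (auto simp: S_def)
    define y where "y = \<eta> (arccos t)"
    have y: "y > 0" using eta_pos[OF r(1,2)] by (simp add: y_def)
    define x where "x = X t / k"
    have x: "0 \<le> x" "x \<le> 1" "X t = k * x"
      using k smoothstep_bounds by (auto simp: x_def X_def mult_le_one)
    have "\<psi> t * S = k * x * y powr (p - 1)"
      using ta t(2) S(1) by (simp add: \<psi>_def \<psi>\<^sub>0_def x(3) y_def[symmetric] S_def[symmetric])
    then have "(\<psi> t * S) powr ?q = c\<^sub>0 * x powr ?q * y powr p"
    proof -
      have "(p - 1) * ?q = p" using p1 by simp
      then have "(y powr (p - 1)) powr ?q = y powr p" by (simp only: powr_powr)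
      moreover have "(k * x * y powr (p - 1)) powr ?q = k powr ?q * x powr ?q * (y powr (p - 1)) powr ?q"
        by (simp only: powr_mult)
      ultimately show ?thesis by (simp only: k(2) \<open>\<psi> t * S = k * x * y powr (p - 1)\<close>)
    qed
    \<comment> \<open>Scaling the field by \<open>x\<close> in \<open>[0, 1]\<close> scales its
      divergence by \<open>x\<close> but the loss in Young's inequality by the smaller factor
      \<open>x powr ?q\<close>, so at least the fraction \<open>x\<close> of the weight
      remains.\<close>
    also have "\<dots> \<le> c\<^sub>0 * x * y powr p"
    proof -
      have "x powr ?q \<le> x" using x powr_mono'[of 1 ?q x] p1 by (cases "x = 0") (auto simp: field_simps)
      then show ?thesis by (intro mult_right_mono mult_left_mono) (auto simp: c\<^sub>0_def)
    qed
    finally have q: "(\<psi> t * S) powr ?q \<le> c\<^sub>0 * x * y powr p" .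
    have "\<psi>\<^sub>0' t * (1 - t\<^sup>2) = n * t * \<psi>\<^sub>0 t - (p - 1) * y powr p"
      using S(3) by (simp add: \<psi>\<^sub>0'_def y_def)
    then have "X t * (\<psi>\<^sub>0' t * (1 - t\<^sup>2)) = X t * (n * t * \<psi>\<^sub>0 t - (p - 1) * y powr p)" by (simp only:)
    also have "\<dots> = n * (X t * \<psi>\<^sub>0 t) * t - (p - 1) * X t * y powr p" by (simp add: algebra_simps)
    also have "\<dots> = n * \<psi> t * t - (p - 1) * k * x * y powr p"
      using ta t(2) by (simp add: \<psi>_def x(3))
    finally have "X t * (\<psi>\<^sub>0' t * (1 - t\<^sup>2)) = n * \<psi> t * t - (p - 1) * k * x * y powr p" .
    moreover have "\<psi>' t * (1 - t\<^sup>2) = X' t * \<psi>\<^sub>0 t * (1 - t\<^sup>2) + X t * (\<psi>\<^sub>0' t * (1 - t\<^sup>2))"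
      using ta t(2) by (simp add: \<psi>'_def algebra_simps)
    moreover have "c\<^sub>0 * p * x * y powr p = (p - 1) * k * x * y powr p" by (simp only: k(3))
    ultimately have "n * \<psi> t * t - \<psi>' t * (1 - t\<^sup>2) = c\<^sub>0 * p * x * y powr p - X' t * \<psi>\<^sub>0 t * (1 - t\<^sup>2)"
      by linarith
    moreover have "X' t * \<psi>\<^sub>0 t * (1 - t\<^sup>2) \<le> 0"
      using X'neg[OF t(1)] psi0[OF ta t(2)] S(4) by (simp add: mult_nonpos_nonneg)
    moreover have "(p - 1) * (\<psi> t * S) powr ?q \<le> (p - 1) * (c\<^sub>0 * x * y powr p)"
      using q p1 by (intro mult_left_mono) auto
    ultimately have "c\<^sub>0 * x * y powr p \<le> n * \<psi> t * t - \<psi>' t * (1 - t\<^sup>2) - (p - 1) * (\<psi> t * S) powr ?q"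
      by (simp add: algebra_simps)
    then show ?thesis by (simp add: x_def y_def S_def)
  qed
  show ?thesis
  proof (rule that[OF d\<psi> c\<psi>])
    show "\<psi> t \<ge> 0" for t
      using mult_nonneg_nonneg[OF X0 less_imp_le[OF psi0]] by (simp add: \<psi>_def)
    fix t assume t: "t1 \<le> t"
    show "0 \<le> n * \<psi> t * t - \<psi>' t * (1 - t\<^sup>2) - (p - 1) * (\<psi> t * sqrt (1 - t\<^sup>2)) powr ?q"
    proof (cases "t < 1")
      case True
      have "0 \<le> c\<^sub>0 * (X t / k) * \<eta> (arccos t) powr p"
        using X0 k by (intro mult_nonneg_nonneg divide_nonneg_pos) (auto simp: c\<^sub>0_def)
      then show ?thesis using key[OF t True] by linarith
    qed (simp add: \<psi>_def \<psi>'_def)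
    assume t': "t \<le> 1 - 2 * \<epsilon>"
    have "(t - l) / (t1 - l) \<ge> 1" "(1 - \<epsilon> - t) / \<epsilon> \<ge> 1" using t t' l \<epsilon> by auto
    then have "X t / k = 1" using k by (simp add: X_def smoothstep_eq)
    then show "c\<^sub>0 * \<eta> (arccos t) powr p
       \<le> n * \<psi> t * t - \<psi>' t * (1 - t\<^sup>2) - (p - 1) * (\<psi> t * sqrt (1 - t\<^sup>2)) powr ?q"
      using key[OF t] t' \<epsilon> by auto
  qed
qed

text \<open>Beyond \<open>t1\<close> the kernel of the cut-off field dominates \<open>h\<close> up
  to height \<open>1 - 2 * \<epsilon>\<close> and is still nonnegative nearer the pole; below
  \<open>t1\<close> the function vanishes. Letting \<open>\<epsilon>\<close> tend to 0 recovers all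
  of \<open>h\<close>, the pole being a null set.\<close>

lemma hardy_symmetric:
  fixes e :: "'a::euclidean_space"
  assumes e: "norm e = 1" and dim: "n = real DIM('a) - 1" "DIM('a) \<ge> 2"
    and appr: "approximable p L E v" and v0: "\<And>x. 0 \<le> v x" and [measurable]: "v \<in> borel_measurable borel"
    and t1: "cos a < t1" "t1 < 1" and vz: "\<And>x. norm x = 1 \<Longrightarrow> x \<bullet> e \<le> t1 \<Longrightarrow> v x = 0"
    and [measurable]: "h \<in> borel_measurable borel" and h0: "\<And>x. 0 \<le> h x" and H: "\<And>x. norm x = 1 \<Longrightarrow> h x \<le> H"
    and hle: "\<And>x. norm x = 1 \<Longrightarrow> t1 < x \<bullet> e \<Longrightarrow> x \<bullet> e < 1 \<Longrightarrow> h x \<le> c\<^sub>0 * \<eta> (arccos (x \<bullet> e)) powr p"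
  shows "(\<integral>x. v x powr p * h x \<partial>sphere_measure) \<le> E"
proof -
  \<comment> \<open>The part of the weighted integrand that the kernel with cut-off parameter
    \<open>\<epsilon>\<close> is known to dominate.\<close>
  define I where "I \<epsilon> x = v x powr p * (indicator {..<1 - 2 * \<epsilon>} (x \<bullet> e) * h x)" for \<epsilon> x
  have "bounded (v ` sphere 0 1)"
    using approximable_continuous[OF appr] by (intro compact_imp_bounded compact_continuous_image) auto
  then obtain B where "\<forall>y\<in>v ` sphere 0 1. norm y \<le> B" unfolding bounded_iff by blast
  then have B: "v x \<le> B" if "norm x = 1" for x using that by (auto simp: abs_le_iff)
  have vp: "v x powr p \<le> B powr p" if "norm x = 1" for x
    using B[OF that] v0[of x] p1 by (intro powr_mono2) auto
  have [measurable]: "I \<epsilon> \<in> borel_measurable borel" for \<epsilon> unfolding I_def by measurable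
  have bound: "\<bar>v x powr p * (c * h x)\<bar> \<le> B powr p * H" if "norm x = 1" "0 \<le> c" "c \<le> 1" for x and c :: real
  proof -
    have "c * h x \<le> 1 * H" using that h0[of x] H[of x] by (intro mult_mono) auto
    then show ?thesis using vp[OF that(1)] h0[of x] that by (auto simp: abs_mult intro!: mult_mono)
  qed
  have le: "(\<integral>x. I \<epsilon> x \<partial>sphere_measure) \<le> E" if \<epsilon>: "0 < \<epsilon>" "t1 < 1 - 2 * \<epsilon>" for \<epsilon>
  proof -
    obtain \<psi> \<psi>' where \<psi>: "\<And>t. (\<psi> has_real_derivative \<psi>' t) (at t)" "continuous_on UNIV \<psi>'" "\<And>t. \<psi> t \<ge> 0"
      and K0: "\<And>t. t1 \<le> t \<Longrightarrow> 0 \<le> n * \<psi> t * t - \<psi>' t * (1 - t\<^sup>2) - (p - 1) * (\<psi> t * sqrt (1 - t\<^sup>2)) powr (p / (p - 1))"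
      and K1: "\<And>t. t1 \<le> t \<Longrightarrow> t \<le> 1 - 2 * \<epsilon> \<Longrightarrow> c\<^sub>0 * \<eta> (arccos t) powr p
       \<le> n * \<psi> t * t - \<psi>' t * (1 - t\<^sup>2) - (p - 1) * (\<psi> t * sqrt (1 - t\<^sup>2)) powr (p / (p - 1))"
      by (rule radial_kernel[OF t1(1) \<epsilon>]) blast
    define K where "K t = n * \<psi> t * t - \<psi>' t * (1 - t\<^sup>2) - (p - 1) * (\<psi> t * sqrt (1 - t\<^sup>2)) powr (p / (p - 1))" for t
    have cpsi: "continuous_on UNIV \<psi>" using \<psi>(1) by (meson DERIV_isCont continuous_at_imp_continuous_on)
    have [measurable]: "\<psi> \<in> borel_measurable borel" "\<psi>' \<in> borel_measurable borel"
      using cpsi \<psi>(2) by (auto intro: borel_measurable_continuous_onI)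
    have [measurable]: "K \<in> borel_measurable borel" unfolding K_def by measurable
    have "continuous_on {-1..1} K"
    proof -
      have c: "continuous_on {-1..1} \<psi>" "continuous_on {-1..1} \<psi>'"
        using cpsi \<psi>(2) by (auto intro: continuous_on_subset)
      have "continuous_on {-1..1} (\<lambda>t. (\<psi> t * sqrt (1 - t\<^sup>2)) powr (p / (p - 1)))"
        using p1 \<psi>(3) c by (intro continuous_on_powr' continuous_on_mult continuous_intros)
          (auto simp: abs_square_le_1 abs_le_iff)
      then show ?thesis unfolding K_def[abs_def]
        by (intro continuous_on_diff continuous_on_mult continuous_on_const c continuous_on_id continuous_on_power)
    qed
    then have "bounded (K ` {-1..1})" by (intro compact_imp_bounded compact_continuous_image) auto
    then obtain KB where "\<forall>y\<in>K ` {-1..1}. norm y \<le> KB" unfolding bounded_iff by blast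
    then have KB: "\<bar>K t\<bar> \<le> KB" if "t \<in> {-1..1}" for t using that by simp
    have xe: "x \<bullet> e \<in> {-1..1}" if "norm x = 1" for x
      using Cauchy_Schwarz_ineq2[of x e] that e by (auto simp: abs_le_iff)
    have "(\<integral>x. I \<epsilon> x \<partial>sphere_measure) \<le> (\<integral>x. v x powr p * K (x \<bullet> e) \<partial>sphere_measure)"
    proof (rule integral_mono_AE)
      show "integrable sphere_measure (I \<epsilon>)"
        by (rule integrable_sphere_bounded[of _ "B powr p * H"]) (auto simp: I_def intro!: bound)
      show "integrable sphere_measure (\<lambda>x. v x powr p * K (x \<bullet> e))"
      proof (rule integrable_sphere_bounded[of _ "B powr p * KB"])
        show "\<bar>v x powr p * K (x \<bullet> e)\<bar> \<le> B powr p * KB" if "norm x = 1" for x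
          using vp[OF that] KB[OF xe[OF that]] by (auto simp: abs_mult intro!: mult_mono')
      qed measurable
      have IK: "I \<epsilon> x \<le> v x powr p * K (x \<bullet> e)" if x: "norm x = 1" for x
      proof (cases "x \<bullet> e \<le> t1")
        case True
        then show ?thesis using vz[OF x] by (simp add: I_def)
      next
        case False
        have "indicator {..<1 - 2 * \<epsilon>} (x \<bullet> e) * h x \<le> K (x \<bullet> e)"
        proof (cases "x \<bullet> e < 1 - 2 * \<epsilon>")
          case True
          then show ?thesis using hle[OF x] K1[of "x \<bullet> e"] False \<epsilon> by (simp add: K_def)
        next
          case f: False
          then show ?thesis using K0[of "x \<bullet> e"] False by (simp add: K_def)
        qed
        then show ?thesis unfolding I_def by (intro mult_left_mono) auto
      qed
      show "AE x in sphere_measure. I \<epsilon> x \<le> v x powr p * K (x \<bullet> e)"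
        using AE_sphere_measure by eventually_elim (rule IK)
    qed
    also have "\<dots> \<le> E"
    proof (rule approximable_hardy[OF appr _ v0])
      show "\<bar>K (x \<bullet> e)\<bar> \<le> KB" if "norm x = 1" for x using KB[OF xe[OF that]] .
      show "(\<integral>x. \<bar>U x\<bar> powr p * K (x \<bullet> e) \<partial>sphere_measure) \<le> energy p G" if "C1 U G" for U G
        by (rule hardy_radial_field[OF e p1 that \<psi>]) (simp add: K_def dim)
    qed (use p1 in auto)
    finally show ?thesis .
  qed
  define \<epsilon> where "\<epsilon> j = (1 - t1) / 4 * inverse (real (Suc j))" for j
  have \<epsilon>: "0 < \<epsilon> j" "t1 < 1 - 2 * \<epsilon> j" for j
  proof -
    have "\<epsilon> j \<le> (1 - t1) / 4 * 1" unfolding \<epsilon>_def using t1 by (intro mult_left_mono) (auto simp: inverse_le_1_iff)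
    then have "2 * \<epsilon> j \<le> (1 - t1) / 2" by simp
    moreover have "(1 - t1) / 2 < 1 - t1" using t1 by simp
    ultimately show "t1 < 1 - 2 * \<epsilon> j" by linarith
    show "0 < \<epsilon> j" using t1 by (simp add: \<epsilon>_def)
  qed
  have \<epsilon>0: "\<epsilon> \<longlonglongrightarrow> 0" unfolding \<epsilon>_def
    using tendsto_mult_left[OF LIMSEQ_inverse_real_of_nat, of "(1 - t1) / 4"] by simp
  have "(\<lambda>j. \<integral>x. I (\<epsilon> j) x \<partial>sphere_measure) \<longlonglongrightarrow> (\<integral>x. v x powr p * h x \<partial>sphere_measure)"
  proof (rule integral_dominated_convergence[where w = "\<lambda>_. B powr p * H"])
    have ae: "AE x in sphere_measure. x \<noteq> e"
      using emeasure_sphere_measure_singleton[OF dim(2), of e] by (intro AE_I[of _ _ "{e}"]) auto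
    show "AE x in sphere_measure. (\<lambda>j. I (\<epsilon> j) x) \<longlonglongrightarrow> v x powr p * h x"
      using ae AE_sphere_measure
    proof eventually_elim
      case (elim x)
      have "x \<bullet> e \<noteq> 1"
      proof
        assume "x \<bullet> e = 1"
        moreover have "x \<bullet> x = 1" "e \<bullet> e = 1" using elim e by (auto simp: dot_square_norm)
        ultimately have "(x - e) \<bullet> (x - e) = 0"
          by (simp add: inner_diff_left inner_diff_right inner_commute[of e x])
        then show False using elim by simp
      qed
      moreover have "x \<bullet> e \<le> 1" using Cauchy_Schwarz_ineq2[of x e] elim e by (simp add: abs_le_iff)
      ultimately have lt: "(1 - x \<bullet> e) / 2 > 0" by simp
      have "\<forall>\<^sub>F j in sequentially. \<epsilon> j < (1 - x \<bullet> e) / 2" using order_tendstoD(2)[OF \<epsilon>0 lt] .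
      then have "\<forall>\<^sub>F j in sequentially. I (\<epsilon> j) x = v x powr p * h x"
        by eventually_elim (simp add: I_def)
      then show ?case by (rule tendsto_eventually)
    qed
    show "AE x in sphere_measure. norm (I (\<epsilon> j) x) \<le> B powr p * H" for j
      using AE_sphere_measure by eventually_elim (auto simp: I_def intro!: bound)
  qed auto
  then show ?thesis using le[OF \<epsilon>] by (intro LIMSEQ_le_const2) auto
qed

text \<open>A function that decreases with the distance to the pole and is positive somewhere at
  height at most \<open>t1\<close> is positive on the whole cap above \<open>t1\<close>. If that cap
  has more measure than the support of \<open>U\<close>, the symmetrized function vanishes below
  \<open>t1\<close>.\<close>

theorem hardy_C1:
  fixes e :: "'a::euclidean_space"
  assumes e: "norm e = 1" and dim: "n = real DIM('a) - 1" "DIM('a) \<ge> 2" and U: "C1 U G"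
    and small: "measure sphere_measure {x. U x \<noteq> 0} < measure sphere_measure {x. norm x = 1 \<and> cos a < x \<bullet> e}"
    and [measurable]: "h \<in> borel_measurable borel" and h0: "\<And>x. 0 \<le> h x" and H: "\<And>x. norm x = 1 \<Longrightarrow> h x \<le> H"
    and hmono: "\<And>x y. norm x = 1 \<Longrightarrow> norm y = 1 \<Longrightarrow> x \<bullet> e \<le> y \<bullet> e \<Longrightarrow> h x \<le> h y"
    and hle: "\<And>x. norm x = 1 \<Longrightarrow> cos a < x \<bullet> e \<Longrightarrow> x \<bullet> e < 1 \<Longrightarrow> h x \<le> c\<^sub>0 * \<eta> (arccos (x \<bullet> e)) powr p"
  shows "(\<integral>x. \<bar>U x\<bar> powr p * h x \<partial>sphere_measure) \<le> energy p G"
proof -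
  have H': "\<bar>h x\<bar> \<le> H" if "norm x = 1" for x using h0[of x] H[OF that] by simp
  obtain v L where [measurable]: "v \<in> borel_measurable borel" and v0: "\<And>x. 0 \<le> v x" and appr: "approximable p L (energy p G) v"
    and vmono: "\<And>x y. norm x = 1 \<Longrightarrow> norm y = 1 \<Longrightarrow> x \<bullet> e < y \<bullet> e \<Longrightarrow> v x \<le> v y"
    and vm: "measure sphere_measure {x. v x > 0} \<le> measure sphere_measure {x. U x \<noteq> 0}"
    and vI: "(\<integral>x. \<bar>U x\<bar> powr p * h x \<partial>sphere_measure) \<le> (\<integral>x. v x powr p * h x \<partial>sphere_measure)"
  proof (rule symmetrization[where h = h, OF less_imp_le[OF p1] e U])
    show "h \<in> borel_measurable borel" by measurable
    show "\<bar>h x\<bar> \<le> H" if "norm x = 1" for x using H'[OF that] .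
    show "h x \<le> h y" if "norm x = 1" "norm y = 1" "x \<bullet> e \<le> y \<bullet> e" for x y using hmono[OF that] .
  qed (rule that)
  let ?A = "\<lambda>s. {x::'a. norm x = 1 \<and> s < x \<bullet> e}"
  have [measurable]: "?A s \<in> sets borel" for s by measurable
  \<comment> \<open>The strict inequality \<open>small\<close> survives a slight shrinking of the
    cap by continuity of the measure from below. The gained strip between \<open>cos a\<close> and
    \<open>t1\<close> hosts the lower cut-off.\<close>
  obtain t1 where t1: "cos a < t1" "measure sphere_measure {x. U x \<noteq> 0} < measure sphere_measure (?A t1)"
  proof -
    let ?B = "\<lambda>j::nat. ?A (cos a + inverse (real (Suc j)))"
    have inv: "inverse (real (Suc (Suc j))) \<le> inverse (real (Suc j))" for j by simp
    have "(\<lambda>j. measure sphere_measure (?B j)) \<longlonglongrightarrow> measure sphere_measure (\<Union>j. ?B j)"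
    proof (rule sphere.finite_Lim_measure_incseq)
      show "incseq ?B"
      proof (rule incseq_SucI)
        fix j
        show "?B j \<subseteq> ?B (Suc j)" using inv[of j] by (intro Collect_mono) linarith
      qed
    qed auto
    also have "(\<Union>j. ?B j) = ?A (cos a)"
    proof safe
      fix x :: 'a and j assume "cos a + inverse (real (Suc j)) < x \<bullet> e"
      moreover have "0 < inverse (real (Suc j))" by simp
      ultimately show "cos a < x \<bullet> e" by linarith
    next
      fix x :: 'a assume x: "norm x = 1" "cos a < x \<bullet> e"
      then obtain j where "inverse (real (Suc j)) < x \<bullet> e - cos a" using reals_Archimedean[of "x \<bullet> e - cos a"] by auto
      then have "cos a + inverse (real (Suc j)) < x \<bullet> e" by linarith
      then show "x \<in> (\<Union>j. ?B j)" using x by blast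
    qed
    finally have "\<forall>\<^sub>F j in sequentially. measure sphere_measure {x. U x \<noteq> 0} < measure sphere_measure (?B j)"
      using small by (rule order_tendstoD)
    then obtain j where j: "measure sphere_measure {x. U x \<noteq> 0} < measure sphere_measure (?B j)"
      using eventually_happens' sequentially_bot by blast
    have "cos a < cos a + inverse (real (Suc j))" by simp
    then show ?thesis using that j by blast
  qed
  have "t1 < 1"
  proof (rule ccontr)
    assume "\<not> t1 < 1"
    have "x \<bullet> e \<le> 1" if "norm x = 1" for x using Cauchy_Schwarz_ineq2[of x e] that e by (simp add: abs_le_iff)
    then have "?A t1 = {}" using \<open>\<not> t1 < 1\<close> by force
    then have "measure sphere_measure (?A t1) = 0" by (simp only: measure_empty)
    then show False using t1(2) measure_nonneg[of sphere_measure "{x. U x \<noteq> 0}"] by linarith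
  qed
  have vz: "v x = 0" if x: "norm x = 1" "x \<bullet> e \<le> t1" for x
  proof (rule ccontr)
    assume "v x \<noteq> 0"
    then have vx: "v x > 0" using v0[of x] by simp
    have "?A t1 \<subseteq> {x. v x > 0}"
      using vmono[OF x(1)] x(2) vx by (fastforce intro: less_le_trans)
    then have "measure sphere_measure (?A t1) \<le> measure sphere_measure {x. v x > 0}"
      by (intro sphere.finite_measure_mono) auto
    then show False using t1(2) vm by linarith
  qed
  have "(\<integral>x. v x powr p * h x \<partial>sphere_measure) \<le> energy p G"
    by (rule hardy_symmetric[OF e dim appr v0 _ t1(1) \<open>t1 < 1\<close> vz _ h0 H]) (use hle t1(1) in auto)
  then show ?thesis using vI by linarith
qed

text \<open>The truncated weight as a function of \<open>t = cos \<theta>\<close>; it also has the value of \<open>\<rho>\<close> at the pole itself.\<close>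

definition profile :: "real \<Rightarrow> real" where
  "profile t = (if cos \<tau> < t \<and> t < 1 then \<eta> (arccos t) else \<eta> \<tau>)"

lemma cos_a_less_cos_\<tau>: "cos a < cos \<tau>"
  using eta_T(1,2) api by (intro cos_monotone_0_pi) auto

lemma arccos_less_\<tau>:
  assumes "cos \<tau> < t" "t < 1"
  shows "arccos t < \<tau>"
proof -
  have "arccos t < arccos (cos \<tau>)" using assms by (intro arccos_less_arccos) auto
  then show ?thesis using eta_T(1,2) api by (simp add: arccos_cos)
qed

lemma profile_pos: "profile t > 0"
  using cos_a_less_cos_\<tau> arccos_range[of t] eta_T(1,2) by (auto simp: profile_def intro!: eta_pos)

text \<open>The value 1 is excluded because \<open>profile\<close> drops back to its minimum
  \<open>\<eta> \<tau>\<close> at the pole.\<close>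

lemma profile_mono:
  assumes "s \<le> t" "t < 1"
  shows "profile s \<le> profile t"
proof -
  have ar: "0 < arccos t" if "cos \<tau> < t" "t < 1" for t using arccos_range[of t] that cos_a_less_cos_\<tau> by simp
  have "\<eta> \<tau> \<le> \<eta> (arccos t)" if "cos \<tau> < t"
    using eta_T(3)[of "arccos t" \<tau>] arccos_less_\<tau>[of t] ar[of t] that assms by simp
  moreover have "\<eta> (arccos s) \<le> \<eta> (arccos t)" if "cos \<tau> < s"
  proof (cases "s = t")
    case False
    have "-1 < s" using that cos_ge_minus_one[of \<tau>] by linarith
    then have "arccos t < arccos s"
      using that assms False by (intro arccos_less_arccos) auto
    then show ?thesis
      using eta_T(3)[of "arccos t" "arccos s"] arccos_less_\<tau>[of s] ar[of t] that assms by simp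
  qed simp
  ultimately show ?thesis using assms by (auto simp: profile_def)
qed

lemma profile_le_eta:
  assumes "cos a < t" "t < 1"
  shows "profile t \<le> \<eta> (arccos t)"
proof (cases "cos \<tau> < t")
  case False
  have "\<tau> \<le> arccos t"
  proof -
    have "arccos (cos \<tau>) \<le> arccos t" using False arccos_range(6)[OF assms] by (intro arccos_le_arccos) auto
    then show ?thesis using eta_T(1,2) api by (simp add: arccos_cos)
  qed
  then show ?thesis
    using False eta_T(4)[of \<tau> "arccos t"] arccos_range[OF assms] by (cases "\<tau> = arccos t") (auto simp: profile_def)
qed (use assms in \<open>auto simp: profile_def\<close>)

lemma profile_measurable [measurable]: "profile \<in> borel_measurable borel"
proof -
  have "continuous_on {cos \<tau><..<1} (\<lambda>t. \<eta> (arccos t))"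
    using cos_a_less_cos_\<tau> by (intro continuous_at_imp_continuous_on)
      (auto intro!: DERIV_isCont eta_arccos_has_derivative)
  then have "(\<lambda>t. if t \<in> {cos \<tau><..<1} then \<eta> (arccos t) else \<eta> \<tau>) \<in> borel_measurable borel"
    by (intro borel_measurable_continuous_on_if) auto
  then show ?thesis by (simp add: profile_def[abs_def])
qed

lemma eta_trunc_arccos:
  assumes "-1 \<le> t" "t < 1"
  shows "eta_trunc n p a (arccos t) = profile t"
proof (cases "cos \<tau> < t")
  case True
  then show ?thesis using arccos_less_\<tau>[of t] assms by (simp add: eta_trunc_def profile_def)
next
  case False
  have "arccos (cos \<tau>) \<le> arccos t" using False assms by (intro arccos_le_arccos) auto
  then have "\<tau> \<le> arccos t" using eta_T(1,2) api by (simp add: arccos_cos)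
  then show ?thesis using False by (simp add: eta_trunc_def profile_def)
qed

end

section \<open>Closure in the Sobolev space and concentration at the pole\<close>

text \<open>Convexity applied to \<open>a / (1 - l)\<close> and \<open>b / l\<close>. This is a form
  of Minkowski's inequality for extended integrals: if the integral of \<open>b\<close> tends to 0
  first and \<open>l\<close> afterwards, the factor of \<open>a\<close> becomes 1.\<close>

lemma nn_integral_powr_perturb:
  fixes a b c :: "'a \<Rightarrow> real" and w :: "'a \<Rightarrow> ennreal"
  assumes p: "p \<ge> 1" and l: "0 < l" "l < 1"
    and [measurable]: "a \<in> borel_measurable M" "b \<in> borel_measurable M" "w \<in> borel_measurable M"
    and nn: "\<And>x. 0 \<le> a x" "\<And>x. 0 \<le> b x" "\<And>x. 0 \<le> c x" "\<And>x. c x \<le> a x + b x"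
  shows "(\<integral>\<^sup>+x. ennreal (c x powr p) * w x \<partial>M) \<le>
    ennreal ((1 - l) powr (1 - p)) * (\<integral>\<^sup>+x. ennreal (a x powr p) * w x \<partial>M) +
    ennreal (l powr (1 - p)) * (\<integral>\<^sup>+x. ennreal (b x powr p) * w x \<partial>M)"
proof -
  have pw: "c x powr p \<le> (1 - l) powr (1 - p) * a x powr p + l powr (1 - p) * b x powr p" for x
  proof -
    have "c x powr p \<le> (a x + b x) powr p" using nn p by (intro powr_mono2) auto
    also have "a x + b x = (1 - l) * (a x / (1 - l)) + (1 - (1 - l)) * (b x / l)" using l by simp
    also have "\<dots> powr p \<le> (1 - l) * (a x / (1 - l)) powr p + (1 - (1 - l)) * (b x / l) powr p"
      using nn l p by (intro powr_convex_combination) auto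
    also have "\<dots> = (1 - l) powr (1 - p) * a x powr p + l powr (1 - p) * b x powr p"
      using l nn by (simp add: powr_divide powr_diff)
    finally show ?thesis .
  qed
  have "(\<integral>\<^sup>+x. ennreal (c x powr p) * w x \<partial>M) \<le>
    (\<integral>\<^sup>+x. ennreal ((1 - l) powr (1 - p)) * (ennreal (a x powr p) * w x) +
      ennreal (l powr (1 - p)) * (ennreal (b x powr p) * w x) \<partial>M)"
  proof (rule nn_integral_mono)
    fix x
    have "ennreal (c x powr p) \<le> ennreal ((1 - l) powr (1 - p)) * ennreal (a x powr p) + ennreal (l powr (1 - p)) * ennreal (b x powr p)"
      using pw[of x] by (simp flip: ennreal_mult ennreal_plus add: ennreal_leI)
    from mult_right_mono[OF this, of "w x"]
    show "ennreal (c x powr p) * w x \<le> ennreal ((1 - l) powr (1 - p)) * (ennreal (a x powr p) * w x) +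
      ennreal (l powr (1 - p)) * (ennreal (b x powr p) * w x)"
      by (simp add: distrib_right mult.assoc)
  qed
  also have "\<dots> = ennreal ((1 - l) powr (1 - p)) * (\<integral>\<^sup>+x. ennreal (a x powr p) * w x \<partial>M) +
    ennreal (l powr (1 - p)) * (\<integral>\<^sup>+x. ennreal (b x powr p) * w x \<partial>M)"
    by (subst nn_integral_add) (auto simp: nn_integral_cmult)
  finally show ?thesis .
qed

lemma C1c_on_sphere_C1: "C1c_on_sphere \<Omega> U G \<Longrightarrow> C1 U G"
  by (auto simp: C1c_on_sphere_def C1_def)

lemma tgrad_measurable [measurable]:
  fixes G :: "'a::euclidean_space \<Rightarrow> 'a"
  assumes [measurable]: "G \<in> borel_measurable borel"
  shows "tgrad G \<in> borel_measurable borel"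
  unfolding tgrad_def[abs_def] by measurable

text \<open>With the weight bounded by \<open>M\<close>, convergence in \<open>L^p\<close> controls
  both sides. Three limits follow one another: the approximating sequence, the perturbation
  parameter \<open>l\<close>, and \<open>M\<close> by monotone convergence.\<close>

lemma W1p0_hardy_closure:
  fixes u :: "'a::euclidean_space \<Rightarrow> real"
  assumes p: "p > 1" and [measurable]: "\<Omega> \<in> sets borel" "W \<in> borel_measurable borel" and W0: "\<And>x. 0 \<le> W x"
    and hardy: "\<And>U G M. C1c_on_sphere \<Omega> U G \<Longrightarrow> 0 \<le> M \<Longrightarrow>
      (\<integral>\<^sup>+x\<in>\<Omega>. ennreal (\<bar>U x\<bar> powr p * min (W x) M) \<partial>sphere_measure) \<le> (\<integral>\<^sup>+x\<in>\<Omega>. ennreal (norm (tgrad G x) powr p) \<partial>sphere_measure)"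
    and ug: "W1p0 p \<Omega> u g"
  shows "(\<integral>\<^sup>+x\<in>\<Omega>. ennreal (\<bar>u x\<bar> powr p * W x) \<partial>sphere_measure) \<le> (\<integral>\<^sup>+x\<in>\<Omega>. ennreal (norm (g x) powr p) \<partial>sphere_measure)"
proof -
  have [measurable]: "u \<in> borel_measurable borel" "g \<in> borel_measurable borel"
    and gfin: "(\<integral>\<^sup>+ x. ennreal (norm (g x) powr p) \<partial>sphere_measure) < \<infinity>"
    using ug by (auto simp: W1p0_def)
  obtain U G where UG: "\<And>k::nat. C1c_on_sphere \<Omega> (U k) (G k)"
    and U: "(\<lambda>k. \<integral>\<^sup>+ x. ennreal (\<bar>U k x - u x\<bar> powr p) \<partial>sphere_measure) \<longlonglongrightarrow> 0"
    and G: "(\<lambda>k. \<integral>\<^sup>+ x. ennreal (norm (tgrad (G k) x - g x) powr p) \<partial>sphere_measure) \<longlonglongrightarrow> 0"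
    using ug unfolding W1p0_def by blast
  have [measurable]: "U k \<in> borel_measurable borel" "G k \<in> borel_measurable borel" for k
    using C1_measurable[OF C1c_on_sphere_C1[OF UG[of k]]] by auto
  define A where "A k = (\<integral>\<^sup>+ x. ennreal (\<bar>U k x - u x\<bar> powr p) \<partial>sphere_measure)" for k
  define B where "B k = (\<integral>\<^sup>+ x. ennreal (norm (tgrad (G k) x - g x) powr p) \<partial>sphere_measure)" for k
  define C where "C = (\<integral>\<^sup>+x\<in>\<Omega>. ennreal (norm (g x) powr p) \<partial>sphere_measure)"
  have "C \<le> (\<integral>\<^sup>+ x. ennreal (norm (g x) powr p) \<partial>sphere_measure)"
    unfolding C_def by (intro nn_integral_mono) (auto simp: indicator_def)
  then have "C < \<infinity>" using gfin by (rule le_less_trans)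
  then obtain c where c: "C = ennreal c" "c \<ge> 0" by (cases C) auto
  have le: "(\<integral>\<^sup>+x\<in>\<Omega>. ennreal (\<bar>u x\<bar> powr p * min (W x) M) \<partial>sphere_measure) \<le> C" if M: "0 \<le> M" for M
  proof -
    let ?w = "\<lambda>x. ennreal (min (W x) M) * indicator \<Omega> x"
    let ?L = "\<integral>\<^sup>+x. ennreal (\<bar>u x\<bar> powr p) * ?w x \<partial>sphere_measure"
    have wsplit: "(\<integral>\<^sup>+x\<in>\<Omega>. ennreal (\<bar>v x\<bar> powr p * min (W x) M) \<partial>sphere_measure)
      = (\<integral>\<^sup>+x. ennreal (\<bar>v x\<bar> powr p) * ?w x \<partial>sphere_measure)" for v :: "'a \<Rightarrow> real"
      using W0 M by (intro nn_integral_cong) (simp add: ennreal_mult mult.assoc)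
    have L: "?L \<le> ennreal ((1 - l) powr (1 - p) * (1 - l) powr (1 - p) * c)" if l: "0 < l" "l < 1" for l
    proof -
      let ?s = "ennreal ((1 - l) powr (1 - p))" and ?t = "ennreal (l powr (1 - p))"
      have Lk: "?L \<le> ?s * (?s * C + ?t * B k) + ?t * (ennreal M * A k)" for k
      proof -
        let ?X = "\<integral>\<^sup>+x. ennreal (\<bar>U k x\<bar> powr p) * ?w x \<partial>sphere_measure"
        let ?Y = "\<integral>\<^sup>+x. ennreal (\<bar>U k x - u x\<bar> powr p) * ?w x \<partial>sphere_measure"
        let ?Z = "\<integral>\<^sup>+x. ennreal (norm (tgrad (G k) x - g x) powr p) * indicator \<Omega> x \<partial>sphere_measure"
        have 1: "?L \<le> ?s * ?X + ?t * ?Y"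
          using p l by (intro nn_integral_powr_perturb) auto
        have "?Y \<le> (\<integral>\<^sup>+x. ennreal M * ennreal (\<bar>U k x - u x\<bar> powr p) \<partial>sphere_measure)"
        proof (intro nn_integral_mono)
          fix x
          have "?w x \<le> ennreal M * 1" by (intro mult_mono ennreal_leI) (auto simp: indicator_def)
          then show "ennreal (\<bar>U k x - u x\<bar> powr p) * ?w x \<le> ennreal M * ennreal (\<bar>U k x - u x\<bar> powr p)"
            by (subst mult.commute) (auto intro: mult_right_mono)
        qed
        also have "\<dots> = ennreal M * A k" unfolding A_def by (rule nn_integral_cmult) measurable
        finally have 2: "?Y \<le> ennreal M * A k" .
        have "?X \<le> (\<integral>\<^sup>+x. ennreal (norm (tgrad (G k) x) powr p) * indicator \<Omega> x \<partial>sphere_measure)"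
          using hardy[OF UG M, of k] by (simp only: wsplit)
        also have "\<dots> \<le> ?s * C + ?t * ?Z"
          unfolding C_def using p l norm_triangle_sub by (intro nn_integral_powr_perturb) auto
        also have "\<dots> \<le> ?s * C + ?t * B k"
          unfolding B_def by (intro add_left_mono mult_left_mono nn_integral_mono) (auto simp: indicator_def)
        finally have 3: "?X \<le> ?s * C + ?t * B k" .
        show ?thesis
          by (rule order_trans[OF 1]) (intro add_mono mult_left_mono 2 3; simp)
      qed
      have "(\<lambda>k. ?s * (?s * C + ?t * B k) + ?t * (ennreal M * A k)) \<longlonglongrightarrow> ?s * (?s * C + ?t * 0) + ?t * (ennreal M * 0)"
        unfolding A_def B_def by (intro tendsto_add ennreal_tendsto_cmult tendsto_const U G) auto
      then have "?L \<le> ?s * (?s * C + ?t * 0) + ?t * (ennreal M * 0)"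
        by (rule LIMSEQ_le_const) (use Lk in blast)
      also have "\<dots> = ennreal ((1 - l) powr (1 - p) * (1 - l) powr (1 - p) * c)"
        using c by (simp add: ennreal_mult mult.assoc)
      finally show ?thesis .
    qed
    \<comment> \<open>The sequence starts at 1/2, since \<open>l < 1\<close> is needed
      throughout.\<close>
    define l where "l j = inverse (real (Suc (Suc j)))" for j
    have l01: "0 < l j" "l j < 1" for j by (auto simp: l_def inverse_less_1_iff)
    have l0: "l \<longlonglongrightarrow> 0"
      using LIMSEQ_Suc[OF LIMSEQ_inverse_real_of_nat] by (simp add: l_def[abs_def])
    have "(\<lambda>j. ennreal ((1 - l j) powr (1 - p) * (1 - l j) powr (1 - p) * c)) \<longlonglongrightarrow> ennreal ((1 - 0) powr (1 - p) * (1 - 0) powr (1 - p) * c)"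
      by (intro tendsto_ennrealI tendsto_intros l0) auto
    then have "?L \<le> ennreal ((1 - 0) powr (1 - p) * (1 - 0) powr (1 - p) * c)"
      by (rule LIMSEQ_le_const) (use L l01 in blast)
    then show ?thesis using c by (simp add: wsplit)
  qed
  have "(\<integral>\<^sup>+x\<in>\<Omega>. ennreal (\<bar>u x\<bar> powr p * W x) \<partial>sphere_measure)
     \<le> (\<integral>\<^sup>+x. (SUP j. ennreal (\<bar>u x\<bar> powr p * min (W x) (real j)) * indicator \<Omega> x) \<partial>sphere_measure)"
  proof (rule nn_integral_mono)
    fix x
    obtain j where "W x \<le> real j" using real_arch_simple by blast
    then show "ennreal (\<bar>u x\<bar> powr p * W x) * indicator \<Omega> x \<le> (SUP j. ennreal (\<bar>u x\<bar> powr p * min (W x) (real j)) * indicator \<Omega> x)"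
      by (intro SUP_upper2[of j]) auto
  qed
  also have "\<dots> = (SUP j. \<integral>\<^sup>+x. ennreal (\<bar>u x\<bar> powr p * min (W x) (real j)) * indicator \<Omega> x \<partial>sphere_measure)"
  proof (rule nn_integral_monotone_convergence_SUP)
    show "incseq (\<lambda>j x. ennreal (\<bar>u x\<bar> powr p * min (W x) (real j)) * indicator \<Omega> x)"
      by (auto simp: incseq_def le_fun_def intro!: mult_right_mono mult_left_mono ennreal_leI)
  qed measurable
  also have "\<dots> \<le> C" by (intro SUP_least le) simp
  finally show ?thesis by (simp add: C_def)
qed

text \<open>The support is closed and misses \<open>x\<close>, so \<open>U\<close> vanishes along a
  short piece of any great circle through \<open>x\<close>. The one in the direction of the
  tangential gradient would have derivative equal to its norm. Consequently the energy over
  \<open>\<Omega>\<close> is the energy over the sphere.\<close>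

lemma tgrad_eq_0_outside:
  fixes U :: "'a::euclidean_space \<Rightarrow> real"
  assumes C: "C1c_on_sphere \<Omega> U G" and x: "norm x = 1" "x \<notin> \<Omega>"
  shows "tgrad G x = 0"
proof (rule ccontr)
  assume v0: "tgrad G x \<noteq> 0"
  define v where "v = tgrad G x /\<^sub>R norm (tgrad G x)"
  have xx: "x \<bullet> x = 1" using x by (auto simp: dot_square_norm)
  have "tgrad G x \<bullet> x = 0" by (simp add: tgrad_def inner_diff_left xx)
  then have vx: "v \<bullet> x = 0" by (simp add: v_def)
  have vv: "v \<bullet> v = 1" using v0 by (simp add: v_def dot_square_norm)
  have Gv: "G x \<bullet> v = norm (tgrad G x)"
  proof -
    have "x \<bullet> v = 0" using vx by (simp add: inner_commute)
    then have "G x \<bullet> v = tgrad G x \<bullet> v" by (simp add: tgrad_def inner_diff_left)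
    then show ?thesis using v0 by (simp add: v_def dot_square_norm power2_eq_square)
  qed
  let ?c = "\<lambda>s. cos s *\<^sub>R x + sin s *\<^sub>R v"
  have nc: "norm (?c s) = 1" for s
  proof -
    have "?c s \<bullet> ?c s = (cos s)\<^sup>2 + (sin s)\<^sup>2"
      using xx vv vx by (simp add: inner_add_left inner_add_right inner_commute[of x v] power2_eq_square)
    then show ?thesis by (simp add: norm_eq_sqrt_inner)
  qed
  let ?K = "closure {x \<in> sphere 0 1. U x \<noteq> 0}"
  have "x \<in> - ?K" using C x by (auto simp: C1c_on_sphere_def)
  moreover have "(?c \<longlongrightarrow> ?c 0) (at 0)" by (intro tendsto_intros)
  ultimately have "\<forall>\<^sub>F s in at 0. ?c s \<in> - ?K"
    by (intro topological_tendstoD) auto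
  then have ev: "\<forall>\<^sub>F s in at 0. U (?c s) = 0"
  proof eventually_elim
    case (elim s)
    then have "?c s \<notin> ?K" by (simp only: Compl_iff not_False_eq_True)
    then have "?c s \<notin> {x \<in> sphere 0 1. U x \<noteq> 0}" by (rule contra_subsetD[OF closure_subset])
    then show ?case using nc[of s] by simp
  qed
  have Ux: "U x = 0"
  proof -
    have "x \<notin> ?K" using \<open>x \<in> - ?K\<close> by (simp only: Compl_iff not_False_eq_True)
    then have "x \<notin> {x \<in> sphere 0 1. U x \<noteq> 0}" by (rule contra_subsetD[OF closure_subset])
    then show ?thesis using x by simp
  qed
  have "(?c has_vector_derivative v) (at 0)"
    by (auto intro!: derivative_eq_intros)
  then have "((\<lambda>s. U (?c s)) has_derivative (\<lambda>t. G (?c 0) \<bullet> (t *\<^sub>R v))) (at 0)"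
    unfolding has_vector_derivative_def
    by (rule has_derivative_compose) (rule C1_has_derivative[OF C1c_on_sphere_C1[OF C]])
  then have d1: "((\<lambda>s. U (?c s)) has_real_derivative G x \<bullet> v) (at 0)"
    unfolding has_field_derivative_def
    by (rule has_derivative_eq_rhs) (simp add: fun_eq_iff)
  have "((\<lambda>s. U (?c s) / s) \<longlongrightarrow> 0) (at 0)"
    by (rule tendsto_eventually) (use ev in \<open>auto elim: eventually_mono\<close>)
  then have "((\<lambda>s. U (?c s)) has_real_derivative 0) (at 0)"
    by (simp add: has_field_derivative_iff Ux)
  then have "G x \<bullet> v = 0" using d1 DERIV_unique by blast
  then show False using Gv v0 by simp
qed

section \<open>Squared chordal distance and concentration at the pole\<close>

lemma C1_dist2: "C1 (\<lambda>x::'a::euclidean_space. (x - e) \<bullet> (x - e)) (\<lambda>x. 2 *\<^sub>R (x - e))"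
  unfolding C1_def
  by (auto intro!: derivative_eq_intros continuous_intros simp: inner_commute algebra_simps fun_eq_iff)

lemma dist2_sphere:
  fixes x e :: "'a::euclidean_space"
  assumes "norm x = 1" "norm e = 1"
  shows "(x - e) \<bullet> (x - e) = 2 - 2 * (x \<bullet> e)"
proof -
  have "x \<bullet> x = 1" "e \<bullet> e = 1" using assms by (auto simp: dot_square_norm)
  then show ?thesis by (simp add: inner_diff_left inner_diff_right inner_commute[of e x])
qed

text \<open>The kernels form an approximate point mass at \<open>e\<close>. The divergence theorem
  for the power \<open>- n / 2\<close> of \<open>Q + \<epsilon>\<close> with the constant factor 1
  turns the singular integral \<open>J\<close> into \<open>I\<close>, whose integrand carries
  additional powers of \<open>Q\<close>. On the sphere \<open>Q + \<epsilon>\<close> is at most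
  \<open>4 + 1\<close> and \<open>m\<close> is negative, so \<open>5 powr m\<close> gives a lower
  bound that does not depend on \<open>\<epsilon>\<close>.\<close>

lemma pole_mass_concentration:
  fixes e :: "'a::euclidean_space"
  assumes e: "norm e = 1" and dim: "DIM('a) \<ge> 2" and n: "n = real DIM('a) - 1"
  obtains c where "c > 0" "\<And>\<epsilon>. 0 < \<epsilon> \<Longrightarrow> \<epsilon> \<le> 1 \<Longrightarrow>
    c \<le> (\<integral>x. \<epsilon> * ((x - e) \<bullet> (x - e) + \<epsilon>) powr (- n / 2 - 1) \<partial>sphere_measure)"
proof -
  define Q where "Q x = (x - e) \<bullet> (x - e)" for x
  define m where "m = - n / 2 - 1"
  have Q0: "Q x \<ge> 0" for x by (simp add: Q_def)
  have Qc: "continuous_on UNIV Q" unfolding Q_def by (intro continuous_intros)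
  have n0: "n > 0" using dim n by simp
  have Q4: "Q x \<le> 4" if "norm x = 1" for x
    using dist2_sphere[OF that e] Cauchy_Schwarz_ineq2[of x e] that e by (simp add: Q_def abs_le_iff)
  define c where "c = (\<integral>x. Q x * Q x / 4 * 5 powr m \<partial>sphere_measure)"
  have ic: "integrable sphere_measure (\<lambda>x. Q x * Q x / 4 * 5 powr m)"
    by (intro integrable_sphere_continuous continuous_intros Qc) auto
  have "c \<noteq> 0"
  proof
    assume "c = 0"
    then have "AE x in sphere_measure. Q x * Q x / 4 * 5 powr m = 0"
      using integral_nonneg_eq_0_iff_AE[OF ic] by (simp add: c_def)
    then have "Q (- e) * Q (- e) / 4 * 5 powr m = 0"
      using e by (intro AE_zero_continuous_on_sphere[of "\<lambda>x. Q x * Q x / 4 * 5 powr m"] continuous_intros)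
        (auto intro: continuous_on_subset[OF Qc])
    then have "Q (- e) = 0" by simp
    moreover have "Q (- e) = 4 * (e \<bullet> e)" by (simp add: Q_def inner_diff_left inner_diff_right)
    ultimately show False using e by (auto simp: dot_square_norm)
  qed
  moreover have "c \<ge> 0" unfolding c_def by (intro integral_nonneg_AE) (auto simp: Q_def)
  ultimately have "c > 0" by simp
  show ?thesis
  proof (rule that[OF \<open>c > 0\<close>])
    fix \<epsilon> :: real assume \<epsilon>: "0 < \<epsilon>" "\<epsilon> \<le> 1"
    have pos: "Q x + \<epsilon> > 0" for x using Q0[of x] \<epsilon> by linarith
    have pc: "continuous_on UNIV (\<lambda>x. (Q x + \<epsilon>) powr r)" for r
      using pos by (intro continuous_intros Qc) (auto simp: less_imp_neq[symmetric])
    have f: "C1 (\<lambda>x. (Q x + \<epsilon>) powr (- n / 2)) (\<lambda>x. (- n / 2 * (Q x + \<epsilon>) powr m) *\<^sub>R (2 *\<^sub>R (x - e)))"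
      unfolding Q_def
    proof (rule C1_real_compose_range[OF C1_dist2])
      fix x
      show "((\<lambda>r. (r + \<epsilon>) powr (- n / 2)) has_real_derivative - n / 2 * ((x - e) \<bullet> (x - e) + \<epsilon>) powr m) (at ((x - e) \<bullet> (x - e)))"
        using pos[of x] unfolding Q_def m_def by (auto intro!: derivative_eq_intros)
      show "continuous_on UNIV (\<lambda>x. - n / 2 * ((x - e) \<bullet> (x - e) + \<epsilon>) powr m)"
        using pc[of m] unfolding Q_def by (rule continuous_on_mult_left)
    qed
    define I where "I x = (Q x + \<epsilon>) powr m * (Q x * Q x / 4 + \<epsilon> * Q x / 2)" for x
    define J where "J x = \<epsilon> * (Q x + \<epsilon>) powr m" for x
    have i: "integrable sphere_measure I" "integrable sphere_measure J"
      unfolding I_def J_def by (intro integrable_sphere_continuous continuous_intros Qc pc; simp)+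
    let ?t = "\<lambda>x. x \<bullet> e"
    have "(\<integral>x. n * (I x - J x) \<partial>sphere_measure) = (\<integral>x. 1 * (((- n / 2 * (Q x + \<epsilon>) powr m) *\<^sub>R (2 *\<^sub>R (x - e))) \<bullet> (e - ?t x *\<^sub>R x)) +
      (Q x + \<epsilon>) powr (- n / 2) * (0 * (1 - (?t x)\<^sup>2) - (real DIM('a) - 1) * 1 * ?t x) \<partial>sphere_measure)"
    proof (rule integral_cong_AE)
      show "(\<lambda>x. n * (I x - J x)) \<in> borel_measurable sphere_measure"
        using i by measurable
      show "(\<lambda>x. 1 * (((- n / 2 * (Q x + \<epsilon>) powr m) *\<^sub>R (2 *\<^sub>R (x - e))) \<bullet> (e - ?t x *\<^sub>R x)) +
      (Q x + \<epsilon>) powr (- n / 2) * (0 * (1 - (?t x)\<^sup>2) - (real DIM('a) - 1) * 1 * ?t x)) \<in> borel_measurable sphere_measure"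
        by (rule borel_measurable_integrable, intro integrable_sphere_continuous continuous_intros pc) 
      have eq: "n * (I x - J x) = 1 * (((- n / 2 * (Q x + \<epsilon>) powr m) *\<^sub>R (2 *\<^sub>R (x - e))) \<bullet> (e - ?t x *\<^sub>R x)) +
      (Q x + \<epsilon>) powr (- n / 2) * (0 * (1 - (?t x)\<^sup>2) - (real DIM('a) - 1) * 1 * ?t x)" if x: "norm x = 1" for x
      proof -
        have 1: "x \<bullet> x = 1" "e \<bullet> e = 1" using x e by (auto simp: dot_square_norm)
        have "Q x = 2 - 2 * ?t x" by (simp only: Q_def dist2_sphere[OF x e])
        then have t: "?t x = 1 - Q x / 2" by linarith
        have i: "(x - e) \<bullet> (e - ?t x *\<^sub>R x) = (?t x)\<^sup>2 - 1"
          using 1 by (simp add: inner_diff_left inner_diff_right inner_commute[of e x] power2_eq_square right_diff_distrib)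
        have A: "((- n / 2 * (Q x + \<epsilon>) powr m) *\<^sub>R (2 *\<^sub>R (x - e))) \<bullet> (e - ?t x *\<^sub>R x)
           = n * (Q x + \<epsilon>) powr m * (1 - (?t x)\<^sup>2)"
          unfolding inner_scaleR_left i by (simp add: algebra_simps)
        have B: "(Q x + \<epsilon>) powr (- n / 2) = (Q x + \<epsilon>) powr m * (Q x + \<epsilon>)"
          using pos[of x] powr_add[of "Q x + \<epsilon>" m 1] by (simp add: m_def)
        have "n * (I x - J x) = 1 * (n * (Q x + \<epsilon>) powr m * (1 - (1 - Q x / 2)\<^sup>2)) +
            (Q x + \<epsilon>) powr m * (Q x + \<epsilon>) * (0 * (1 - (1 - Q x / 2)\<^sup>2) - n * 1 * (1 - Q x / 2))"
          by (simp add: I_def J_def power2_eq_square field_simps)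
        then show ?thesis unfolding A B unfolding t n[symmetric] .
      qed
      show "AE x in sphere_measure. n * (I x - J x) = 1 * (((- n / 2 * (Q x + \<epsilon>) powr m) *\<^sub>R (2 *\<^sub>R (x - e))) \<bullet> (e - ?t x *\<^sub>R x)) +
      (Q x + \<epsilon>) powr (- n / 2) * (0 * (1 - (?t x)\<^sup>2) - (real DIM('a) - 1) * 1 * ?t x)"
        using AE_sphere_measure by eventually_elim (rule eq)
    qed
    also have "\<dots> = 0"
      by (rule sphere_divergence[OF e f, of "\<lambda>_. 1" "\<lambda>_. 0"]) auto
    finally have "(\<integral>x. J x \<partial>sphere_measure) = (\<integral>x. I x \<partial>sphere_measure)"
      using i n0 by simp
    moreover have "c \<le> (\<integral>x. I x \<partial>sphere_measure)"
      unfolding c_def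
    proof (rule integral_mono_AE[OF ic i(1)])
      have "Q x * Q x / 4 * 5 powr m \<le> I x" if x: "norm x = 1" for x
      proof -
        have "5 powr m \<le> (Q x + \<epsilon>) powr m"
          using pos[of x] Q4[OF x] \<epsilon> n0 by (intro powr_mono2') (auto simp: m_def)
        then have "5 powr m * (Q x * Q x / 4) \<le> (Q x + \<epsilon>) powr m * (Q x * Q x / 4 + \<epsilon> * Q x / 2)"
          using Q0[of x] \<epsilon> by (intro mult_mono) auto
        then show ?thesis by (simp add: I_def mult.commute)
      qed
      then show "AE x in sphere_measure. Q x * Q x / 4 * 5 powr m \<le> I x"
        using AE_sphere_measure by (auto elim!: eventually_mono)
    qed
    ultimately show "c \<le> (\<integral>x. \<epsilon> * ((x - e) \<bullet> (x - e) + \<epsilon>) powr (- n / 2 - 1) \<partial>sphere_measure)"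
      by (simp add: J_def Q_def m_def)
  qed
qed

text \<open>If the integrals stayed bounded, dominated convergence would contradict the previous lemma.\<close>

lemma pole_integral_unbounded:
  fixes e :: "'a::euclidean_space"
  assumes e: "norm e = 1" and dim: "DIM('a) \<ge> 2" and n: "n = real DIM('a) - 1" and r: "r > 0"
  shows "\<exists>\<epsilon>. 0 < \<epsilon> \<and> \<epsilon> \<le> 1 \<and> R < (\<integral>x. indicator {x. (x - e) \<bullet> (x - e) < r} x * ((x - e) \<bullet> (x - e) + \<epsilon>) powr (- n / 2) \<partial>sphere_measure)"
proof (rule ccontr)
  define Q where "Q x = (x - e) \<bullet> (x - e)" for x
  have Q0: "Q x \<ge> 0" for x by (simp add: Q_def)
  have [measurable]: "Q \<in> borel_measurable borel" unfolding Q_def by measurable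
  have n0: "n > 0" using dim n by simp
  assume "\<not> ?thesis"
  then have le: "(\<integral>x. indicator {x. Q x < r} x * (Q x + \<epsilon>) powr (- n / 2) \<partial>sphere_measure) \<le> R" if "0 < \<epsilon>" "\<epsilon> \<le> 1" for \<epsilon>
    using that unfolding Q_def by (meson not_le)
  obtain c where c: "c > 0" "\<And>\<epsilon>. 0 < \<epsilon> \<Longrightarrow> \<epsilon> \<le> 1 \<Longrightarrow> c \<le> (\<integral>x. \<epsilon> * (Q x + \<epsilon>) powr (- n / 2 - 1) \<partial>sphere_measure)"
    using pole_mass_concentration[OF e dim n] unfolding Q_def by blast
  define \<epsilon> where "\<epsilon> j = inverse (real (Suc j))" for j
  have \<epsilon>: "0 < \<epsilon> j" "\<epsilon> j \<le> 1" for j by (auto simp: \<epsilon>_def inverse_le_1_iff)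
  have \<epsilon>0: "\<epsilon> \<longlonglongrightarrow> 0" unfolding \<epsilon>_def by (rule LIMSEQ_inverse_real_of_nat)
  have pos: "Q x + \<epsilon> j > 0" for x j using Q0[of x] \<epsilon>[of j] by linarith
  have Qpos: "AE x in sphere_measure. Q x > 0"
  proof -
    have "AE x in sphere_measure. x \<noteq> e"
      using emeasure_sphere_measure_singleton[OF dim, of e] by (intro AE_I[of _ _ "{e}"]) auto
    then show ?thesis by eventually_elim (simp add: Q_def)
  qed
  let ?g = "\<lambda>x. indicator {x. Q x < r} x * Q x powr (- n / 2)"
  let ?f = "\<lambda>j x. indicator {x. Q x < r} x * (Q x + \<epsilon> j) powr (- n / 2)"
  have lim: "(\<lambda>j. (Q x + \<epsilon> j) powr s) \<longlonglongrightarrow> Q x powr s" if "Q x > 0" for x s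
  proof -
    have "(\<lambda>j. (Q x + \<epsilon> j) powr s) \<longlonglongrightarrow> (Q x + 0) powr s"
      using that by (intro tendsto_intros \<epsilon>0) auto
    then show ?thesis by simp
  qed
  have fint: "integrable sphere_measure (?f j)" for j
  proof (rule integrable_sphere_bounded[of _ "\<epsilon> j powr (- n / 2)"])
    fix x
    have "(Q x + \<epsilon> j) powr (- n / 2) \<le> \<epsilon> j powr (- n / 2)"
      using \<epsilon>[of j] Q0[of x] n0 by (intro powr_mono2') auto
    then show "\<bar>?f j x\<bar> \<le> \<epsilon> j powr (- n / 2)" by (auto simp: indicator_def)
  qed measurable
  have fR: "(\<integral>\<^sup>+x. ennreal (?f j x) \<partial>sphere_measure) \<le> ennreal R" for j
    using le[OF \<epsilon>] by (subst nn_integral_eq_integral[OF fint]) (auto intro!: ennreal_leI)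
  \<comment> \<open>Fatou's lemma turns the assumed uniform bound into integrability of the limit
    \<open>?g\<close>, the dominating function of the final step.\<close>
  have "(\<integral>\<^sup>+x. ennreal (?g x) \<partial>sphere_measure) \<le> (\<integral>\<^sup>+x. liminf (\<lambda>j. ennreal (?f j x)) \<partial>sphere_measure)"
  proof (rule nn_integral_mono_AE)
    show "AE x in sphere_measure. ennreal (?g x) \<le> liminf (\<lambda>j. ennreal (?f j x))"
      using Qpos
    proof eventually_elim
      case (elim x)
      have "(\<lambda>j. ennreal (?f j x)) \<longlonglongrightarrow> ennreal (?g x)"
        by (intro tendsto_ennrealI tendsto_mult tendsto_const lim elim)
      then show ?case using lim_imp_Liminf[OF sequentially_bot] by fastforce
    qed
  qed
  also have "\<dots> \<le> liminf (\<lambda>j. \<integral>\<^sup>+x. ennreal (?f j x) \<partial>sphere_measure)"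
    by (rule nn_integral_liminf) measurable
  also have "\<dots> \<le> ennreal R"
    by (rule order_trans[OF Liminf_le_Limsup Limsup_bounded]) (use fR in auto)
  finally have gR: "(\<integral>\<^sup>+x. ennreal (?g x) \<partial>sphere_measure) < \<infinity>" by (simp add: le_less_trans)
  have gint: "integrable sphere_measure ?g"
    by (rule integrableI_nonneg) (use gR in auto)
  have "(\<lambda>j. \<integral>x. \<epsilon> j * (Q x + \<epsilon> j) powr (- n / 2 - 1) \<partial>sphere_measure) \<longlonglongrightarrow> (\<integral>x. 0 \<partial>(sphere_measure :: 'a measure))"
  proof (rule integral_dominated_convergence[where w = "\<lambda>x. ?g x + r powr (- n / 2)"])
    show "integrable sphere_measure (\<lambda>x. ?g x + r powr (- n / 2))" using gint by simp
    show "AE x in sphere_measure. (\<lambda>j. \<epsilon> j * (Q x + \<epsilon> j) powr (- n / 2 - 1)) \<longlonglongrightarrow> 0"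
      using Qpos by eventually_elim (use tendsto_mult[OF \<epsilon>0 lim] in force)
    show "AE x in sphere_measure. norm (\<epsilon> j * (Q x + \<epsilon> j) powr (- n / 2 - 1)) \<le> ?g x + r powr (- n / 2)" for j
      using Qpos
    proof eventually_elim
      case (elim x)
      have "\<epsilon> j * (Q x + \<epsilon> j) powr (- n / 2 - 1) \<le> (Q x + \<epsilon> j) * (Q x + \<epsilon> j) powr (- n / 2 - 1)"
        using elim by (intro mult_right_mono) auto
      also have "\<dots> = (Q x + \<epsilon> j) powr (- n / 2)"
        using pos[of x j] powr_add[of "Q x + \<epsilon> j" 1 "- n / 2 - 1"] by simp
      also have "\<dots> \<le> Q x powr (- n / 2)"
        using \<epsilon>[of j] elim n0 by (intro powr_mono2') auto
      also have "\<dots> \<le> ?g x + r powr (- n / 2)"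
      proof (cases "Q x < r")
        case False
        then have "Q x powr (- n / 2) \<le> r powr (- n / 2)" using r n0 by (intro powr_mono2') auto
        then show ?thesis using False by simp
      qed simp
      finally show ?case using \<epsilon>[of j] by simp
    qed
  qed auto
  then have "(\<lambda>j. \<integral>x. \<epsilon> j * (Q x + \<epsilon> j) powr (- n / 2 - 1) \<partial>sphere_measure) \<longlonglongrightarrow> 0" by simp
  then have "c \<le> 0" by (rule LIMSEQ_le_const) (use c(2) \<epsilon> in blast)
  then show False using c(1) by simp
qed

section \<open>The sharp Hardy inequality\<close>

context hardy_weight
begin

lemma hardy_C1c:
  fixes e :: "'a::euclidean_space"
  assumes e: "norm e = 1" and dim: "n = real DIM('a) - 1" "DIM('a) \<ge> 2"
    and \<Omega>: "openin (top_of_set (sphere 0 1)) \<Omega>" "e \<in> \<Omega>"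
    and vol: "measure sphere_measure \<Omega> < measure sphere_measure (sphere (0::'a) 1)"
    and avol: "measure sphere_measure \<Omega> = measure sphere_measure {x. norm x = 1 \<and> cos a < x \<bullet> e}"
    and C: "C1c_on_sphere \<Omega> U G" and M: "0 \<le> M"
  shows "(\<integral>\<^sup>+x\<in>\<Omega>. ennreal (\<bar>U x\<bar> powr p * min (c\<^sub>0 * profile (x \<bullet> e) powr p) M) \<partial>sphere_measure)
    \<le> (\<integral>\<^sup>+x\<in>\<Omega>. ennreal (norm (tgrad G x) powr p) \<partial>sphere_measure)"
proof -
  have U: "C1 U G" by (rule C1c_on_sphere_C1[OF C])
  have [measurable]: "U \<in> borel_measurable borel" "G \<in> borel_measurable borel"
    using C1_measurable[OF U] by auto
  define K where "K = closure {x \<in> sphere 0 1. U x \<noteq> 0}"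
  have K: "compact K" "K \<subseteq> \<Omega>" using C by (auto simp: C1c_on_sphere_def K_def)
  have \<Omega>S: "\<Omega> \<subseteq> sphere 0 1" using openin_imp_subset[OF \<Omega>(1)] by simp
  obtain O' where O': "open O'" "\<Omega> = sphere 0 1 \<inter> O'" using \<Omega>(1) unfolding openin_open by blast
  have [measurable]: "\<Omega> \<in> sets borel" "K \<in> sets borel"
    using O' K by (auto intro: borel_closed compact_imp_closed)
  have S1 [measurable]: "sphere (0::'a) 1 \<in> sets borel" by (intro borel_closed closed_sphere)
  have small: "measure sphere_measure {x. U x \<noteq> 0} < measure sphere_measure \<Omega>"
  proof -
    have "measure sphere_measure {x. U x \<noteq> 0} \<le> measure sphere_measure K"
    proof (rule sphere.finite_measure_mono_AE)
      have "x \<in> K" if "norm x = 1" "U x \<noteq> 0" for x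
        unfolding K_def using that by (intro subsetD[OF closure_subset]) auto
      then show "AE x in sphere_measure. x \<in> {x. U x \<noteq> 0} \<longrightarrow> x \<in> K"
        using AE_sphere_measure by (auto elim!: eventually_mono)
    qed auto
    moreover have "measure sphere_measure K < measure sphere_measure \<Omega>"
    proof -
      \<comment> \<open>Otherwise \<open>\<Omega>\<close> would be both open and closed in the
        connected sphere, hence empty or everything; it contains \<open>e\<close> and has too small
        a measure. The open set \<open>O' - K\<close> then has positive measure and is missed by the
        support.\<close>
      have "\<Omega> \<noteq> K"
      proof
        assume "\<Omega> = K"
        then have "closedin (top_of_set (sphere 0 1)) \<Omega>"
          using K(1) \<Omega>S by (intro closed_subset compact_imp_closed) auto
        moreover have "connected (sphere (0::'a) 1)" using dim(2) by (intro connected_sphere) auto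
        ultimately have "\<Omega> = {} \<or> \<Omega> = sphere 0 1"
          using \<Omega>(1) unfolding connected_clopen by blast
        then show False using \<Omega>(2) vol by auto
      qed
      then obtain y where y: "y \<in> \<Omega>" "y \<notin> K" using K(2) by blast
      have "open (O' - K)" using O' K by (intro open_Diff compact_imp_closed) auto
      moreover have "y \<in> O' - K" "norm y = 1" using y O' by auto
      ultimately have "emeasure sphere_measure (O' - K) > 0"
        by (rule emeasure_sphere_measure_open_pos)
      then have pos: "measure sphere_measure (O' - K) > 0"
        by (simp add: sphere.emeasure_eq_measure)
      have "measure sphere_measure (O' - K) \<le> measure sphere_measure (\<Omega> - K)"
      proof (rule sphere.finite_measure_mono_AE)
        show "AE x in sphere_measure. x \<in> O' - K \<longrightarrow> x \<in> \<Omega> - K"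
          using AE_sphere_measure by eventually_elim (use O' in auto)
      qed auto
      also have "\<dots> = measure sphere_measure \<Omega> - measure sphere_measure K"
        using K by (intro sphere.finite_measure_Diff) auto
      finally show ?thesis using pos by linarith
    qed
    ultimately show ?thesis by linarith
  qed
  \<comment> \<open>The value \<open>M\<close> from 1 on restores the monotonicity that
    \<open>profile\<close> loses at the pole and only enlarges the weight.\<close>
  define F where "F t = (if t < 1 then min (c\<^sub>0 * profile t powr p) M else M)" for t
  have c0: "c\<^sub>0 \<ge> 0" by (simp add: c\<^sub>0_def)
  have F0: "0 \<le> F t" and FM: "F t \<le> M" for t using M c0 by (auto simp: F_def)
  have Fmono: "F s \<le> F t" if "s \<le> t" for s t
  proof (cases "t < 1")
    case True
    have "profile s powr p \<le> profile t powr p"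
      using profile_mono[OF that True] profile_pos[of s] p1 by (intro powr_mono2) auto
    then have "c\<^sub>0 * profile s powr p \<le> c\<^sub>0 * profile t powr p" using c0 by (intro mult_left_mono)
    then show ?thesis using True that by (auto simp: F_def intro!: min.mono)
  next
    case False
    then show ?thesis using FM[of s] by (simp add: F_def)
  qed
  have [measurable]: "F \<in> borel_measurable borel"
    by (rule borel_measurable_mono) (use Fmono in \<open>auto simp: mono_def\<close>)
  let ?h = "\<lambda>x. F (x \<bullet> e)"
  have hardy: "(\<integral>x. \<bar>U x\<bar> powr p * ?h x \<partial>sphere_measure) \<le> energy p G"
  proof (rule hardy_C1[OF e dim U])
    show "?h x \<le> c\<^sub>0 * \<eta> (arccos (x \<bullet> e)) powr p" if "cos a < x \<bullet> e" "x \<bullet> e < 1" for x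
    proof -
      have "profile (x \<bullet> e) powr p \<le> \<eta> (arccos (x \<bullet> e)) powr p"
        using profile_le_eta[OF that] profile_pos[of "x \<bullet> e"] p1 by (intro powr_mono2) auto
      then have "c\<^sub>0 * profile (x \<bullet> e) powr p \<le> c\<^sub>0 * \<eta> (arccos (x \<bullet> e)) powr p"
        using c0 by (intro mult_left_mono)
      then show ?thesis using that(2) by (simp add: F_def min.coboundedI1)
    qed
  qed (use small F0 FM Fmono in \<open>auto simp: avol\<close>)
  have Uc: "bounded (U ` sphere 0 1)"
    using C1_continuous(1)[OF U] by (intro compact_imp_bounded compact_continuous_image) auto
  then obtain B where "\<forall>y\<in>U ` sphere 0 1. norm y \<le> B" unfolding bounded_iff by blast
  then have B: "\<bar>U x\<bar> \<le> B" if "norm x = 1" for x using that by auto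
  have int: "integrable sphere_measure (\<lambda>x. \<bar>U x\<bar> powr p * ?h x)"
  proof (rule integrable_sphere_bounded[of _ "B powr p * M"])
    show "\<bar>\<bar>U x\<bar> powr p * ?h x\<bar> \<le> B powr p * M" if "norm x = 1" for x
    proof -
      have "\<bar>U x\<bar> powr p \<le> B powr p" using B[OF that] p1 by (intro powr_mono2) auto
      then show ?thesis using F0[of "x \<bullet> e"] FM[of "x \<bullet> e"] by (auto simp: abs_mult intro!: mult_mono)
    qed
  qed measurable
  have iE: "integrable sphere_measure (\<lambda>x. norm (tgrad G x) powr p)"
    using C1_continuous[OF U] p1 by (intro integrable_energy) auto
  have "(\<integral>\<^sup>+x\<in>\<Omega>. ennreal (\<bar>U x\<bar> powr p * min (c\<^sub>0 * profile (x \<bullet> e) powr p) M) \<partial>sphere_measure)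
      \<le> (\<integral>\<^sup>+x. ennreal (\<bar>U x\<bar> powr p * ?h x) \<partial>sphere_measure)"
  proof (rule nn_integral_mono)
    fix x
    have "min (c\<^sub>0 * profile (x \<bullet> e) powr p) M \<le> ?h x" by (simp add: F_def)
    then show "ennreal (\<bar>U x\<bar> powr p * min (c\<^sub>0 * profile (x \<bullet> e) powr p) M) * indicator \<Omega> x \<le> ennreal (\<bar>U x\<bar> powr p * ?h x)"
      by (auto simp: indicator_def intro!: ennreal_leI mult_left_mono)
  qed
  also have "\<dots> = ennreal (\<integral>x. \<bar>U x\<bar> powr p * ?h x \<partial>sphere_measure)"
    using F0 by (intro nn_integral_eq_integral[OF int]) auto
  also have "\<dots> \<le> ennreal (energy p G)" by (rule ennreal_leI[OF hardy])
  also have "\<dots> = (\<integral>\<^sup>+x. ennreal (norm (tgrad G x) powr p) \<partial>sphere_measure)"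
    unfolding energy_def by (rule nn_integral_eq_integral[OF iE, symmetric]) auto
  also have "\<dots> = (\<integral>\<^sup>+x\<in>\<Omega>. ennreal (norm (tgrad G x) powr p) \<partial>sphere_measure)"
  proof (rule nn_integral_cong_AE)
    have "ennreal (norm (tgrad G x) powr p) = ennreal (norm (tgrad G x) powr p) * indicator \<Omega> x" if "norm x = 1" for x
      using tgrad_eq_0_outside[OF C that] by (cases "x \<in> \<Omega>") auto
    then show "AE x in sphere_measure. ennreal (norm (tgrad G x) powr p) = ennreal (norm (tgrad G x) powr p) * indicator \<Omega> x"
      using AE_sphere_measure by (auto elim!: eventually_mono)
  qed
  finally show ?thesis .
qed

text \<open>Translates \<open>eta_asymptotic\<close> from the angle to the chord:
  \<open>q = 2 - 2 * t\<close> exceeds \<open>sin^2 = 1 - t^2\<close> by the square of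
  \<open>1 - t\<close>, so the sine is at most the chordal distance. The radius
  \<open>2 - 2 * cos d\<close> is the squared chord of the angle \<open>d\<close>.\<close>

lemma profile_near_pole:
  fixes e :: "'a::euclidean_space"
  assumes e: "norm e = 1" and c: "c < 1"
  obtains r where "r > 0"
    "\<And>x. norm x = 1 \<Longrightarrow> 0 < (x - e) \<bullet> (x - e) \<Longrightarrow> (x - e) \<bullet> (x - e) < r \<Longrightarrow> c * (\<beta> - 1) * ((x - e) \<bullet> (x - e)) powr (- 1 / 2) \<le> profile (x \<bullet> e)"
proof -
  obtain d where d: "d > 0" "d \<le> \<tau>" "\<And>t. 0 < t \<Longrightarrow> t < d \<Longrightarrow> c * (\<beta> - 1) / sin t \<le> \<eta> t"
    using eta_asymptotic[OF c] by blast
  have dpi: "d < pi" using d(2) eta_T(2) api by linarith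
  show ?thesis
  proof (rule that[of "2 - 2 * cos d"])
    have "cos d < cos 0" using d dpi by (intro cos_monotone_0_pi) auto
    then show "2 - 2 * cos d > 0" by simp
    fix x assume x: "norm x = 1" "0 < (x - e) \<bullet> (x - e)" "(x - e) \<bullet> (x - e) < 2 - 2 * cos d"
    define t where "t = x \<bullet> e"
    define q where "q = (x - e) \<bullet> (x - e)"
    have q: "q = 2 - 2 * t" unfolding q_def t_def by (rule dist2_sphere[OF x(1) e])
    have t: "cos d < t" "t < 1" using x(2,3) unfolding q_def[symmetric] q by auto
    have cc: "cos \<tau> \<le> cos d" using d eta_T(2) api by (intro cos_monotone_0_pi_le) auto
    have "cos a < t" using cos_a_less_cos_\<tau> cc t by linarith
    note r = arccos_range[OF this t(2)]
    have "arccos t < arccos (cos d)" using t r(6) by (intro arccos_less_arccos) auto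
    then have "arccos t < d" using d dpi by (simp add: arccos_cos)
    then have 1: "c * (\<beta> - 1) / sqrt (1 - t\<^sup>2) \<le> \<eta> (arccos t)" using d(3)[OF r(1)] r(4) by simp
    have pe: "profile t = \<eta> (arccos t)" using cc t by (simp add: profile_def)
    have "c * (\<beta> - 1) * q powr (- 1 / 2) \<le> profile t"
    proof (cases "c \<le> 0")
      case True
      have "c * (\<beta> - 1) * q powr (- 1 / 2) \<le> 0" using True beta(1) by (simp add: mult_nonpos_nonneg)
      then show ?thesis using profile_pos[of t] by linarith
    next
      case False
      have "1 - t\<^sup>2 \<le> q"
      proof -
        have "q - (1 - t\<^sup>2) = (1 - t)\<^sup>2" by (simp add: q power2_eq_square algebra_simps)
        then show ?thesis using zero_le_power2[of "1 - t"] by linarith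
      qed
      then have "1 / sqrt q \<le> 1 / sqrt (1 - t\<^sup>2)" using r(3) by (intro divide_left_mono) auto
      moreover have "q powr (- 1 / 2) = 1 / sqrt q"
      proof -
        have "- 1 / 2 = - (1 / 2 :: real)" by simp
        then have "q powr (- 1 / 2) = inverse (q powr (1 / 2))" by (simp only: powr_minus)
        then show ?thesis using x(2) unfolding q_def[symmetric] by (simp add: powr_half_sqrt inverse_eq_divide)
      qed
      ultimately have "c * (\<beta> - 1) * q powr (- 1 / 2) \<le> c * (\<beta> - 1) * (1 / sqrt (1 - t\<^sup>2))"
        using False beta(1) by (intro mult_left_mono) auto
      then show ?thesis using 1 pe by simp
    qed
    then show "c * (\<beta> - 1) * ((x - e) \<bullet> (x - e)) powr (- 1 / 2) \<le> profile (x \<bullet> e)" by (simp add: q_def t_def)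
  qed
qed

text \<open>Near the pole the test functions \<open>(|x - e|\<^sup>2 + \<epsilon>)\<close> to the power \<open>-\<gamma>/2\<close>, with the critical \<open>\<gamma> = (n - p) / p\<close>,
  have pointwise almost the critical quotient, and the integrals diverge as \<open>\<epsilon>\<close> tends to 0; the
  cut-off only contributes a bounded error \<open>D\<close>.\<close>

lemma test_functions:
  fixes e :: "'a::euclidean_space"
  assumes e: "norm e = 1" and r: "r > 0"
  obtains D where "\<And>\<epsilon>. 0 < \<epsilon> \<Longrightarrow> \<epsilon> \<le> 1 \<Longrightarrow> \<exists>U G. C1 U G \<and>
     (\<forall>x. 2 * r \<le> (x - e) \<bullet> (x - e) \<longrightarrow> U x = 0) \<and>
     (\<forall>x. (x - e) \<bullet> (x - e) < r \<longrightarrow> U x = ((x - e) \<bullet> (x - e) + \<epsilon>) powr (- ((n - p) / p) / 2)) \<and>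
     (\<forall>x. norm x = 1 \<longrightarrow> norm (tgrad G x) powr p \<le>
        ((n - p) / p) powr p * (indicator {x. (x - e) \<bullet> (x - e) < r} x * ((x - e) \<bullet> (x - e) + \<epsilon>) powr (- n / 2)) + D)"
proof -
  define g where "g = (n - p) / p"
  have g: "g > 0" "(g + 1) * p = n" using p1 pn by (auto simp: g_def field_simps)
  \<comment> \<open>The bound for \<open>F'\<close> beyond \<open>r\<close> by the product rule,
    \<open>smoothstep'\<close> being at most 4. The factor 4 in \<open>4 * b\<close> is the 2 from
    the derivative of the squared distance times the diameter 2 of the sphere.\<close>
  define b where "b = g / 2 * r powr (- g / 2 - 1) + r powr (- g / 2) * (4 / r)"
  have b0: "b \<ge> 0" using g r by (simp add: b_def)
  show ?thesis
  proof (rule that[of "(4 * b) powr p"])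
    fix \<epsilon> :: real assume \<epsilon>: "0 < \<epsilon>" "\<epsilon> \<le> 1"
    define Q where "Q x = (x - e) \<bullet> (x - e)" for x
    define X where "X s = 1 - smoothstep ((s - r) / r)" for s
    define X' where "X' s = - smoothstep' ((s - r) / r) / r" for s
    have dX: "(X has_real_derivative X' s) (at s)" for s
    proof -
      have "((\<lambda>s. smoothstep ((s - r) / r)) has_real_derivative smoothstep' ((s - r) / r) * (1 / r)) (at s)"
        using r by (intro DERIV_chain2[OF smoothstep_has_real_derivative]) (auto intro!: derivative_eq_intros)
      then have "((\<lambda>s. 1 - smoothstep ((s - r) / r)) has_real_derivative 0 - smoothstep' ((s - r) / r) * (1 / r)) (at s)"
        by (intro DERIV_diff DERIV_const)
      then show ?thesis by (simp add: X_def[abs_def] X'_def)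
    qed
    have cX': "continuous_on UNIV X'"
    proof -
      have "continuous_on UNIV (\<lambda>s. (s - r) / r)" using r by (auto intro!: continuous_intros)
      then have "continuous_on UNIV (\<lambda>s. smoothstep' ((s - r) / r))"
        by (rule continuous_on_compose2[OF continuous_smoothstep']) simp
      then show ?thesis unfolding X'_def[abs_def] using r by (auto intro!: continuous_intros)
    qed
    have cX: "continuous_on UNIV X" by (rule continuous_at_imp_continuous_on) (auto intro!: DERIV_isCont[OF dX])
    define F where "F s = (s + \<epsilon>) powr (- g / 2) * X s" for s
    define F' where "F' s = (- g / 2) * (s + \<epsilon>) powr (- g / 2 - 1) * X s + X' s * (s + \<epsilon>) powr (- g / 2)" for s
    have Q0: "Q x \<ge> 0" and Qe: "Q x + \<epsilon> > 0" for x using \<epsilon> by (auto simp: Q_def add_nonneg_pos)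
    have cQ: "continuous_on UNIV Q" unfolding Q_def[abs_def] by (intro continuous_intros)
    have CQ: "C1 Q (\<lambda>x. 2 *\<^sub>R (x - e))" unfolding Q_def[abs_def] by (rule C1_dist2)
    have C: "C1 (\<lambda>x. F (Q x)) (\<lambda>x. F' (Q x) *\<^sub>R (2 *\<^sub>R (x - e)))"
    proof (rule C1_real_compose_range[OF CQ])
      fix x
      have "((\<lambda>s. (s + \<epsilon>) powr (- g / 2)) has_real_derivative (- g / 2) * (Q x + \<epsilon>) powr (- g / 2 - 1)) (at (Q x))"
        using Qe[of x] by (auto intro!: derivative_eq_intros)
      from DERIV_mult[OF this dX] show "(F has_real_derivative F' (Q x)) (at (Q x))"
        by (simp only: F_def[abs_def] F'_def)
      have pc: "continuous_on UNIV (\<lambda>x. (Q x + \<epsilon>) powr s)" for s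
        using Qe by (intro continuous_intros cQ) (auto simp: less_imp_neq[symmetric])
      show "continuous_on UNIV (\<lambda>x. F' (Q x))"
        unfolding F'_def
        by (intro continuous_on_add continuous_on_mult continuous_on_const pc
            continuous_on_compose2[OF cX cQ] continuous_on_compose2[OF cX' cQ]) auto
    qed
    have Xr: "X s = 1" "X' s = 0" if "s < r" for s
      using that r by (auto simp: X_def X'_def smoothstep_eq divide_nonpos_pos)
    let ?G = "\<lambda>x. F' (Q x) *\<^sub>R (2 *\<^sub>R (x - e))"
    \<comment> \<open>The tangential part of \<open>x - e\<close> has length
      \<open>sin \<theta>\<close>, at most the chordal distance.\<close>
    have tg: "norm (tgrad ?G x) \<le> 2 * \<bar>F' (Q x)\<bar> * sqrt (Q x)" if x: "norm x = 1" for x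
    proof -
      have xx: "x \<bullet> x = 1" using x by (auto simp: dot_square_norm)
      have "tgrad ?G x = (- 2 * F' (Q x)) *\<^sub>R (e - (x \<bullet> e) *\<^sub>R x)"
        by (simp add: tgrad_def inner_diff_left xx inner_commute[of e x] algebra_simps)
      then have "norm (tgrad ?G x) = 2 * \<bar>F' (Q x)\<bar> * sqrt (1 - (x \<bullet> e)\<^sup>2)"
        using inner_radial_field(2)[OF x e] by (simp add: abs_mult)
      also have "sqrt (1 - (x \<bullet> e)\<^sup>2) \<le> sqrt (Q x)"
      proof -
        have "Q x = 2 - 2 * (x \<bullet> e)" unfolding Q_def by (rule dist2_sphere[OF x e])
        then have "Q x - (1 - (x \<bullet> e)\<^sup>2) = (1 - x \<bullet> e)\<^sup>2" by (simp add: power2_eq_square algebra_simps)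
        then have "1 - (x \<bullet> e)\<^sup>2 \<le> Q x" using zero_le_power2[of "1 - x \<bullet> e"] by linarith
        then show ?thesis by (rule real_sqrt_le_mono)
      qed
      finally show ?thesis by (simp add: mult_left_mono)
    qed
    have near: "norm (tgrad ?G x) powr p \<le> g powr p * (Q x + \<epsilon>) powr (- n / 2)" if x: "norm x = 1" "Q x < r" for x
    proof -
      have eq: "2 * \<bar>F' (Q x)\<bar> = g * (Q x + \<epsilon>) powr (- g / 2 - 1)"
        using Xr[OF x(2)] g by (simp add: F'_def abs_mult)
      have "norm (tgrad ?G x) \<le> g * (Q x + \<epsilon>) powr (- g / 2 - 1) * sqrt (Q x)"
        using tg[OF x(1)] by (simp only: eq)
      also have "\<dots> \<le> g * (Q x + \<epsilon>) powr (- g / 2 - 1) * (Q x + \<epsilon>) powr (1 / 2)"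
        using g \<epsilon> Q0[of x] by (intro mult_left_mono) (auto simp: powr_half_sqrt)
      also have "\<dots> = g * (Q x + \<epsilon>) powr (- g / 2 - 1 + 1 / 2)" by (simp only: powr_add mult.assoc)
      finally have "norm (tgrad ?G x) powr p \<le> (g * (Q x + \<epsilon>) powr (- g / 2 - 1 + 1 / 2)) powr p"
        using p1 by (intro powr_mono2) auto
      also have "\<dots> = g powr p * (Q x + \<epsilon>) powr ((- g / 2 - 1 + 1 / 2) * p)"
        by (simp only: powr_mult powr_powr)
      also have "(- g / 2 - 1 + 1 / 2) * p = - n / 2" using g(2) by (simp add: algebra_simps)
      finally show ?thesis .
    qed
    have far: "norm (tgrad ?G x) powr p \<le> (4 * b) powr p" if x: "norm x = 1" "r \<le> Q x" for x
    proof -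
      have s: "0 \<le> smoothstep s" "smoothstep s \<le> 1" "0 \<le> smoothstep' s" for s using smoothstep_bounds by auto
      have s4: "smoothstep' s \<le> 4" for s
      proof (cases "s \<le> 1")
        case True
        have "max 0 (1 - (max 0 s)\<^sup>2) * max 0 s \<le> 1 * 1" using True by (intro mult_mono) auto
        then show ?thesis by (simp add: smoothstep'_def)
      qed (simp add: smoothstep_eq)
      have pr: "(Q x + \<epsilon>) powr s \<le> r powr s" if "s \<le> 0" for s
        using x r \<epsilon> that by (intro powr_mono2') auto
      have pr1: "(Q x + \<epsilon>) powr (- g / 2 - 1) \<le> r powr (- g / 2 - 1)"
        and pr2: "(Q x + \<epsilon>) powr (- g / 2) \<le> r powr (- g / 2)"
        using g by (intro pr; simp)+
      have "\<bar>F' (Q x)\<bar> \<le> \<bar>(- g / 2) * (Q x + \<epsilon>) powr (- g / 2 - 1) * X (Q x)\<bar> + \<bar>X' (Q x) * (Q x + \<epsilon>) powr (- g / 2)\<bar>"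
        unfolding F'_def by (rule abs_triangle_ineq)
      also have "\<bar>(- g / 2) * (Q x + \<epsilon>) powr (- g / 2 - 1) * X (Q x)\<bar> \<le> g / 2 * r powr (- g / 2 - 1) * 1"
        unfolding abs_mult using g s pr1 by (intro mult_mono) (auto simp: X_def)
      also have "\<bar>X' (Q x) * (Q x + \<epsilon>) powr (- g / 2)\<bar> \<le> 4 / r * r powr (- g / 2)"
        unfolding abs_mult using g s4 s r pr2 by (intro mult_mono) (auto simp: X'_def divide_right_mono)
      finally have F'b: "\<bar>F' (Q x)\<bar> \<le> b" by (simp add: b_def mult.commute)
      have "Q x \<le> 4"
        using dist2_sphere[OF x(1) e] Cauchy_Schwarz_ineq2[of x e] x e by (simp add: Q_def abs_le_iff)
      then have "sqrt (Q x) \<le> sqrt 4" by (rule real_sqrt_le_mono)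
      then have "sqrt (Q x) \<le> 2" by simp
      then have "2 * \<bar>F' (Q x)\<bar> * sqrt (Q x) \<le> 2 * b * 2" using F'b b0 Q0[of x] by (intro mult_mono) auto
      then have "norm (tgrad ?G x) \<le> 4 * b" using tg[OF x(1)] by linarith
      then show ?thesis using p1 by (intro powr_mono2) auto
    qed
    have "norm (tgrad ?G x) powr p \<le> g powr p * (indicator {x. Q x < r} x * (Q x + \<epsilon>) powr (- n / 2)) + (4 * b) powr p"
      if x: "norm x = 1" for x
      using near[OF x] far[OF x] by (cases "Q x < r") (auto simp: add_increasing2)
    moreover have "F (Q x) = 0" if "2 * r \<le> Q x" for x
    proof -
      have "1 \<le> (Q x - r) / r" using that r by simp
      then show ?thesis by (simp add: F_def X_def smoothstep_eq)
    qed
    moreover have "F (Q x) = (Q x + \<epsilon>) powr (- g / 2)" if "Q x < r" for x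
      using Xr[OF that] by (simp add: F_def)
    ultimately show "\<exists>U G. C1 U G \<and>
     (\<forall>x. 2 * r \<le> (x - e) \<bullet> (x - e) \<longrightarrow> U x = 0) \<and>
     (\<forall>x. (x - e) \<bullet> (x - e) < r \<longrightarrow> U x = ((x - e) \<bullet> (x - e) + \<epsilon>) powr (- ((n - p) / p) / 2)) \<and>
     (\<forall>x. norm x = 1 \<longrightarrow> norm (tgrad G x) powr p \<le>
        ((n - p) / p) powr p * (indicator {x. (x - e) \<bullet> (x - e) < r} x * ((x - e) \<bullet> (x - e) + \<epsilon>) powr (- n / 2)) + (4 * b) powr p)"
      using C unfolding Q_def g_def by (intro exI conjI) (assumption | blast)+
  qed
qed

text \<open>The excess of \<open>C\<close> over the constant is spent on a factor
  \<open>c < 1\<close> with \<open>g powr p < C * c powr p\<close>. Both sides are then multiples of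
  the same integral \<open>A\<close> up to the bounded error \<open>D\<close>, and \<open>A\<close>
  can be made arbitrarily large.\<close>

lemma hardy_constant_sharp:
  fixes e :: "'a::euclidean_space"
  assumes e: "norm e = 1" and dim: "n = real DIM('a) - 1" "DIM('a) \<ge> 2"
    and \<Omega>: "openin (top_of_set (sphere 0 1)) \<Omega>" "e \<in> \<Omega>"
    and C: "C > ((n - p) / p) powr p"
  shows "\<exists>u g. W1p0 p \<Omega> u g \<and> (\<integral>\<^sup>+x\<in>\<Omega>. ennreal (norm (g x) powr p) \<partial>sphere_measure)
     < ennreal C * (\<integral>\<^sup>+x\<in>\<Omega>. ennreal (\<bar>u x\<bar> powr p * ((p - 1) / (n - p) * profile (x \<bullet> e)) powr p) \<partial>sphere_measure)"
proof -
  define g where "g = (n - p) / p"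
  have g: "g > 0" "(g + 1) * p = n" using p1 pn by (auto simp: g_def field_simps)
  define Q where "Q x = (x - e) \<bullet> (x - e)" for x
  have [measurable]: "Q \<in> borel_measurable borel" unfolding Q_def by measurable
  have Q0: "Q x \<ge> 0" for x by (simp add: Q_def)
  have C0: "C > 0" using C by (rule le_less_trans[rotated]) simp
  obtain c where c: "0 < c" "c < 1" "g powr p < C * c powr p"
  proof -
    \<comment> \<open>The solution of \<open>C * d powr p = g powr p\<close>; any \<open>c\<close>
      strictly between \<open>d\<close> and 1 serves.\<close>
    define d where "d = (g powr p / C) powr (1 / p)"
    have "g powr p / C < 1" using C C0 by (simp add: g_def)
    then have "d < 1 powr (1 / p)" unfolding d_def using p1 C0 g by (intro powr_less_mono2) auto
    then have d: "0 < d" "d < 1" using g C0 by (auto simp: d_def)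
    define c where "c = (d + 1) / 2"
    have "d powr p < c powr p" using d p1 by (intro powr_less_mono2) (auto simp: c_def)
    moreover have "d powr p = g powr p / C" using p1 g C0 by (simp add: d_def powr_powr)
    ultimately have "g powr p < C * c powr p" using C0 by (simp add: field_simps)
    then show ?thesis by (intro that[of c]) (use d in \<open>auto simp: c_def\<close>)
  qed
  obtain r0 where r0: "r0 > 0" "\<And>x. norm x = 1 \<Longrightarrow> 0 < Q x \<Longrightarrow> Q x < r0 \<Longrightarrow> c * (\<beta> - 1) * Q x powr (- 1 / 2) \<le> profile (x \<bullet> e)"
    using profile_near_pole[OF e c(2)] unfolding Q_def by blast
  obtain O' where O': "open O'" "\<Omega> = sphere 0 1 \<inter> O'" using \<Omega>(1) unfolding openin_open by blast
  obtain \<delta> where \<delta>: "\<delta> > 0" "ball e \<delta> \<subseteq> O'" using O' \<Omega>(2) by (meson IntE open_contains_ball)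
  have [measurable]: "\<Omega> \<in> sets borel" unfolding O'(2) by (intro sets.Int borel_closed borel_open O' closed_sphere)
  \<comment> \<open>The test function lives where \<open>Q \<le> 2 * r\<close>, and
    \<open>2 * r \<le> \<delta>^2 / 2\<close> keeps this inside the ball of radius
    \<open>\<delta>\<close>.\<close>
  define r where "r = min r0 (\<delta>\<^sup>2 / 4)"
  have r: "r > 0" "r \<le> r0" "r \<le> \<delta>\<^sup>2 / 4" using r0 \<delta> by (auto simp: r_def)
  have inO: "x \<in> \<Omega>" if "norm x = 1" "Q x \<le> 2 * r" for x
  proof -
    have "(norm (x - e))\<^sup>2 < \<delta>\<^sup>2" using that(2) r(3) \<delta>(1) by (simp add: Q_def dot_square_norm) (smt (verit) zero_less_power)
    then have "norm (x - e) < \<delta>" using \<delta>(1) by (simp add: power_less_imp_less_base)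
    then show ?thesis using that(1) \<delta>(2) O'(2) by (auto simp: dist_norm norm_minus_commute)
  qed
  obtain D where D: "\<And>\<epsilon>. 0 < \<epsilon> \<Longrightarrow> \<epsilon> \<le> 1 \<Longrightarrow> \<exists>U G. C1 U G \<and> (\<forall>x. 2 * r \<le> Q x \<longrightarrow> U x = 0) \<and>
     (\<forall>x. Q x < r \<longrightarrow> U x = (Q x + \<epsilon>) powr (- g / 2)) \<and>
     (\<forall>x. norm x = 1 \<longrightarrow> norm (tgrad G x) powr p \<le> g powr p * (indicator {x. Q x < r} x * (Q x + \<epsilon>) powr (- n / 2)) + D)"
    using test_functions[OF e r(1)] unfolding Q_def g_def by blast
  define S where "S = measure (sphere_measure :: 'a measure) UNIV"
  \<comment> \<open>Once \<open>A\<close> exceeds this threshold,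
    \<open>(C * c powr p - g powr p) * A\<close> outweighs the error \<open>D\<close> integrated
    over the sphere.\<close>
  define R where "R = \<bar>D\<bar> * S / (C * c powr p - g powr p)"
  obtain \<epsilon> where \<epsilon>: "0 < \<epsilon>" "\<epsilon> \<le> 1" "R < (\<integral>x. indicator {x. Q x < r} x * (Q x + \<epsilon>) powr (- n / 2) \<partial>sphere_measure)"
    using pole_integral_unbounded[OF e dim(2,1) r(1), of R] unfolding Q_def by blast
  obtain U G where U: "C1 U G" "\<And>x. 2 * r \<le> Q x \<Longrightarrow> U x = 0" "\<And>x. Q x < r \<Longrightarrow> U x = (Q x + \<epsilon>) powr (- g / 2)"
    "\<And>x. norm x = 1 \<Longrightarrow> norm (tgrad G x) powr p \<le> g powr p * (indicator {x. Q x < r} x * (Q x + \<epsilon>) powr (- n / 2)) + D"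
    using D[OF \<epsilon>(1,2)] by blast
  have [measurable]: "U \<in> borel_measurable borel" "G \<in> borel_measurable borel"
    using C1_measurable[OF U(1)] by auto
  let ?f = "\<lambda>x. indicator {x. Q x < r} x * (Q x + \<epsilon>) powr (- n / 2)"
  define A where "A = (\<integral>x. ?f x \<partial>sphere_measure)"
  have n0: "n > 0" using p1 pn by simp
  have fint: "integrable sphere_measure ?f"
  proof (rule integrable_sphere_bounded[of _ "\<epsilon> powr (- n / 2)"])
    fix x
    have "(Q x + \<epsilon>) powr (- n / 2) \<le> \<epsilon> powr (- n / 2)"
      using \<epsilon> Q0[of x] n0 by (intro powr_mono2') auto
    then show "\<bar>?f x\<bar> \<le> \<epsilon> powr (- n / 2)" by (auto simp: indicator_def)
  qed measurable
  have iE: "integrable sphere_measure (\<lambda>x. norm (tgrad G x) powr p)"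
    using C1_continuous[OF U(1)] p1 by (intro integrable_energy) auto
  have C1c: "C1c_on_sphere \<Omega> U G"
  proof -
    have "closed {x \<in> sphere 0 1. Q x \<le> 2 * r}"
    proof -
      have "closed {x. Q x \<le> 2 * r}" unfolding Q_def by (intro closed_Collect_le continuous_intros)
      then have "closed (sphere 0 1 \<inter> {x. Q x \<le> 2 * r})" by (intro closed_Int closed_sphere)
      then show ?thesis by (simp add: Int_def)
    qed
    moreover have "{x \<in> sphere 0 1. U x \<noteq> 0} \<subseteq> {x \<in> sphere 0 1. Q x \<le> 2 * r}" using U(2) by force
    ultimately have cl: "closure {x \<in> sphere 0 1. U x \<noteq> 0} \<subseteq> {x \<in> sphere 0 1. Q x \<le> 2 * r}"
      by (rule closure_minimal[rotated])
    have "bounded {x \<in> sphere (0::'a) 1. U x \<noteq> 0}" by (rule bounded_subset[of "sphere 0 1"]) auto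
    then have "compact (closure {x \<in> sphere 0 1. U x \<noteq> 0})" by (simp add: compact_eq_bounded_closed bounded_closure)
    moreover have "closure {x \<in> sphere 0 1. U x \<noteq> 0} \<subseteq> \<Omega>" using cl inO by auto
    ultimately show ?thesis using U(1) by (auto simp: C1c_on_sphere_def C1_def)
  qed
  \<comment> \<open>The constant sequence \<open>U\<close> is its own approximation.\<close>
  have W: "W1p0 p \<Omega> U (tgrad G)"
    unfolding W1p0_def
  proof (intro conjI exI allI)
    have "continuous_on UNIV (\<lambda>x. \<bar>U x\<bar> powr p)"
      using C1_continuous[OF U(1)] p1 by (intro continuous_on_powr' continuous_intros) auto
    then have "integrable sphere_measure (\<lambda>x. \<bar>U x\<bar> powr p)" by (rule integrable_sphere_continuous)
    then show "(\<integral>\<^sup>+ x. ennreal (\<bar>U x\<bar> powr p) \<partial>sphere_measure) < \<infinity>"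
      by (subst nn_integral_eq_integral) auto
    show "(\<integral>\<^sup>+ x. ennreal (norm (tgrad G x) powr p) \<partial>sphere_measure) < \<infinity>"
      using iE by (subst nn_integral_eq_integral) auto
    show "C1c_on_sphere \<Omega> ((\<lambda>_. U) k) ((\<lambda>_. G) k)" for k :: nat using C1c by simp
  qed auto
  have S0: "S \<ge> 0" by (simp add: S_def)
  have "(\<integral>\<^sup>+x\<in>\<Omega>. ennreal (norm (tgrad G x) powr p) \<partial>sphere_measure) \<le> (\<integral>\<^sup>+x. ennreal (norm (tgrad G x) powr p) \<partial>sphere_measure)"
    by (intro nn_integral_mono) (auto simp: indicator_def)
  also have "\<dots> = ennreal (\<integral>x. norm (tgrad G x) powr p \<partial>sphere_measure)"
    by (rule nn_integral_eq_integral[OF iE]) auto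
  finally have upper: "(\<integral>\<^sup>+x\<in>\<Omega>. ennreal (norm (tgrad G x) powr p) \<partial>sphere_measure)
    \<le> ennreal (\<integral>x. norm (tgrad G x) powr p \<partial>sphere_measure)" .
  have "(\<integral>x. norm (tgrad G x) powr p \<partial>sphere_measure) \<le> (\<integral>x. g powr p * ?f x + D \<partial>sphere_measure)"
  proof (rule integral_mono_AE[OF iE])
    show "integrable sphere_measure (\<lambda>x. g powr p * ?f x + D)" using fint by simp
    show "AE x in sphere_measure. norm (tgrad G x) powr p \<le> g powr p * ?f x + D"
      using AE_sphere_measure by eventually_elim (rule U(4))
  qed
  also have "\<dots> = g powr p * A + D * S" using fint by (simp add: A_def S_def)
  also have "\<dots> < C * c powr p * A"
  proof -
    have "\<bar>D\<bar> * S < (C * c powr p - g powr p) * A"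
      using \<epsilon>(3) c(3) by (simp add: R_def A_def pos_divide_less_eq mult.commute)
    moreover have "D * S \<le> \<bar>D\<bar> * S" using S0 by (intro mult_right_mono) auto
    ultimately show ?thesis by (simp add: algebra_simps)
  qed
  finally have lt: "(\<integral>x. norm (tgrad G x) powr p \<partial>sphere_measure) < C * c powr p * A" .
  have "0 \<le> (\<integral>x. norm (tgrad G x) powr p \<partial>sphere_measure)" by simp
  then have "0 < C * c powr p * A" using lt by linarith
  from upper ennreal_lessI[OF this lt]
  have "(\<integral>\<^sup>+x\<in>\<Omega>. ennreal (norm (tgrad G x) powr p) \<partial>sphere_measure) < ennreal (C * c powr p * A)"
    by (rule le_less_trans)
  also have "\<dots> = ennreal C * (\<integral>\<^sup>+x. ennreal (c powr p * ?f x) \<partial>sphere_measure)"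
  proof -
    have "(\<integral>\<^sup>+x. ennreal (c powr p * ?f x) \<partial>sphere_measure) = ennreal (c powr p * A)"
      using fint by (subst nn_integral_eq_integral) (auto simp: A_def)
    then show ?thesis using C0 by (simp add: ennreal_mult' mult.assoc)
  qed
  also have "\<dots> \<le> ennreal C * (\<integral>\<^sup>+x\<in>\<Omega>. ennreal (\<bar>U x\<bar> powr p * ((p - 1) / (n - p) * profile (x \<bullet> e)) powr p) \<partial>sphere_measure)"
  proof (intro mult_left_mono nn_integral_mono_AE)
    have ae: "AE x in sphere_measure. x \<noteq> e"
      using emeasure_sphere_measure_singleton[OF dim(2), of e] by (intro AE_I[of _ _ "{e}"]) auto
    show "AE x in sphere_measure. ennreal (c powr p * ?f x) \<le> ennreal (\<bar>U x\<bar> powr p * ((p - 1) / (n - p) * profile (x \<bullet> e)) powr p) * indicator \<Omega> x"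
      using ae AE_sphere_measure
    proof eventually_elim
      case (elim x)
      show ?case
      proof (cases "Q x < r")
        case True
        have Qx: "Q x > 0" using elim(1) by (simp add: Q_def)
        have x\<Omega>: "x \<in> \<Omega>" using inO[of x] elim(2) True r(1) by simp
        have "c * (\<beta> - 1) * Q x powr (- 1 / 2) \<le> profile (x \<bullet> e)"
          using r0(2)[OF elim(2) Qx] True r(2) by simp
        then have "(p - 1) / (n - p) * (c * (\<beta> - 1) * Q x powr (- 1 / 2)) \<le> (p - 1) / (n - p) * profile (x \<bullet> e)"
          using p1 pn by (intro mult_left_mono) auto
        moreover have "(p - 1) / (n - p) * (c * (\<beta> - 1) * Q x powr (- 1 / 2)) = c * Q x powr (- 1 / 2)"
        proof -
          have "(p - 1) / (n - p) * (\<beta> - 1) = 1" using beta(3) pn by simp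
          moreover have "(p - 1) / (n - p) * (c * (\<beta> - 1) * Q x powr (- 1 / 2))
            = ((p - 1) / (n - p) * (\<beta> - 1)) * (c * Q x powr (- 1 / 2))" by (simp only: mult_ac)
          ultimately show ?thesis by (simp only: mult_1_left)
        qed
        moreover have "(Q x + \<epsilon>) powr (- 1 / 2) \<le> Q x powr (- 1 / 2)"
          using Qx \<epsilon> by (intro powr_mono2') auto
        then have "c * (Q x + \<epsilon>) powr (- 1 / 2) \<le> c * Q x powr (- 1 / 2)" using c(1) by simp
        ultimately have "c * (Q x + \<epsilon>) powr (- 1 / 2) \<le> (p - 1) / (n - p) * profile (x \<bullet> e)" by linarith
        then have "(c * (Q x + \<epsilon>) powr (- 1 / 2)) powr p \<le> ((p - 1) / (n - p) * profile (x \<bullet> e)) powr p"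
          using p1 c(1) by (intro powr_mono2) auto
        then have "(Q x + \<epsilon>) powr (- g / 2 * p) * (c powr p * (Q x + \<epsilon>) powr (- 1 / 2 * p))
          \<le> (Q x + \<epsilon>) powr (- g / 2 * p) * ((p - 1) / (n - p) * profile (x \<bullet> e)) powr p"
          by (intro mult_left_mono) (simp_all only: powr_mult powr_powr powr_ge_zero)
        moreover have "(Q x + \<epsilon>) powr (- g / 2 * p) * (c powr p * (Q x + \<epsilon>) powr (- 1 / 2 * p)) = c powr p * (Q x + \<epsilon>) powr (- n / 2)"
        proof -
          \<comment> \<open>The critical exponent enters through \<open>(g + 1) * p = n\<close>:
            function and weight together give exactly the divergent power.\<close>
          have "- g / 2 * p + - 1 / 2 * p = - n / 2" using g(2) by (simp add: algebra_simps)
          then have "(Q x + \<epsilon>) powr (- g / 2 * p) * (Q x + \<epsilon>) powr (- 1 / 2 * p) = (Q x + \<epsilon>) powr (- n / 2)"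
            by (simp only: powr_add[symmetric])
          then show ?thesis by (simp only: mult.left_commute)
        qed
        moreover have "\<bar>U x\<bar> powr p = (Q x + \<epsilon>) powr (- g / 2 * p)" using U(3)[OF True] by (simp add: powr_powr)
        ultimately have "c powr p * (Q x + \<epsilon>) powr (- n / 2) \<le> \<bar>U x\<bar> powr p * ((p - 1) / (n - p) * profile (x \<bullet> e)) powr p"
          by (simp only:)
        then show ?thesis using True x\<Omega> by (simp add: ennreal_leI)
      qed simp
    qed
  qed simp
  finally show ?thesis using W by blast
qed

end

theorem theorem1p1:
  fixes \<Omega> :: "((real^'n) \<times> real) set" and p a_star :: real
  assumes n2: "CARD('n) \<ge> 2"
    and p: "1 < p" "p < real CARD('n)"
    and \<Omega>_open: "openin (top_of_set (sphere 0 1)) \<Omega>"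
    and N_in: "north_pole \<in> \<Omega>"
    and \<Omega>_vol: "measure sphere_measure \<Omega> < measure sphere_measure (sphere (0::(real^'n) \<times> real) 1)"
    and a_star: "0 < a_star" "a_star < pi"
    and a_vol: "measure sphere_measure \<Omega> = measure sphere_measure (geo_ball a_star :: ((real^'n) \<times> real) set)"
  shows "(\<forall>u g. W1p0 p \<Omega> u g \<longrightarrow>
            (\<integral>\<^sup>+ x\<in>\<Omega>. ennreal (norm (g x) powr p) \<partial>sphere_measure)
              \<ge> ennreal (((real CARD('n) - p) / p) powr p) *
                (\<integral>\<^sup>+ x\<in>\<Omega>. ennreal (\<bar>u x\<bar> powr p * rho (real CARD('n)) p a_star x powr p) \<partial>sphere_measure))
       \<and> (\<forall>C > ((real CARD('n) - p) / p) powr p. \<exists>u g. W1p0 p \<Omega> u g \<and>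
            (\<integral>\<^sup>+ x\<in>\<Omega>. ennreal (norm (g x) powr p) \<partial>sphere_measure)
              < ennreal C *
                (\<integral>\<^sup>+ x\<in>\<Omega>. ennreal (\<bar>u x\<bar> powr p * rho (real CARD('n)) p a_star x powr p) \<partial>sphere_measure))"
proof -
  define n where "n = real CARD('n)"
  interpret hardy_weight n p a_star using p a_star by unfold_locales (auto simp: n_def)
  let ?e = "north_pole :: (real^'n) \<times> real"
  have e: "norm ?e = 1" by (simp add: north_pole_def norm_prod_def)
  have xe: "x \<bullet> ?e = snd x" for x by (simp add: north_pole_def inner_prod_def)
  have dim: "n = real DIM((real^'n) \<times> real) - 1" "DIM((real^'n) \<times> real) \<ge> 2"
    using n2 by (auto simp: n_def)
  have snd1: "-1 \<le> snd x" "snd x \<le> 1" if "norm x = 1" for x :: "(real^'n) \<times> real"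
    using Cauchy_Schwarz_ineq2[of x ?e] that e by (auto simp: xe abs_le_iff)
  have ball: "geo_ball a_star = {x. norm x = 1 \<and> cos a_star < x \<bullet> ?e}"
  proof -
    have "0 \<le> arccos t \<and> arccos t < a_star \<longleftrightarrow> cos a_star < t" if "-1 \<le> t" "t \<le> 1" for t
    proof -
      have "arccos t < arccos (cos a_star) \<longleftrightarrow> cos a_star < t"
        using that by (intro arccos_less_mono) auto
      then show ?thesis using that a_star by (simp add: arccos_cos arccos_lbound)
    qed
    note ac = this
    show ?thesis
    proof (rule set_eqI)
      fix x :: "(real^'n) \<times> real"
      show "x \<in> geo_ball a_star \<longleftrightarrow> x \<in> {x. norm x = 1 \<and> cos a_star < x \<bullet> ?e}"
        using ac[of "snd x"] snd1[of x] by (auto simp: geo_ball_def theta_def xe)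
    qed
  qed
  \<comment> \<open>At the pole both sides take the truncated value \<open>\<eta> \<tau>\<close>,
    and outside the ball \<open>profile\<close> is constant because
    \<open>cos a_star < cos \<tau>\<close>. The identity is confined to the sphere, where the
    measure is concentrated.\<close>
  have weight: "rho n p a_star x = (p - 1) / (n - p) * profile (x \<bullet> ?e)" if x: "norm x = 1" for x :: "(real^'n) \<times> real"
  proof (cases "x = ?e")
    case True
    then show ?thesis by (simp add: rho_def eta_trunc_def profile_def xe north_pole_def)
  next
    case False
    have "snd x \<noteq> 1" using dist2_sphere[OF x e] False by (auto simp: xe)
    then have lt: "snd x < 1" using snd1(2)[OF x] by simp
    show ?thesis
    proof (cases "x \<in> geo_ball a_star")
      case True
      then show ?thesis using False eta_trunc_arccos[OF snd1(1)[OF x] lt] by (simp add: rho_def theta_def xe)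
    next
      case f: False
      then have "snd x \<le> cos a_star" using x by (simp add: ball xe)
      then show ?thesis using f cos_a_less_cos_\<tau> by (simp add: rho_def eta_trunc_def profile_def xe)
    qed
  qed
  have [measurable]: "\<Omega> \<in> sets borel"
  proof -
    obtain T where "open T" "\<Omega> = sphere 0 1 \<inter> T" using \<Omega>_open unfolding openin_open by blast
    then show ?thesis by (simp only:) (intro sets.Int borel_closed borel_open closed_sphere)
  qed
  \<comment> \<open>The factor \<open>n - p\<close> of the Hardy constant cancels against the
    normalisation of \<open>rho\<close>.\<close>
  have const: "((n - p) / p) powr p * ((p - 1) / (n - p) * profile t) powr p = c\<^sub>0 * profile t powr p" for t
  proof -
    have "(n - p) / p * ((p - 1) / (n - p) * profile t) = (p - 1) / p * profile t" using pn by simp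
    then show ?thesis by (simp only: powr_mult[symmetric] c\<^sub>0_def)
  qed
  have rho_int: "(\<integral>\<^sup>+x\<in>\<Omega>. ennreal (\<bar>u x\<bar> powr p * rho n p a_star x powr p) \<partial>sphere_measure)
     = (\<integral>\<^sup>+x\<in>\<Omega>. ennreal (\<bar>u x\<bar> powr p * ((p - 1) / (n - p) * profile (x \<bullet> ?e)) powr p) \<partial>sphere_measure)" for u
    by (rule nn_integral_cong_AE) (use AE_sphere_measure in \<open>eventually_elim, simp add: weight\<close>)
  show ?thesis
    unfolding n_def[symmetric] rho_int
  proof (intro conjI allI impI)
    fix u g assume ug: "W1p0 p \<Omega> u g"
    then have [measurable]: "u \<in> borel_measurable borel" by (simp add: W1p0_def)
    have "ennreal (((n - p) / p) powr p) * (\<integral>\<^sup>+x\<in>\<Omega>. ennreal (\<bar>u x\<bar> powr p * ((p - 1) / (n - p) * profile (x \<bullet> ?e)) powr p) \<partial>sphere_measure)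
      = (\<integral>\<^sup>+x. ennreal (((n - p) / p) powr p) * (ennreal (\<bar>u x\<bar> powr p * ((p - 1) / (n - p) * profile (x \<bullet> ?e)) powr p) * indicator \<Omega> x) \<partial>sphere_measure)"
      by (rule nn_integral_cmult[symmetric]) measurable
    also have "\<dots> = (\<integral>\<^sup>+x\<in>\<Omega>. ennreal (\<bar>u x\<bar> powr p * (c\<^sub>0 * profile (x \<bullet> ?e) powr p)) \<partial>sphere_measure)"
    proof (rule nn_integral_cong)
      fix x
      show "ennreal (((n - p) / p) powr p) * (ennreal (\<bar>u x\<bar> powr p * ((p - 1) / (n - p) * profile (x \<bullet> ?e)) powr p) * indicator \<Omega> x)
        = ennreal (\<bar>u x\<bar> powr p * (c\<^sub>0 * profile (x \<bullet> ?e) powr p)) * indicator \<Omega> x"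
        unfolding const[symmetric] mult.assoc[symmetric]
        by (subst ennreal_mult[symmetric]) (auto simp: mult_ac)
    qed
    also have "\<dots> \<le> (\<integral>\<^sup>+x\<in>\<Omega>. ennreal (norm (g x) powr p) \<partial>sphere_measure)"
    proof (rule W1p0_hardy_closure[OF p(1) _ _ _ _ ug])
      show "0 \<le> c\<^sub>0 * profile (x \<bullet> ?e) powr p" for x by (simp add: c\<^sub>0_def)
      show "(\<integral>\<^sup>+x\<in>\<Omega>. ennreal (\<bar>U x\<bar> powr p * min (c\<^sub>0 * profile (x \<bullet> ?e) powr p) M) \<partial>sphere_measure)
        \<le> (\<integral>\<^sup>+x\<in>\<Omega>. ennreal (norm (tgrad G x) powr p) \<partial>sphere_measure)"
        if "C1c_on_sphere \<Omega> U G" "0 \<le> M" for U G M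
        by (rule hardy_C1c[OF e dim \<Omega>_open N_in \<Omega>_vol _ that]) (use a_vol in \<open>simp add: ball\<close>)
    qed measurable
    finally show "ennreal (((n - p) / p) powr p) * (\<integral>\<^sup>+x\<in>\<Omega>. ennreal (\<bar>u x\<bar> powr p * ((p - 1) / (n - p) * profile (x \<bullet> ?e)) powr p) \<partial>sphere_measure)
      \<le> (\<integral>\<^sup>+x\<in>\<Omega>. ennreal (norm (g x) powr p) \<partial>sphere_measure)" .
  next
    fix C assume "((n - p) / p) powr p < C"
    then show "\<exists>u g. W1p0 p \<Omega> u g \<and> (\<integral>\<^sup>+x\<in>\<Omega>. ennreal (norm (g x) powr p) \<partial>sphere_measure)
      < ennreal C * (\<integral>\<^sup>+x\<in>\<Omega>. ennreal (\<bar>u x\<bar> powr p * ((p - 1) / (n - p) * profile (x \<bullet> ?e)) powr p) \<partial>sphere_measure)"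
      by (rule hardy_constant_sharp[OF e dim \<Omega>_open N_in])
  qed
qed

end
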